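(* For every $n\ge 1$, the group $G_n=\mathrm{Aut}_{K\text{-alg}}(\mathbb{S}_n)$ is the iterated semidirect product $$G_n = S_n\ltimes \mathbb{T}^n\ltimes \mathrm{Inn}(\mathbb{S}_n)$$ (meaning $S_n\ltimes(\mathbb{T}^n\ltimes\mathrm{Inn}(\mathbb{S}_n))$): $\mathrm{Inn}(\mathbb{S}_n)$ and $\mathbb{T}^n\ltimes\mathrm{Inn}(\mathbb{S}_n)$ are normal subgroups of $G_n$, and every $\sigma\in G_n$ can be written uniquely as $\sigma=\tau\, t_\lambda\, \omega$ with $\tau\in S_n$, $t_\lambda\in\mathbb{T}^n$, $\omega\in \mathrm{Inn}(\mathbb{S}_n)$.
   Context: $K$ is a field of characteristic zero and $n\ge1$. $\mathbb{S}_n$ is the $K$-algebra generated by $x_1,\dots,x_n,y_1,\dots,y_n$ subject to the defining relations $y_1x_1=\cdots=y_nx_n=1$ and $[x_i,y_j]=[x_i,x_j]=[y_i,y_j]=0$ for all $i\ne j$ (where $[a,b]=ab-ba$). $G_n:=\mathrm{Aut}_{K\text{-alg}}(\mathbb{S}_n)$. The torus $\mathbb{T}^n=\{t_\lambda\mid \lambda=(\lambda_1,\dots,\lambda_n)\in (K^* )^n\}$ consists of the automorphisms $t_\lambda(x_i)=\lambda_ix_i$, $t_\lambda(y_i)=\lambda_i^{-1}y_i$. The symmetric group $S_n$ is identified with the automorphisms $\tau(x_i)=x_{\tau(i)}$, $\tau(y_i)=y_{\tau(i)}$. $\mathbb{S}_n^*$ is the group of units of $\mathbb{S}_n$, and $\mathrm{Inn}(\mathbb{S}_n)=\{\omega_u: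 a\mapsto uau^{-1}\mid u\in\mathbb{S}_n^*\}$ is the group of inner automorphisms. *)

theory Defs
  imports "HOL-Algebra.Algebra"
begin

text \<open>The algebra S_n is constructed literally as in the paper: the free associative
  K-algebra on the letters x_1..x_n, y_1..y_n (finitely supported K-valued functions on
  words, with concatenation-convolution product) modulo the two-sided ideal generated
  by the defining relations.\<close>

datatype letter = Lx nat | Ly nat

definition letters :: "nat \<Rightarrow> letter set" where
  "letters n = {Lx i | i. i \<in> {1..n}} \<union> {Ly i | i. i \<in> {1..n}}"

definition free_alg :: "'k itself \<Rightarrow> nat \<Rightarrow> (letter list \<Rightarrow> 'k::field) ring" where
  "free_alg K n =
    \<lparr>carrier = {f. finite {w. f w \<noteq> 0} \<and> (\<forall>w. f w \<noteq> 0 \<longrightarrow> set w \<subseteq> letters n)},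
     Group.monoid.mult = (\<lambda>f g w. \<Sum>i\<le>length w. f (take i w) * g (drop i w)),
     Group.monoid.one = (\<lambda>w. if w = [] then 1 else 0),
     Ring.ring.zero = (\<lambda>w. 0),
     Ring.ring.add = (\<lambda>f g w. f w + g w)\<rparr>"

definition monom :: "letter list \<Rightarrow> letter list \<Rightarrow> 'k::field" where
  "monom u = (\<lambda>w. if w = u then 1 else 0)"

definition commutator :: "letter \<Rightarrow> letter \<Rightarrow> letter list \<Rightarrow> 'k::field" where
  "commutator a b = (\<lambda>w. monom [a, b] w - monom [b, a] w)"

definition relators :: "'k itself \<Rightarrow> nat \<Rightarrow> (letter list \<Rightarrow> 'k::field) set" where
  "relators K n =
     {(\<lambda>w. monom [Ly i, Lx i] w - monom [] w) | i. i \<in> {1..n}}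
   \<union> {commutator (Lx i) (Ly j) | i j. i \<in> {1..n} \<and> j \<in> {1..n} \<and> i \<noteq> j}
   \<union> {commutator (Lx i) (Lx j) | i j. i \<in> {1..n} \<and> j \<in> {1..n} \<and> i \<noteq> j}
   \<union> {commutator (Ly i) (Ly j) | i j. i \<in> {1..n} \<and> j \<in> {1..n} \<and> i \<noteq> j}"

definition rel_ideal :: "'k itself \<Rightarrow> nat \<Rightarrow> (letter list \<Rightarrow> 'k::field) set" where
  "rel_ideal K n = genideal (free_alg K n) (relators K n)"

definition Sn :: "'k itself \<Rightarrow> nat \<Rightarrow> (letter list \<Rightarrow> 'k::field) set ring" where
  "Sn K n = free_alg K n Quot rel_ideal K n"

definition cls :: "'k itself \<Rightarrow> nat \<Rightarrow> (letter list \<Rightarrow> 'k::field) \<Rightarrow> (letter list \<Rightarrow> 'k) set" where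
  "cls K n f = a_r_coset (free_alg K n) (rel_ideal K n) f"

definition xg :: "'k::field itself \<Rightarrow> nat \<Rightarrow> nat \<Rightarrow> (letter list \<Rightarrow> 'k) set" where
  "xg K n i = cls K n (monom [Lx i])"

definition yg :: "'k::field itself \<Rightarrow> nat \<Rightarrow> nat \<Rightarrow> (letter list \<Rightarrow> 'k) set" where
  "yg K n i = cls K n (monom [Ly i])"

definition scal :: "'k::field itself \<Rightarrow> nat \<Rightarrow> 'k \<Rightarrow> (letter list \<Rightarrow> 'k) set" where
  "scal K n c = cls K n (\<lambda>w. if w = [] then c else 0)"

text \<open>K-algebra automorphisms of S_n: ring automorphisms that are K-linear, i.e. fix the
  scalars; represented extensionally (undefined outside the carrier).\<close>
definition Aut :: "'k::field itself \<Rightarrow> nat \<Rightarrow> ((letter list \<Rightarrow> 'k) set \<Rightarrow> (letter list \<Rightarrow> 'k) set) set" where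
  "Aut K n = {\<sigma>. \<sigma> \<in> ring_iso (Sn K n) (Sn K n) \<and> \<sigma> \<in> extensional (carrier (Sn K n))
                 \<and> (\<forall>c. \<sigma> (scal K n c) = scal K n c)}"

definition Gn :: "'k::field itself \<Rightarrow> nat \<Rightarrow> ((letter list \<Rightarrow> 'k) set \<Rightarrow> (letter list \<Rightarrow> 'k) set) monoid" where
  "Gn K n = \<lparr>carrier = Aut K n,
             Group.monoid.mult = (\<lambda>\<sigma> \<tau>. compose (carrier (Sn K n)) \<sigma> \<tau>),
             Group.monoid.one = restrict id (carrier (Sn K n))\<rparr>"

definition SymG :: "'k::field itself \<Rightarrow> nat \<Rightarrow> ((letter list \<Rightarrow> 'k) set \<Rightarrow> (letter list \<Rightarrow> 'k) set) set" where
  "SymG K n = {\<sigma> \<in> Aut K n. \<exists>\<tau>. bij_betw \<tau> {1..n} {1..n} \<and>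
      (\<forall>i\<in>{1..n}. \<sigma> (xg K n i) = xg K n (\<tau> i) \<and> \<sigma> (yg K n i) = yg K n (\<tau> i))}"

definition Torus :: "'k::field itself \<Rightarrow> nat \<Rightarrow> ((letter list \<Rightarrow> 'k) set \<Rightarrow> (letter list \<Rightarrow> 'k) set) set" where
  "Torus K n = {\<sigma> \<in> Aut K n. \<exists>lam::nat \<Rightarrow> 'k. (\<forall>i\<in>{1..n}. lam i \<noteq> 0) \<and>
      (\<forall>i\<in>{1..n}. \<sigma> (xg K n i) = scal K n (lam i) \<otimes>\<^bsub>Sn K n\<^esub> xg K n i
                 \<and> \<sigma> (yg K n i) = scal K n (inverse (lam i)) \<otimes>\<^bsub>Sn K n\<^esub> yg K n i)}"

definition Inn :: "'k::field itself \<Rightarrow> nat \<Rightarrow> ((letter list \<Rightarrow> 'k) set \<Rightarrow> (letter list \<Rightarrow> 'k) set) set" where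
  "Inn K n = {\<sigma> \<in> Aut K n. \<exists>u \<in> Units (Sn K n).
      \<forall>a \<in> carrier (Sn K n). \<sigma> a = u \<otimes>\<^bsub>Sn K n\<^esub> a \<otimes>\<^bsub>Sn K n\<^esub> inv\<^bsub>Sn K n\<^esub> u}"

end

theory Submission
  imports "HOL-Computational_Algebra.Formal_Laurent_Series" Defs
begin

text \<open>
  The algebra acts faithfully on functions of a multi-index, \<open>x\<^sub>i\<close> and \<open>y\<^sub>i\<close> being the two
  shifts of the \<open>i\<close>-th coordinate. If one lets \<open>x\<^sub>i\<close> act as the scalar \<open>X\<close> of the field of
  Laurent series instead, the kernel is a prime ideal \<open>p\<^sub>i\<close>, generated by \<open>1 - x\<^sub>i y\<^sub>i\<close>. Every
  nonzero ideal contains all matrix units and the intersection of the \<open>p\<^sub>i\<close> consists of finite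
  matrices, so an automorphism \<open>\<sigma>\<close> permutes the \<open>p\<^sub>i\<close>. As \<open>x\<^sub>i\<close> is central modulo \<open>p\<^sub>i\<close>, its image is
  a Laurent unit modulo \<open>p\<^sub>j = \<sigma> p\<^sub>i\<close>, and a dimension count leaves only \<open>\<lambda> x\<^sub>j\<close>.

  After division by a permutation and a torus element, \<open>\<sigma>\<close> preserves each \<open>p\<^sub>i\<close> and fixes \<open>x\<^sub>i\<close>, \<open>y\<^sub>i\<close>
  modulo \<open>p\<^sub>i\<close>. The matrix \<open>\<phi>\<close> with columns \<open>\<sigma> (E\<^sub>\<beta>\<^sub>0) v\<close> satisfies \<open>\<sigma> a \<phi> = \<phi> a\<close>, hence commutes with
  \<open>x\<^sub>i\<close> and \<open>y\<^sub>i\<close> up to matrices with bounded \<open>i\<close>-th coordinates; therefore it is constant along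
  diagonals outside bounded ranges, which means that it belongs to the algebra. The same applies to
  the inverse of \<open>\<sigma>\<close>, the products of the two elements are central, hence scalars, and \<open>\<sigma>\<close> is inner.
  Uniqueness is read off from the characters \<open>x\<^sub>i \<mapsto> \<mu>\<^sub>i\<close>, which do not see inner automorphisms.
\<close>

section \<open>The free algebra and its quotient\<close>

text \<open>The matrix units with second index 0 span a left ideal isomorphic to the simple faithful
  module of polynomials, and \<sigma> carries it to the twisted module. A matrix comparing the two
  therefore always exists; the obstacle is to place it in the algebra, and this is where the
  behaviour of \<sigma> modulo every prime is used. Invertibility comes from symmetry: the inverse
  automorphism has an intertwiner as well, and nonzero scalar products on both sides make each a
  unit.

  The operators act on all functions, not on finitely supported ones, so that they are given by
  pointwise formulas; that a matrix determines its operator then rests on the finiteness of its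
  rows. Laurent series are a convenient field around the Laurent polynomials, over which
  \<open>x i\<close> and \<open>y i\<close> become inverse scalars and one construction serves for
  all representations.

  Modulo \<open>p i\<close> both \<open>x i\<close> and \<open>y i\<close> are invertible and cannot
  be told apart. Excluding negative exponents needs the Fredholm index, which is visible in a
  representation where the single variable \<open>i\<close> is still a shift; the others may then be
  specialised to 1.\<close>

lemma Collect_supp_add: "{w. f w + g w \<noteq> (0::'k::field)} \<subseteq> {w. f w \<noteq> 0} \<union> {w. g w \<noteq> 0}"
  by auto

locale one_sided_inverses =
  fixes K :: "'k::field itself" and n :: nat
begin

abbreviation R where "R \<equiv> free_alg K n"
abbreviation S where "S \<equiv> Sn K n"
abbreviation I where "I \<equiv> rel_ideal K n"

abbreviation mult_Sn (infixl "\<cdot>" 70) where "a \<cdot> b \<equiv> a \<otimes>\<^bsub>Sn K n\<^esub> b"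
abbreviation add_Sn (infixl "\<boxplus>" 65) where "a \<boxplus> b \<equiv> a \<oplus>\<^bsub>Sn K n\<^esub> b"
abbreviation minus_Sn (infixl "\<boxminus>" 65) where "a \<boxminus> b \<equiv> a \<ominus>\<^bsub>Sn K n\<^esub> b"

lemma carrier_free_alg_iff:
  "f \<in> carrier R \<longleftrightarrow> finite {w. f w \<noteq> 0} \<and> (\<forall>w. f w \<noteq> 0 \<longrightarrow> set w \<subseteq> letters n)"
  by (simp add: free_alg_def)

lemma mult_free_alg: "(f \<otimes>\<^bsub>R\<^esub> g) w = (\<Sum>i\<le>length w. f (take i w) * g (drop i w))"
  and add_free_alg: "(f \<oplus>\<^bsub>R\<^esub> g) w = f w + g w"
  and one_free_alg: "\<one>\<^bsub>R\<^esub> w = (if w = [] then 1 else 0)"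
  and zero_free_alg: "\<zero>\<^bsub>R\<^esub> w = 0"
  by (simp_all add: free_alg_def)

lemma mult_free_alg_nonzeroD:
  assumes "(f \<otimes>\<^bsub>R\<^esub> g) w \<noteq> 0"
  obtains u v where "w = u @ v" "f u \<noteq> 0" "g v \<noteq> 0"
proof -
  from assms obtain i where "f (take i w) * g (drop i w) \<noteq> 0"
    unfolding mult_free_alg by (meson sum.not_neutral_contains_not_neutral)
  then show ?thesis using that[of "take i w" "drop i w"] by auto
qed

text \<open>Both sides sum over the ways to cut \<open>w\<close> into three pieces. The left records
  the end positions of the first two pieces, the right their lengths; the reindexing passes from
  positions to lengths.\<close>

lemma mult_free_alg_assoc: "f \<otimes>\<^bsub>R\<^esub> g \<otimes>\<^bsub>R\<^esub> h = f \<otimes>\<^bsub>R\<^esub> (g \<otimes>\<^bsub>R\<^esub> h)"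
proof
  fix w
  let ?F = "\<lambda>j k. f (take j w) * g (take k (drop j w)) * h (drop (j + k) w)"
  have "(f \<otimes>\<^bsub>R\<^esub> g \<otimes>\<^bsub>R\<^esub> h) w = (\<Sum>i\<le>length w. \<Sum>j\<le>i. ?F j (i - j))"
    by (auto simp: mult_free_alg sum_distrib_right min_absorb1 min_absorb2 drop_take
        intro!: sum.cong)
  also have "\<dots> = (\<Sum>(i, j)\<in>Sigma {..length w} (\<lambda>i. {..i}). ?F j (i - j))"
    by (rule sum.Sigma) auto
  also have "\<dots> = (\<Sum>(j, k)\<in>Sigma {..length w} (\<lambda>j. {..length w - j}). ?F j k)"
    by (rule sum.reindex_bij_witness[where i = "\<lambda>(j, k). (j + k, j)" and j = "\<lambda>(i, j). (j, i - j)"]) auto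
  also have "\<dots> = (\<Sum>j\<le>length w. \<Sum>k\<le>length w - j. ?F j k)"
    by (simp add: sum.Sigma)
  also have "\<dots> = (f \<otimes>\<^bsub>R\<^esub> (g \<otimes>\<^bsub>R\<^esub> h)) w"
    by (auto simp: mult_free_alg sum_distrib_left mult.assoc add.commute intro!: sum.cong)
  finally show "(f \<otimes>\<^bsub>R\<^esub> g \<otimes>\<^bsub>R\<^esub> h) w = (f \<otimes>\<^bsub>R\<^esub> (g \<otimes>\<^bsub>R\<^esub> h)) w" .
qed

lemma mult_free_alg_closed:
  assumes "f \<in> carrier R" "g \<in> carrier R"
  shows "f \<otimes>\<^bsub>R\<^esub> g \<in> carrier R"
proof -
  have "{w. (f \<otimes>\<^bsub>R\<^esub> g) w \<noteq> 0} \<subseteq> (\<lambda>(u, v). u @ v) ` ({w. f w \<noteq> 0} \<times> {w. g w \<noteq> 0})"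
    by (auto elim!: mult_free_alg_nonzeroD)
  moreover have "finite ((\<lambda>(u, v). u @ v) ` ({w. f w \<noteq> 0} \<times> {w. g w \<noteq> 0}))"
    using assms by (simp add: carrier_free_alg_iff)
  ultimately have "finite {w. (f \<otimes>\<^bsub>R\<^esub> g) w \<noteq> 0}" by (rule finite_subset)
  moreover have "set w \<subseteq> letters n" if "(f \<otimes>\<^bsub>R\<^esub> g) w \<noteq> 0" for w
    using that assms unfolding carrier_free_alg_iff by (elim mult_free_alg_nonzeroD) simp
  ultimately show ?thesis by (simp add: carrier_free_alg_iff)
qed

lemma ring_free_alg: "ring R"
proof (rule ringI)
  show "abelian_group R"
  proof (rule abelian_groupI)
    fix f g assume fg: "f \<in> carrier R" "g \<in> carrier R"
    have "finite {w. f w + g w \<noteq> 0}"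
      by (rule finite_subset[OF Collect_supp_add]) (use fg in \<open>simp add: carrier_free_alg_iff\<close>)
    then show "f \<oplus>\<^bsub>R\<^esub> g \<in> carrier R"
      using fg by (simp add: carrier_free_alg_iff add_free_alg) (metis add.right_neutral add_cancel_right_left)
  next
    fix f assume "f \<in> carrier R"
    then show "\<exists>g\<in>carrier R. g \<oplus>\<^bsub>R\<^esub> f = \<zero>\<^bsub>R\<^esub>"
      by (intro bexI[of _ "\<lambda>w. - f w"]) (auto simp: carrier_free_alg_iff fun_eq_iff add_free_alg zero_free_alg)
  qed (auto simp: carrier_free_alg_iff fun_eq_iff add_free_alg zero_free_alg)
  show "monoid R"
  proof (rule monoidI)
    fix f assume "f \<in> carrier R"
    have *: "(\<Sum>i\<le>length w. (if take i w = [] then 1 else 0) * f (drop i w)) = f w" for w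
    proof -
      have "(\<Sum>i\<le>length w. (if take i w = [] then 1 else 0) * f (drop i w))
          = (\<Sum>i\<le>length w. if i = 0 then f w else 0)"
        by (intro sum.cong) auto
      then show ?thesis by simp
    qed
    show "\<one>\<^bsub>R\<^esub> \<otimes>\<^bsub>R\<^esub> f = f"
      by (simp add: fun_eq_iff mult_free_alg one_free_alg * del: take_eq_Nil)
    have *: "(\<Sum>i\<le>length w. f (take i w) * (if drop i w = [] then 1 else 0)) = f w" for w
    proof -
      have "(\<Sum>i\<le>length w. f (take i w) * (if drop i w = [] then 1 else 0))
          = (\<Sum>i\<le>length w. if i = length w then f w else 0)"
        by (intro sum.cong) auto
      then show ?thesis by simp
    qed
    show "f \<otimes>\<^bsub>R\<^esub> \<one>\<^bsub>R\<^esub> = f"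
      by (simp add: fun_eq_iff mult_free_alg one_free_alg * del: drop_eq_Nil)
  next
    show "\<one>\<^bsub>R\<^esub> \<in> carrier R" by (simp add: carrier_free_alg_iff one_free_alg)
  qed (simp_all add: mult_free_alg_closed mult_free_alg_assoc)
qed (auto simp: fun_eq_iff mult_free_alg add_free_alg algebra_simps sum.distrib)

sublocale R: ring R by (rule ring_free_alg)

lemma monom_carrier: "set w \<subseteq> letters n \<Longrightarrow> monom w \<in> carrier R"
  by (auto simp: carrier_free_alg_iff monom_def)

text \<open>Relators and coset differences are written pointwise, while ideal theory speaks of the
  ring operation \<ominus>; this identifies the two.\<close>

lemma diff_carrier:
  assumes "f \<in> carrier R" "g \<in> carrier R"
  shows "(\<lambda>w. f w - g w) \<in> carrier R" and "f \<ominus>\<^bsub>R\<^esub> g = (\<lambda>w. f w - g w)"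
proof -
  have neg: "(\<lambda>w. - g w) \<in> carrier R" using assms by (simp add: carrier_free_alg_iff)
  have "(\<lambda>w. - g w) \<oplus>\<^bsub>R\<^esub> g = \<zero>\<^bsub>R\<^esub>" by (simp add: fun_eq_iff add_free_alg zero_free_alg)
  then have "\<ominus>\<^bsub>R\<^esub> g = (\<lambda>w. - g w)" using neg assms(2) R.minus_equality by blast
  then show eq: "f \<ominus>\<^bsub>R\<^esub> g = (\<lambda>w. f w - g w)"
    by (simp add: a_minus_def fun_eq_iff add_free_alg)
  show "(\<lambda>w. f w - g w) \<in> carrier R" using R.minus_closed[OF assms] by (simp add: eq)
qed

lemma letters_iff [simp]: "Lx i \<in> letters n \<longleftrightarrow> i \<in> {1..n}" "Ly i \<in> letters n \<longleftrightarrow> i \<in> {1..n}"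
  by (auto simp: letters_def)

lemma relators_carrier: "relators K n \<subseteq> carrier R"
  unfolding relators_def commutator_def
  by (auto intro!: diff_carrier(1) monom_carrier)

sublocale I: ideal I R
  unfolding rel_ideal_def by (rule R.genideal_ideal[OF relators_carrier])

lemma ring_Sn: "ring S"
  unfolding Sn_def by (rule I.quotient_is_ring)

sublocale S: ring S by (rule ring_Sn)

abbreviation cl where "cl \<equiv> cls K n"

lemma cls_hom: "cl \<in> ring_hom R S"
  unfolding Sn_def using I.rcos_ring_hom by (simp add: cls_def[abs_def])

lemma cls_closed [simp]: "f \<in> carrier R \<Longrightarrow> cl f \<in> carrier S"
  and cls_mult: "f \<in> carrier R \<Longrightarrow> g \<in> carrier R \<Longrightarrow> cl (f \<otimes>\<^bsub>R\<^esub> g) = cl f \<cdot> cl g"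
  and cls_add: "f \<in> carrier R \<Longrightarrow> g \<in> carrier R \<Longrightarrow> cl (f \<oplus>\<^bsub>R\<^esub> g) = cl f \<boxplus> cl g"
  and cls_one: "cl \<one>\<^bsub>R\<^esub> = \<one>\<^bsub>S\<^esub>"
  using cls_hom by (auto simp: ring_hom_def)

lemma cls_zero: "cl \<zero>\<^bsub>R\<^esub> = \<zero>\<^bsub>S\<^esub>"
  using ring_hom_zero[OF cls_hom ring_free_alg ring_Sn] .

lemma cls_surj:
  assumes "a \<in> carrier S" obtains f where "f \<in> carrier R" "a = cl f"
  using assms that unfolding Sn_def cls_def FactRing_def A_RCOSETS_def' by auto

lemma cls_eq_iff:
  assumes "f \<in> carrier R" "g \<in> carrier R"
  shows "cl f = cl g \<longleftrightarrow> (\<lambda>w. f w - g w) \<in> I"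
  using R.quotient_eq_iff_same_a_r_cos[OF I.is_ideal assms] diff_carrier(2)[OF assms]
  by (simp add: cls_def)

end

section \<open>Representations by shifts and scalars\<close>

text \<open>A parameter \<open>\<theta> i = 0\<close> means that \<open>x\<^sub>i\<close> shifts the \<open>i\<close>-th coordinate, a nonzero one that it
  acts as this scalar.\<close>

definition xop :: "(nat \<Rightarrow> 'l::field) \<Rightarrow> nat \<Rightarrow> ((nat \<Rightarrow> nat) \<Rightarrow> 'l) \<Rightarrow> (nat \<Rightarrow> nat) \<Rightarrow> 'l" where
  "xop \<theta> i g \<alpha> = (if \<theta> i \<noteq> 0 then \<theta> i * g \<alpha>
     else if \<alpha> i = 0 then 0 else g (\<alpha>(i := \<alpha> i - 1)))"

definition yop :: "(nat \<Rightarrow> 'l::field) \<Rightarrow> nat \<Rightarrow> ((nat \<Rightarrow> nat) \<Rightarrow> 'l) \<Rightarrow> (nat \<Rightarrow> nat) \<Rightarrow> 'l" where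
  "yop \<theta> i g \<alpha> = (if \<theta> i \<noteq> 0 then inverse (\<theta> i) * g \<alpha> else g (\<alpha>(i := Suc (\<alpha> i))))"

fun lop :: "(nat \<Rightarrow> 'l::field) \<Rightarrow> letter \<Rightarrow> ((nat \<Rightarrow> nat) \<Rightarrow> 'l) \<Rightarrow> (nat \<Rightarrow> nat) \<Rightarrow> 'l" where
  "lop \<theta> (Lx i) = xop \<theta> i"
| "lop \<theta> (Ly i) = yop \<theta> i"

fun wop :: "(nat \<Rightarrow> 'l::field) \<Rightarrow> letter list \<Rightarrow> ((nat \<Rightarrow> nat) \<Rightarrow> 'l) \<Rightarrow> (nat \<Rightarrow> nat) \<Rightarrow> 'l" where
  "wop \<theta> [] g = g"
| "wop \<theta> (a # w) g = lop \<theta> a (wop \<theta> w g)"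

lemma yop_xop_same: "yop \<theta> i (xop \<theta> i g) = g"
  by (auto simp: xop_def yop_def fun_eq_iff)

lemma xop_xop_commute: "i \<noteq> j \<Longrightarrow> xop \<theta> i (xop \<theta> j g) = xop \<theta> j (xop \<theta> i g)"
  by (auto simp: xop_def fun_eq_iff fun_upd_twist)

lemma yop_yop_commute: "i \<noteq> j \<Longrightarrow> yop \<theta> i (yop \<theta> j g) = yop \<theta> j (yop \<theta> i g)"
  by (auto simp: yop_def fun_eq_iff fun_upd_twist)

lemma xop_yop_commute: "i \<noteq> j \<Longrightarrow> xop \<theta> i (yop \<theta> j g) = yop \<theta> j (xop \<theta> i g)"
  by (auto simp: xop_def yop_def fun_eq_iff fun_upd_twist)

lemma wop_append: "wop \<theta> (u @ v) g = wop \<theta> u (wop \<theta> v g)"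
  by (induction u) auto

lemma wop_add: "wop \<theta> w (\<lambda>\<alpha>. g \<alpha> + h \<alpha>) = (\<lambda>\<alpha>. wop \<theta> w g \<alpha> + wop \<theta> w h \<alpha>)"
proof (induction w)
  case (Cons a w)
  then show ?case by (cases a) (auto simp: xop_def yop_def fun_eq_iff algebra_simps)
qed auto

lemma wop_scale: "wop \<theta> w (\<lambda>\<alpha>. c * g \<alpha>) = (\<lambda>\<alpha>. c * wop \<theta> w g \<alpha>)"
proof (induction w)
  case (Cons a w)
  then show ?case by (cases a) (auto simp: xop_def yop_def fun_eq_iff algebra_simps)
qed auto

lemma wop_sum: "wop \<theta> w (\<lambda>\<alpha>. \<Sum>j\<in>J. c j * h j \<alpha>) \<alpha> = (\<Sum>j\<in>J. c j * wop \<theta> w (h j) \<alpha>)"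
proof (induction J rule: infinite_finite_induct)
  case (insert j J)
  then show ?case by (simp add: wop_add wop_scale)
qed (use wop_scale[of \<theta> w 0 "\<lambda>_. 0"] in \<open>simp_all add: fun_eq_iff\<close>)

text \<open>\<open>\<kappa>\<close> embeds the coefficient field into the field over which the
  representation lives. Enlarging the field is what allows a generator to act as an
  indeterminate.\<close>

locale sn_rep = one_sided_inverses K n
  for K :: "'k::field itself" and n :: nat +
  fixes \<kappa> :: "'k \<Rightarrow> 'l::field" and \<theta> :: "nat \<Rightarrow> 'l"
  assumes \<kappa>_add: "\<kappa> (a + b) = \<kappa> a + \<kappa> b"
    and \<kappa>_mult: "\<kappa> (a * b) = \<kappa> a * \<kappa> b"
    and \<kappa>_one [simp]: "\<kappa> 1 = 1"
begin

lemma \<kappa>_zero [simp]: "\<kappa> 0 = 0"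
  using \<kappa>_add[of 0 0] by (metis add.right_neutral add_left_cancel)

lemma \<kappa>_sum: "\<kappa> (sum f J) = (\<Sum>j\<in>J. \<kappa> (f j))"
  by (induction J rule: infinite_finite_induct) (auto simp: \<kappa>_add)

lemma \<kappa>_nonzero: "a \<noteq> 0 \<Longrightarrow> \<kappa> a \<noteq> 0"
  using \<kappa>_mult[of a "inverse a"] by auto

definition act :: "(letter list \<Rightarrow> 'k) \<Rightarrow> ((nat \<Rightarrow> nat) \<Rightarrow> 'l) \<Rightarrow> (nat \<Rightarrow> nat) \<Rightarrow> 'l" where
  "act f g \<alpha> = (\<Sum>w | f w \<noteq> 0. \<kappa> (f w) * wop \<theta> w g \<alpha>)"

text \<open>Supports shrink under cancellation, so elements with different supports are compared
  over a common finite set of words.\<close>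

lemma act_superset:
  assumes "finite W" "{w. f w \<noteq> 0} \<subseteq> W"
  shows "act f g \<alpha> = (\<Sum>w\<in>W. \<kappa> (f w) * wop \<theta> w g \<alpha>)"
  unfolding act_def by (rule sum.mono_neutral_left) (use assms in auto)

lemma act_add:
  assumes "f \<in> carrier R" "g \<in> carrier R"
  shows "act (f \<oplus>\<^bsub>R\<^esub> g) h \<alpha> = act f h \<alpha> + act g h \<alpha>"
proof -
  let ?W = "{w. f w \<noteq> 0} \<union> {w. g w \<noteq> 0}"
  have fin: "finite ?W" using assms by (simp add: carrier_free_alg_iff)
  have "act (f \<oplus>\<^bsub>R\<^esub> g) h \<alpha> = (\<Sum>w\<in>?W. \<kappa> (f w + g w) * wop \<theta> w h \<alpha>)"
    by (subst act_superset[OF fin]) (auto simp: add_free_alg)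
  also have "\<dots> = act f h \<alpha> + act g h \<alpha>"
    using act_superset[OF fin, of f] act_superset[OF fin, of g]
    by (simp add: \<kappa>_add algebra_simps sum.distrib)
  finally show ?thesis .
qed

lemma act_diff:
  assumes "f \<in> carrier R" "g \<in> carrier R"
  shows "act (\<lambda>w. f w - g w) h \<alpha> = act f h \<alpha> - act g h \<alpha>"
proof -
  have "(\<lambda>w. f w - g w) \<oplus>\<^bsub>R\<^esub> g = f" by (simp add: fun_eq_iff add_free_alg)
  then show ?thesis using act_add[OF diff_carrier(1)[OF assms] assms(2), of h \<alpha>] by simp
qed

text \<open>The convolution runs over cuts of a word, the composition over pairs of words; the pair
  \<open>(u, v)\<close> corresponds to the word \<open>u @ v\<close> cut after \<open>u\<close>. All
  concatenations of support words form \<open>W\<close>, which contains the support of the product,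
  and cuts with a piece outside its support contribute zero.\<close>

lemma act_mult:
  assumes f: "f \<in> carrier R" and g: "g \<in> carrier R"
  shows "act (f \<otimes>\<^bsub>R\<^esub> g) h \<alpha> = act f (act g h) \<alpha>"
proof -
  let ?F = "{w. f w \<noteq> 0}" and ?G = "{w. g w \<noteq> 0}"
  define W where "W = (\<lambda>(u, v). u @ v) ` (?F \<times> ?G)"
  let ?t = "\<lambda>u v. \<kappa> (f u) * (\<kappa> (g v) * wop \<theta> u (wop \<theta> v h) \<alpha>)"
  have fin: "finite ?F" "finite ?G" using f g by (auto simp: carrier_free_alg_iff)
  then have W: "finite W" by (auto simp: W_def)
  have "act (f \<otimes>\<^bsub>R\<^esub> g) h \<alpha> = (\<Sum>w\<in>W. \<kappa> ((f \<otimes>\<^bsub>R\<^esub> g) w) * wop \<theta> w h \<alpha>)"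
    by (rule act_superset[OF W]) (auto simp: W_def elim!: mult_free_alg_nonzeroD)
  also have "\<dots> = (\<Sum>w\<in>W. \<Sum>i\<le>length w. ?t (take i w) (drop i w))"
    by (auto simp: mult_free_alg \<kappa>_sum \<kappa>_mult sum_distrib_right mult.assoc
        simp flip: wop_append intro!: sum.cong)
  also have "\<dots> = (\<Sum>(w, i)\<in>Sigma W (\<lambda>w. {..length w}). ?t (take i w) (drop i w))"
    by (rule sum.Sigma) (use W in auto)
  also have "\<dots> = (\<Sum>(u, v)\<in>{(u, v). u @ v \<in> W}. ?t u v)"
    by (rule sum.reindex_bij_witness[where i = "\<lambda>(u, v). (u @ v, length u)"
          and j = "\<lambda>(w, i). (take i w, drop i w)"]) auto
  also have "\<dots> = (\<Sum>(u, v)\<in>?F \<times> ?G. ?t u v)"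
  proof (rule sum.mono_neutral_right)
    have "{(u, v). u @ v \<in> W} \<subseteq> (\<lambda>(w, i). (take i w, drop i w)) ` Sigma W (\<lambda>w. {..length w})"
    proof clarify
      fix u v assume "u @ v \<in> W"
      then show "(u, v) \<in> (\<lambda>(w, i). (take i w, drop i w)) ` Sigma W (\<lambda>w. {..length w})"
        by (intro image_eqI[of _ _ "(u @ v, length u)"]) auto
    qed
    then show "finite {(u, v). u @ v \<in> W}" by (rule finite_subset) (use W in auto)
  qed (auto simp: W_def)
  also have "\<dots> = (\<Sum>u\<in>?F. \<kappa> (f u) * wop \<theta> u (\<lambda>\<beta>. \<Sum>v\<in>?G. \<kappa> (g v) * wop \<theta> v h \<beta>) \<alpha>)"
    by (simp add: wop_sum sum_distrib_left sum.cartesian_product)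
  also have "\<dots> = act f (act g h) \<alpha>"
    by (simp add: act_def[abs_def])
  finally show ?thesis .
qed

lemma act_monom: "act (monom w) g \<alpha> = wop \<theta> w g \<alpha>"
  by (simp add: act_def monom_def)

lemma act_zero_arg: "act f (\<lambda>_. 0) \<alpha> = 0"
proof -
  have "wop \<theta> w (\<lambda>_. 0) = (\<lambda>_. 0)" for w using wop_scale[of \<theta> w 0 "\<lambda>_. 0"] by simp
  then show ?thesis by (simp add: act_def)
qed

text \<open>Provides the two-sided ideal with which the ideal generated by the relators is
  compared.\<close>

lemma ideal_act_kernel: "ideal {f \<in> carrier R. \<forall>g \<alpha>. act f g \<alpha> = 0} R" (is "ideal ?J R")
proof (rule idealI)
  show "subgroup ?J (add_monoid R)"
  proof (rule R.add.subgroupI)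
    show "?J \<noteq> {}" by (auto simp: act_def zero_free_alg intro!: exI[of _ "\<zero>\<^bsub>R\<^esub>"])
  next
    fix f assume f: "f \<in> ?J"
    have "act (\<ominus>\<^bsub>R\<^esub> f) g \<alpha> = 0" for g \<alpha>
    proof -
      have "act (\<ominus>\<^bsub>R\<^esub> f \<oplus>\<^bsub>R\<^esub> f) g \<alpha> = 0"
        using f by (simp add: R.l_neg act_def zero_free_alg)
      then show ?thesis using f by (subst (asm) act_add) auto
    qed
    then show "\<ominus>\<^bsub>R\<^esub> f \<in> ?J" using f by simp
  qed (auto simp: act_add)
next
  fix f g assume "f \<in> ?J" "g \<in> carrier R"
  then have "act f = (\<lambda>h \<alpha>. 0)" "f \<in> carrier R" by (auto simp: fun_eq_iff)
  then show "g \<otimes>\<^bsub>R\<^esub> f \<in> ?J" "f \<otimes>\<^bsub>R\<^esub> g \<in> ?J"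
    using \<open>g \<in> carrier R\<close> by (simp_all add: act_mult act_zero_arg)
qed (rule ring_free_alg)

lemma act_rel_ideal:
  assumes "f \<in> I" shows "act f g \<alpha> = 0"
proof -
  have "relators K n \<subseteq> {f \<in> carrier R. \<forall>g \<alpha>. act f g \<alpha> = 0}"
  proof
    fix f assume f: "f \<in> relators K n"
    have "act f g \<alpha> = 0" for g \<alpha>
      using f unfolding relators_def commutator_def
      by (auto simp: act_diff monom_carrier act_monom yop_xop_same
          xop_xop_commute yop_yop_commute xop_yop_commute)
    then show "f \<in> {f \<in> carrier R. \<forall>g \<alpha>. act f g \<alpha> = 0}" using f relators_carrier by auto
  qed
  from R.genideal_minimal[OF ideal_act_kernel this] assms show ?thesis
    unfolding rel_ideal_def by auto
qed

text \<open>Elements of the quotient are cosets, so a representative is chosen; the choice does not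
  matter because the ideal acts as zero.\<close>

definition A :: "(letter list \<Rightarrow> 'k) set \<Rightarrow> ((nat \<Rightarrow> nat) \<Rightarrow> 'l) \<Rightarrow> (nat \<Rightarrow> nat) \<Rightarrow> 'l" where
  "A a = act (SOME f. f \<in> carrier R \<and> cl f = a)"

lemma A_cls: 
  assumes "f \<in> carrier R" shows "A (cl f) = act f"
proof -
  let ?f = "SOME g. g \<in> carrier R \<and> cl g = cl f"
  have f: "?f \<in> carrier R \<and> cl ?f = cl f" by (rule someI[of _ f]) (use assms in auto)
  then have "(\<lambda>w. ?f w - f w) \<in> I" using assms cls_eq_iff by blast
  then have "act ?f h \<alpha> - act f h \<alpha> = 0" for h \<alpha>
    using act_rel_ideal act_diff[of ?f f h \<alpha>] f assms by simp
  then show ?thesis by (simp add: A_def fun_eq_iff)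
qed

lemma A_add: "a \<in> carrier S \<Longrightarrow> b \<in> carrier S \<Longrightarrow> A (a \<boxplus> b) g \<alpha> = A a g \<alpha> + A b g \<alpha>"
  by (elim cls_surj) (simp add: A_cls act_add flip: cls_add)

lemma A_mult: "a \<in> carrier S \<Longrightarrow> b \<in> carrier S \<Longrightarrow> A (a \<cdot> b) g = A a (A b g)"
  by (elim cls_surj) (simp add: fun_eq_iff A_cls act_mult flip: cls_mult)

lemma A_zero [simp]: "A \<zero>\<^bsub>S\<^esub> g \<alpha> = 0"
proof -
  have "A \<zero>\<^bsub>S\<^esub> g \<alpha> = A \<zero>\<^bsub>S\<^esub> g \<alpha> + A \<zero>\<^bsub>S\<^esub> g \<alpha>"
    using A_add[of "\<zero>\<^bsub>S\<^esub>" "\<zero>\<^bsub>S\<^esub>" g \<alpha>] by simp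
  then show ?thesis by (metis add.right_neutral add_left_cancel)
qed

lemma A_uminus: "a \<in> carrier S \<Longrightarrow> A (\<ominus>\<^bsub>S\<^esub> a) g \<alpha> = - A a g \<alpha>"
  using A_add[of "\<ominus>\<^bsub>S\<^esub> a" a g \<alpha>] by (simp add: S.l_neg eq_neg_iff_add_eq_0)

lemma A_diff: "a \<in> carrier S \<Longrightarrow> b \<in> carrier S \<Longrightarrow> A (a \<boxminus> b) g \<alpha> = A a g \<alpha> - A b g \<alpha>"
  by (simp add: a_minus_def A_add A_uminus)

lemma act_one: "act \<one>\<^bsub>R\<^esub> g = g"
  by (simp add: fun_eq_iff act_def one_free_alg)

lemma A_one [simp]: "A \<one>\<^bsub>S\<^esub> g = g"
  by (simp add: A_cls act_one flip: cls_one)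

lemma A_scal: "A (scal K n c) g \<alpha> = \<kappa> c * g \<alpha>"
proof -
  have "(\<lambda>w. if w = [] then c else 0) \<in> carrier R" by (simp add: carrier_free_alg_iff)
  moreover have "act (\<lambda>w. if w = [] then c else 0) g \<alpha> = \<kappa> c * g \<alpha>"
    by (cases "c = 0") (simp_all add: act_def)
  ultimately show ?thesis by (simp add: scal_def A_cls)
qed

lemma A_xg: "i \<in> {1..n} \<Longrightarrow> A (xg K n i) = xop \<theta> i"
  and A_yg: "i \<in> {1..n} \<Longrightarrow> A (yg K n i) = yop \<theta> i"
  by (auto simp: fun_eq_iff xg_def yg_def A_cls monom_carrier act_monom)

lemma A_arg_add: "a \<in> carrier S \<Longrightarrow> A a (\<lambda>\<beta>. g \<beta> + h \<beta>) \<alpha> = A a g \<alpha> + A a h \<alpha>"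
  by (elim cls_surj) (simp add: A_cls act_def wop_add algebra_simps sum.distrib)

lemma A_arg_scale: "a \<in> carrier S \<Longrightarrow> A a (\<lambda>\<beta>. c * g \<beta>) \<alpha> = c * A a g \<alpha>"
  by (elim cls_surj) (simp add: A_cls act_def wop_scale algebra_simps sum_distrib_left)

lemma A_arg_sum: "a \<in> carrier S \<Longrightarrow> A a (\<lambda>\<beta>. \<Sum>j\<in>J. c j * h j \<beta>) \<alpha> = (\<Sum>j\<in>J. c j * A a (h j) \<alpha>)"
proof (induction J rule: infinite_finite_induct)
  case (insert j J)
  then show ?case by (simp add: A_arg_add A_arg_scale)
qed (use A_arg_scale[of a 0 "\<lambda>_. 0"] in simp_all)

end

section \<open>Normal forms and faithfulness\<close>

fun lidx :: "letter \<Rightarrow> nat" where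
  "lidx (Lx i) = i"
| "lidx (Ly i) = i"

definition idx :: "nat set \<Rightarrow> (nat \<Rightarrow> nat) set" where
  "idx L = {\<alpha>. \<forall>j. j \<notin> L \<longrightarrow> \<alpha> j = 0}"

text \<open>The word of a monomial with exponents \<alpha>. The list fixes the order of the blocks,
  since words do not commute.\<close>

definition pw :: "(nat \<Rightarrow> letter) \<Rightarrow> (nat \<Rightarrow> nat) \<Rightarrow> nat list \<Rightarrow> letter list" where
  "pw c \<alpha> l = concat (map (\<lambda>i. replicate (\<alpha> i) (c i)) l)"

definition \<delta> :: "(nat \<Rightarrow> nat) \<Rightarrow> (nat \<Rightarrow> nat) \<Rightarrow> 'l::field" where
  "\<delta> \<beta> = (\<lambda>\<gamma>. if \<gamma> = \<beta> then 1 else 0)"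

lemma pw_Nil [simp]: "pw c \<alpha> [] = []"
  and pw_Cons: "pw c \<alpha> (i # l) = replicate (\<alpha> i) (c i) @ pw c \<alpha> l"
  and pw_append: "pw c \<alpha> (l @ m) = pw c \<alpha> l @ pw c \<alpha> m"
  by (simp_all add: pw_def)

lemma pw_upd_notin: "i \<notin> set l \<Longrightarrow> pw c (\<alpha>(i := k)) l = pw c \<alpha> l"
  by (auto simp: pw_def intro!: arg_cong[where f = concat])

lemma set_pw: "set (pw c \<alpha> l) \<subseteq> c ` set l"
  by (auto simp: pw_def)

lemma wop_replicate_Lx: "\<theta> i = 0 \<Longrightarrow>
    wop \<theta> (replicate k (Lx i)) g \<gamma> = (if k \<le> \<gamma> i then g (\<gamma>(i := \<gamma> i - k)) else 0)"
  by (induction k arbitrary: \<gamma>) (auto simp: xop_def)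

lemma wop_replicate_Ly: "\<theta> i = 0 \<Longrightarrow> wop \<theta> (replicate k (Ly i)) g \<gamma> = g (\<gamma>(i := \<gamma> i + k))"
  by (induction k arbitrary: \<gamma>) (auto simp: yop_def)

lemma wop_pw_Lx:
  assumes "distinct l" "\<forall>i\<in>set l. \<theta> i = 0"
  shows "wop \<theta> (pw Lx \<alpha> l) g \<gamma> =
    (if \<forall>i\<in>set l. \<alpha> i \<le> \<gamma> i then g (\<lambda>i. if i \<in> set l then \<gamma> i - \<alpha> i else \<gamma> i) else 0)"
  using assms
proof (induction l arbitrary: \<gamma>)
  case (Cons a l)
  have "(\<lambda>i. if i \<in> set l then (\<gamma>(a := \<gamma> a - \<alpha> a)) i - \<alpha> i else (\<gamma>(a := \<gamma> a - \<alpha> a)) i) =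
    (\<lambda>i. if i \<in> set (a # l) then \<gamma> i - \<alpha> i else \<gamma> i)"
    using Cons.prems by (auto simp: fun_eq_iff)
  moreover have "(\<forall>i\<in>set l. \<alpha> i \<le> (\<gamma>(a := \<gamma> a - \<alpha> a)) i) \<longleftrightarrow> (\<forall>i\<in>set l. \<alpha> i \<le> \<gamma> i)"
    using Cons.prems by auto
  ultimately show ?case using Cons by (simp add: pw_Cons wop_append wop_replicate_Lx)
qed simp

lemma wop_pw_Ly:
  assumes "distinct l" "\<forall>i\<in>set l. \<theta> i = 0"
  shows "wop \<theta> (pw Ly \<beta> l) g \<gamma> = g (\<lambda>i. if i \<in> set l then \<gamma> i + \<beta> i else \<gamma> i)"
  using assms
proof (induction l arbitrary: \<gamma>)
  case (Cons a l)
  have "(\<lambda>i. if i \<in> set l then (\<gamma>(a := \<gamma> a + \<beta> a)) i + \<beta> i else (\<gamma>(a := \<gamma> a + \<beta> a)) i) =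
    (\<lambda>i. if i \<in> set (a # l) then \<gamma> i + \<beta> i else \<gamma> i)"
    using Cons.prems by (auto simp: fun_eq_iff)
  then show ?case using Cons by (simp add: pw_Cons wop_append wop_replicate_Ly)
qed simp

context one_sided_inverses
begin

abbreviation x where "x \<equiv> xg K n"
abbreviation y where "y \<equiv> yg K n"
abbreviation sc where "sc \<equiv> scal K n"
abbreviation Idx where "Idx \<equiv> idx {1..n}"

definition ix :: "nat list" where "ix = [1..<Suc n]"

lemma set_ix: "set ix = {1..n}" and distinct_ix: "distinct ix"
  by (auto simp: ix_def)

lemma ix_split:
  assumes "i \<in> {1..n}"
  obtains p q where "ix = p @ i # q" "i \<notin> set p" "i \<notin> set q" "set p \<subseteq> {1..n}" "set q \<subseteq> {1..n}"
proof -
  obtain p q where pq: "ix = p @ i # q" using assms set_ix split_list by metis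
  moreover have "set p \<subseteq> set ix" "set q \<subseteq> set ix" using pq by auto
  ultimately show ?thesis using that distinct_ix set_ix by auto
qed

section \<open>Reduction of words to the form
  \<open>x\<^sup>\<alpha> y\<^sup>\<beta>\<close>\<close>

definition nw :: "(nat \<Rightarrow> nat) \<Rightarrow> (nat \<Rightarrow> nat) \<Rightarrow> letter list" where
  "nw \<alpha> \<beta> = pw Lx \<alpha> ix @ pw Ly \<beta> ix"

lemma monom_mult: "monom u \<otimes>\<^bsub>R\<^esub> monom v = monom (u @ v)"
proof
  fix w
  have "(monom u \<otimes>\<^bsub>R\<^esub> monom v) w = (\<Sum>i\<le>length w. if i = length u then (if w = u @ v then 1 else 0) else 0)"
    unfolding mult_free_alg
  proof (intro sum.cong refl)
    fix i assume "i \<in> {..length w}"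
    then have "length (take i w) = i" by simp
    then have *: "take i w = u \<and> drop i w = v \<longleftrightarrow> i = length u \<and> w = u @ v"
      by (metis append_eq_conv_conj)
    have "monom u (take i w) * monom v (drop i w) = (if take i w = u \<and> drop i w = v then 1 else 0)"
      by (simp add: monom_def)
    also have "\<dots> = (if i = length u then (if w = u @ v then 1 else 0) else 0)"
      unfolding * by auto
    finally show "monom u (take i w) * monom v (drop i w) =
        (if i = length u then (if w = u @ v then 1 else 0) else 0)" .
  qed
  also have "\<dots> = monom (u @ v) w" by (simp add: monom_def)
  finally show "(monom u \<otimes>\<^bsub>R\<^esub> monom v) w = monom (u @ v) w" .
qed

definition mo :: "letter list \<Rightarrow> (letter list \<Rightarrow> 'k) set" where
  "mo w = cl (monom w)"

lemma mo_closed: "set w \<subseteq> letters n \<Longrightarrow> mo w \<in> carrier S"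
  by (simp add: mo_def monom_carrier)

lemma mo_append: "set u \<subseteq> letters n \<Longrightarrow> set v \<subseteq> letters n \<Longrightarrow> mo (u @ v) = mo u \<cdot> mo v"
  by (simp add: mo_def monom_carrier flip: monom_mult cls_mult)

lemma mo_Nil: "mo [] = \<one>\<^bsub>S\<^esub>"
proof -
  have "monom [] = \<one>\<^bsub>R\<^esub>" by (simp add: fun_eq_iff monom_def one_free_alg)
  then show ?thesis by (simp add: mo_def cls_one)
qed

lemma xg_closed [simp]: "i \<in> {1..n} \<Longrightarrow> x i \<in> carrier S"
  and yg_closed [simp]: "i \<in> {1..n} \<Longrightarrow> y i \<in> carrier S"
  by (simp_all add: xg_def yg_def monom_carrier)

lemma scal_closed [simp]: "sc c \<in> carrier S"
  by (simp add: scal_def carrier_free_alg_iff)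

lemma relators_in_rel_ideal: "f \<in> relators K n \<Longrightarrow> f \<in> I"
  unfolding rel_ideal_def using R.genideal_self[OF relators_carrier] by auto

lemma mo_commute:
  assumes "a \<in> letters n" "b \<in> letters n" "lidx a \<noteq> lidx b"
  shows "mo [a, b] = mo [b, a]"
proof -
  have "commutator a b \<in> relators K n \<or> commutator b a \<in> relators K n"
    using assms by (cases a; cases b) (auto simp: relators_def)
  then have "(\<lambda>w. monom [a, b] w - monom [b, a] w) \<in> I \<or> (\<lambda>w. monom [b, a] w - monom [a, b] w) \<in> I"
    unfolding commutator_def using relators_in_rel_ideal by blast
  moreover have "monom [a, b] \<in> carrier R" "monom [b, a] \<in> carrier R"
    using assms by (auto intro: monom_carrier)
  ultimately show ?thesis
    unfolding mo_def using cls_eq_iff by metis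
qed

lemma mo_Ly_Lx: "i \<in> {1..n} \<Longrightarrow> mo [Ly i, Lx i] = \<one>\<^bsub>S\<^esub>"
proof -
  assume i: "i \<in> {1..n}"
  then have "(\<lambda>w. monom [Ly i, Lx i] w - monom [] w) \<in> I"
    by (auto intro!: relators_in_rel_ideal simp: relators_def)
  then show ?thesis
    using i cls_eq_iff[OF monom_carrier monom_carrier, of "[Ly i, Lx i]" "[]"]
    by (simp add: mo_def flip: mo_Nil)
qed

lemma mo_cong:
  assumes "mo u = mo v" "set u \<subseteq> letters n" "set v \<subseteq> letters n" "set p \<subseteq> letters n" "set q \<subseteq> letters n"
  shows "mo (p @ u @ q) = mo (p @ v @ q)"
  using assms by (simp add: mo_append)

lemma mo_commute_word:
  assumes "a \<in> letters n" "set u \<subseteq> letters n" "set v \<subseteq> letters n" "\<forall>b\<in>set u. lidx b \<noteq> lidx a"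
  shows "mo (a # u @ v) = mo (u @ a # v)"
  using assms
proof (induction u)
  case (Cons b u)
  have "mo ([] @ [a, b] @ u @ v) = mo ([] @ [b, a] @ u @ v)"
    by (rule mo_cong) (use Cons.prems mo_commute[of a b] in auto)
  moreover have "mo ([b] @ (a # u @ v) @ []) = mo ([b] @ (u @ a # v) @ [])"
    by (rule mo_cong) (use Cons in auto)
  ultimately show ?case by simp
qed simp

lemma set_pw_letters:
  assumes "set l \<subseteq> {1..n}" "c = Lx \<or> c = Ly"
  shows "set (pw c \<alpha> l) \<subseteq> letters n"
proof -
  have "c ` set l \<subseteq> letters n" using assms by auto
  then show ?thesis using set_pw[of c \<alpha> l] by blast
qed

lemma lidx_pw: "c = Lx \<or> c = Ly \<Longrightarrow> i \<notin> set l \<Longrightarrow> \<forall>b\<in>set (pw c \<alpha> l). lidx b \<noteq> i"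
  using set_pw[of c \<alpha> l] by fastforce

text \<open>The new letter commutes with the blocks that stand before position \<open>i\<close> in
  \<open>ix\<close>, since their indices differ, and then joins the block of
  \<open>i\<close>.\<close>

lemma mo_pw_push:
  assumes i: "i \<in> {1..n}" and c: "c = Lx \<or> c = Ly" and v: "set v \<subseteq> letters n"
  shows "mo (c i # pw c \<alpha> ix @ v) = mo (pw c (\<alpha>(i := Suc (\<alpha> i))) ix @ v)"
proof -
  obtain p q where pq: "ix = p @ i # q" "i \<notin> set p" "i \<notin> set q" "set p \<subseteq> {1..n}" "set q \<subseteq> {1..n}"
    using i by (rule ix_split)
  let ?u = "pw c \<alpha> p" and ?z = "pw c \<alpha> q"
  have sets: "set ?u \<subseteq> letters n" "set ?z \<subseteq> letters n"
    using set_pw_letters[OF pq(4) c] set_pw_letters[OF pq(5) c] by auto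
  have ci: "c i \<in> letters n" "lidx (c i) = i" using i c by auto
  have "mo (c i # ?u @ (replicate (\<alpha> i) (c i) @ ?z @ v)) = mo (?u @ c i # (replicate (\<alpha> i) (c i) @ ?z @ v))"
    using sets v ci lidx_pw[OF c pq(2)] by (intro mo_commute_word) auto
  then show ?thesis
    by (simp add: pq pw_append pw_Cons pw_upd_notin)
qed

text \<open>If no \<open>Lx i\<close> is present, the letter \<open>Ly i\<close> commutes with the
  whole x-part. Otherwise it travels to the block of \<open>i\<close> and cancels one letter there
  by the relation \<open>y i x i = 1\<close>.\<close>

lemma mo_Ly_pw_Lx:
  assumes i: "i \<in> {1..n}" and v: "set v \<subseteq> letters n"
  shows "\<alpha> i = 0 \<Longrightarrow> mo (Ly i # pw Lx \<alpha> ix @ v) = mo (pw Lx \<alpha> ix @ Ly i # v)"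
    and "\<alpha> i = Suc k \<Longrightarrow> mo (Ly i # pw Lx \<alpha> ix @ v) = mo (pw Lx (\<alpha>(i := k)) ix @ v)"
proof -
  obtain p q where pq: "ix = p @ i # q" "i \<notin> set p" "i \<notin> set q" "set p \<subseteq> {1..n}" "set q \<subseteq> {1..n}"
    using i by (rule ix_split)
  let ?u = "pw Lx \<alpha> p" and ?z = "pw Lx \<alpha> q"
  have sets: "set ?u \<subseteq> letters n" "set ?z \<subseteq> letters n"
    using set_pw_letters[OF pq(4), of Lx] set_pw_letters[OF pq(5), of Lx] by auto
  have ne: "\<forall>b\<in>set ?u. lidx b \<noteq> lidx (Ly i)" "\<forall>b\<in>set ?z. lidx b \<noteq> lidx (Ly i)"
    using lidx_pw[OF _ pq(2), of Lx] lidx_pw[OF _ pq(3), of Lx] by auto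
  have Ly: "Ly i \<in> letters n" using i by simp
  show "mo (Ly i # pw Lx \<alpha> ix @ v) = mo (pw Lx \<alpha> ix @ Ly i # v)" if "\<alpha> i = 0"
  proof -
    have "mo (Ly i # (?u @ ?z) @ v) = mo ((?u @ ?z) @ Ly i # v)"
      by (rule mo_commute_word[OF Ly _ v]) (use sets ne in auto)
    then show ?thesis unfolding pq(1) pw_append pw_Cons that by simp
  qed
  assume *: "\<alpha> i = Suc k"
  have "mo (Ly i # ?u @ (replicate (\<alpha> i) (Lx i) @ ?z @ v)) = mo (?u @ Ly i # (replicate (\<alpha> i) (Lx i) @ ?z @ v))"
    by (rule mo_commute_word[OF Ly sets(1) _ ne(1)]) (use sets v i in auto)
  also have "\<dots> = mo (?u @ [Ly i, Lx i] @ replicate k (Lx i) @ ?z @ v)" by (simp add: *)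
  also have "\<dots> = mo (?u @ [] @ replicate k (Lx i) @ ?z @ v)"
    by (rule mo_cong) (use i v sets mo_Ly_Lx[OF i] in \<open>auto simp: mo_Nil\<close>)
  finally show "mo (Ly i # pw Lx \<alpha> ix @ v) = mo (pw Lx (\<alpha>(i := k)) ix @ v)"
    by (simp add: pq pw_append pw_Cons pw_upd_notin)
qed

lemma idx_upd: "\<alpha> \<in> Idx \<Longrightarrow> i \<in> {1..n} \<Longrightarrow> \<alpha>(i := k) \<in> Idx"
  by (auto simp: idx_def)

lemma set_nw: "set (nw \<alpha> \<beta>) \<subseteq> letters n"
  unfolding nw_def using set_pw_letters[of ix] set_ix by auto

text \<open>Letters are added on the left. An x raises \<alpha>; a y lowers \<alpha> if it meets its
  partner and raises \<beta> otherwise. Only products \<open>y i x i\<close> cancel, which is why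
  the x-part has to stand on the left.\<close>

lemma mo_eq_nw:
  assumes "set w \<subseteq> letters n"
  shows "\<exists>\<alpha>\<in>Idx. \<exists>\<beta>\<in>Idx. mo w = mo (nw \<alpha> \<beta>)"
  using assms
proof (induction w)
  case Nil
  have "nw (\<lambda>_. 0) (\<lambda>_. 0) = []" by (simp add: nw_def pw_def)
  then show ?case by (intro bexI[of _ "\<lambda>_. 0"]) (auto simp: idx_def)
next
  case (Cons a w)
  then obtain \<alpha> \<beta> where IH: "\<alpha> \<in> Idx" "\<beta> \<in> Idx" "mo w = mo (nw \<alpha> \<beta>)" by auto
  have set: "set (pw Ly \<beta> ix) \<subseteq> letters n" "set (pw Lx \<alpha> ix) \<subseteq> letters n"
    by (intro set_pw_letters; auto simp: set_ix)+
  have "mo ([a] @ w @ []) = mo ([a] @ nw \<alpha> \<beta> @ [])"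
    by (rule mo_cong) (use Cons.prems IH set_nw in auto)
  then have eq: "mo (a # w) = mo (a # nw \<alpha> \<beta>)" by simp
  show ?case
  proof (cases a)
    case (Lx i)
    then have i: "i \<in> {1..n}" using Cons.prems by auto
    have "mo (a # nw \<alpha> \<beta>) = mo (nw (\<alpha>(i := Suc (\<alpha> i))) \<beta>)"
      unfolding Lx nw_def by (rule mo_pw_push[OF i _ set(1)]) simp
    with eq have "mo (a # w) = mo (nw (\<alpha>(i := Suc (\<alpha> i))) \<beta>)" by simp
    then show ?thesis using IH idx_upd[OF _ i] by blast
  next
    case (Ly i)
    then have i: "i \<in> {1..n}" using Cons.prems by auto
    show ?thesis
    proof (cases "\<alpha> i")
      case 0
      have "mo (pw Lx \<alpha> ix @ (Ly i # pw Ly \<beta> ix) @ []) =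
        mo (pw Lx \<alpha> ix @ pw Ly (\<beta>(i := Suc (\<beta> i))) ix @ [])"
        using mo_pw_push[OF i, of Ly "[]" \<beta>] set i
        by (intro mo_cong set_pw_letters) (auto simp: set_ix)
      then have "mo (a # nw \<alpha> \<beta>) = mo (nw \<alpha> (\<beta>(i := Suc (\<beta> i))))"
        unfolding Ly nw_def using mo_Ly_pw_Lx(1)[OF i set(1), of \<alpha>] 0 by simp
      with eq have "mo (a # w) = mo (nw \<alpha> (\<beta>(i := Suc (\<beta> i))))" by simp
      then show ?thesis using IH idx_upd[OF _ i] by blast
    next
      case (Suc k)
      have "mo (a # nw \<alpha> \<beta>) = mo (nw (\<alpha>(i := k)) \<beta>)"
        unfolding Ly nw_def using mo_Ly_pw_Lx(2)[where \<alpha> = \<alpha>, OF i set(1) Suc] by simp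
      with eq have "mo (a # w) = mo (nw (\<alpha>(i := k)) \<beta>)" by simp
      then show ?thesis using IH idx_upd[OF _ i] by blast
    qed
  qed
qed

lemma smonom_carrier: "set w \<subseteq> letters n \<Longrightarrow> (\<lambda>v. c * monom w v) \<in> carrier R"
  by (auto simp: carrier_free_alg_iff monom_def)

lemma cls_smonom: "set w \<subseteq> letters n \<Longrightarrow> cl (\<lambda>v. c * monom w v) = sc c \<cdot> mo w"
proof -
  assume w: "set w \<subseteq> letters n"
  have c: "(\<lambda>v. if v = [] then c else 0) \<in> carrier R" by (simp add: carrier_free_alg_iff)
  have "(\<lambda>v. c * monom w v) = (\<lambda>v. if v = [] then c else 0) \<otimes>\<^bsub>R\<^esub> monom w"
  proof
    fix v
    have "((\<lambda>v. if v = [] then c else 0) \<otimes>\<^bsub>R\<^esub> monom w) v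
        = (\<Sum>i\<le>length v. if i = 0 then c * monom w v else 0)"
      unfolding mult_free_alg by (intro sum.cong) auto
    then show "c * monom w v = ((\<lambda>v. if v = [] then c else 0) \<otimes>\<^bsub>R\<^esub> monom w) v" by simp
  qed
  then show ?thesis using c w by (simp add: scal_def mo_def monom_carrier flip: cls_mult)
qed

lemma free_alg_induct [consumes 1, case_names zero add]:
  assumes "f \<in> carrier R" and zero: "P \<zero>\<^bsub>R\<^esub>"
    and add: "\<And>f c w. f \<in> carrier R \<Longrightarrow> set w \<subseteq> letters n \<Longrightarrow> P f \<Longrightarrow> P (f \<oplus>\<^bsub>R\<^esub> (\<lambda>v. c * monom w v))"
  shows "P f"
proof -
  have "finite {w. f w \<noteq> 0}" using assms(1) by (simp add: carrier_free_alg_iff)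
  moreover have "finite W \<Longrightarrow> f \<in> carrier R \<Longrightarrow> {w. f w \<noteq> 0} \<subseteq> W \<Longrightarrow> P f" for W f
  proof (induction W arbitrary: f rule: finite_induct)
    case empty
    then have "f = \<zero>\<^bsub>R\<^esub>" by (auto simp: fun_eq_iff zero_free_alg)
    then show ?case using zero by simp
  next
    case (insert w W)
    show ?case
    proof (cases "f w = 0")
      case True
      then have "{w. f w \<noteq> 0} \<subseteq> W" using insert.prems by auto
      then show ?thesis using insert by blast
    next
      case False
      then have w: "set w \<subseteq> letters n" using insert.prems by (auto simp: carrier_free_alg_iff)
      let ?g = "f(w := 0)"
      have "{v. ?g v \<noteq> 0} \<subseteq> {v. f v \<noteq> 0}" by auto
      then have g: "?g \<in> carrier R"
        using insert.prems by (auto simp: carrier_free_alg_iff intro: finite_subset)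
      have "P ?g" by (rule insert.IH[OF g]) (use insert.prems in auto)
      from add[OF g w this, of "f w"] show ?thesis
        by (rule back_subst[of P]) (auto simp: fun_eq_iff add_free_alg monom_def)
    qed
  qed
  ultimately show ?thesis using assms(1) by blast
qed

text \<open>The inductive steps multiply by one generator on the left, so a property of operators
  has to be followed through a single outermost shift only.\<close>

lemma Sn_induct [consumes 1, case_names zero add scale one x y]:
  assumes "a \<in> carrier S" and "P \<zero>\<^bsub>S\<^esub>"
    and add: "\<And>a b. a \<in> carrier S \<Longrightarrow> b \<in> carrier S \<Longrightarrow> P a \<Longrightarrow> P b \<Longrightarrow> P (a \<boxplus> b)"
    and scale: "\<And>c a. a \<in> carrier S \<Longrightarrow> P a \<Longrightarrow> P (sc c \<cdot> a)"
    and one: "P \<one>\<^bsub>S\<^esub>"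
    and x: "\<And>i a. i \<in> {1..n} \<Longrightarrow> a \<in> carrier S \<Longrightarrow> P a \<Longrightarrow> P (x i \<cdot> a)"
    and y: "\<And>i a. i \<in> {1..n} \<Longrightarrow> a \<in> carrier S \<Longrightarrow> P a \<Longrightarrow> P (y i \<cdot> a)"
  shows "P a"
proof -
  have mo: "P (mo w)" if "set w \<subseteq> letters n" for w
    using that
  proof (induction w)
    case (Cons a w)
    have "mo ([a] @ w) = mo [a] \<cdot> mo w" using Cons.prems by (intro mo_append) auto
    then show ?case using Cons x[of _ "mo w"] y[of _ "mo w"]
      by (cases a) (auto simp: mo_closed, auto simp: mo_def xg_def yg_def)
  qed (simp add: mo_Nil one)
  obtain f where f: "f \<in> carrier R" "a = cl f" using assms(1) by (rule cls_surj)
  from f(1) have "P (cl f)"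
  proof (induction rule: free_alg_induct)
    case (add f c w)
    then show ?case
      using assms(3)[of "cl f" "sc c \<cdot> mo w"] scale mo
      by (simp add: cls_add smonom_carrier cls_smonom mo_closed)
  qed (simp add: cls_zero assms)
  then show ?thesis by (simp add: f)
qed

lemma normal_form:
  assumes "a \<in> carrier S"
  obtains f where "f \<in> carrier R" "a = cl f" "\<forall>w. f w \<noteq> 0 \<longrightarrow> (\<exists>\<alpha>\<in>Idx. \<exists>\<beta>\<in>Idx. w = nw \<alpha> \<beta>)"
proof -
  obtain f where f: "f \<in> carrier R" "a = cl f" using assms by (rule cls_surj)
  from f(1) have "\<exists>g. g \<in> carrier R \<and> cl f = cl g \<and> (\<forall>w. g w \<noteq> 0 \<longrightarrow> (\<exists>\<alpha>\<in>Idx. \<exists>\<beta>\<in>Idx. w = nw \<alpha> \<beta>))"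
  proof (induction rule: free_alg_induct)
    case zero
    then show ?case by (auto simp: zero_free_alg intro!: exI[of _ "\<zero>\<^bsub>R\<^esub>"])
  next
    case (add f c w)
    then obtain g where g: "g \<in> carrier R" "cl f = cl g"
      "\<And>w. g w \<noteq> 0 \<Longrightarrow> \<exists>\<alpha>\<in>Idx. \<exists>\<beta>\<in>Idx. w = nw \<alpha> \<beta>" by blast
    obtain \<alpha> \<beta> where ab: "\<alpha> \<in> Idx" "\<beta> \<in> Idx" "mo w = mo (nw \<alpha> \<beta>)" using mo_eq_nw[OF add(2)] by blast
    let ?h = "g \<oplus>\<^bsub>R\<^esub> (\<lambda>v. c * monom (nw \<alpha> \<beta>) v)"
    have "?h \<in> carrier R" using g smonom_carrier set_nw by blast
    moreover have "cl (f \<oplus>\<^bsub>R\<^esub> (\<lambda>v. c * monom w v)) = cl ?h"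
      using add g ab by (simp add: cls_add smonom_carrier set_nw cls_smonom)
    moreover have "\<exists>\<alpha>\<in>Idx. \<exists>\<beta>\<in>Idx. v = nw \<alpha> \<beta>" if "?h v \<noteq> 0" for v
      using that g(3)[of v] ab by (auto simp: add_free_alg monom_def split: if_splits)
    ultimately show ?case by blast
  qed
  then show ?thesis using that f by auto
qed

end

section \<open>Linear independence of the monomials\<close>

context sn_rep
begin

lemma wop_nw:
  assumes "\<And>i. i \<in> {1..n} \<Longrightarrow> \<theta> i = 0" "\<gamma> \<in> Idx" "\<alpha> \<in> Idx" "\<beta> \<in> Idx"
  shows "wop \<theta> (nw \<alpha> \<beta>) g \<gamma> = (if \<forall>i. \<alpha> i \<le> \<gamma> i then g (\<lambda>i. \<gamma> i - \<alpha> i + \<beta> i) else 0)"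
proof -
  have "(\<lambda>i. if i \<in> {1..n} then \<gamma> i - \<alpha> i else \<gamma> i) = (\<lambda>i. \<gamma> i - \<alpha> i)"
    using assms(2-) by (auto simp: idx_def fun_eq_iff)
  moreover have "(\<forall>i\<in>{1..n}. \<alpha> i \<le> \<gamma> i) \<longleftrightarrow> (\<forall>i. \<alpha> i \<le> \<gamma> i)"
    using assms(2-) unfolding idx_def by force
  ultimately have x: "wop \<theta> (pw Lx \<alpha> ix) h \<gamma> = (if \<forall>i. \<alpha> i \<le> \<gamma> i then h (\<lambda>i. \<gamma> i - \<alpha> i) else 0)" for h
    using wop_pw_Lx[OF distinct_ix, of \<theta> \<alpha> h \<gamma>] assms(1) unfolding set_ix by metis
  have "(\<lambda>i. if i \<in> {1..n} then \<epsilon> i + \<beta> i else \<epsilon> i) = (\<lambda>i. \<epsilon> i + \<beta> i)" for \<epsilon>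
    using assms(4) by (auto simp: idx_def fun_eq_iff)
  then have y: "wop \<theta> (pw Ly \<beta> ix) g \<epsilon> = g (\<lambda>i. \<epsilon> i + \<beta> i)" for \<epsilon>
    using wop_pw_Ly[OF distinct_ix, of \<theta> \<beta> g \<epsilon>] assms(1) unfolding set_ix by metis
  show ?thesis unfolding nw_def wop_append x y ..
qed

text \<open>Among the monomials of a normal form choose one whose \<beta> has least total degree,
  say \<open>(\<alpha>0, \<beta>0)\<close>. A monomial \<open>(\<alpha>, \<beta>)\<close>
  contributes to the entry in row \<open>\<alpha>0\<close> and column \<open>\<beta>0\<close> only
  if \<alpha> is at most \<open>\<alpha>0\<close> and
  \<open>\<alpha>0 - \<alpha> + \<beta> = \<beta>0\<close>. Then \<beta> is at most
  \<open>\<beta>0\<close>, minimality makes them equal, and the entry is the coefficient of the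
  chosen monomial.\<close>

lemma faithful:
  assumes \<theta>: "\<And>i. i \<in> {1..n} \<Longrightarrow> \<theta> i = 0"
    and a: "a \<in> carrier S" and zero: "\<And>\<beta> \<gamma>. \<beta> \<in> Idx \<Longrightarrow> \<gamma> \<in> Idx \<Longrightarrow> A a (\<delta> \<beta>) \<gamma> = 0"
  shows "a = \<zero>\<^bsub>S\<^esub>"
proof -
  obtain f where f: "f \<in> carrier R" "a = cl f"
    and nf: "\<forall>w. f w \<noteq> 0 \<longrightarrow> (\<exists>\<alpha>\<in>Idx. \<exists>\<beta>\<in>Idx. w = nw \<alpha> \<beta>)"
    using a by (rule normal_form)
  have "f w = 0" for w
  proof (rule ccontr)
    assume "f w \<noteq> 0"
    define P where "P p \<longleftrightarrow> fst p \<in> Idx \<and> snd p \<in> Idx \<and> f (nw (fst p) (snd p)) \<noteq> 0" for p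
    obtain \<alpha> \<beta> where "\<alpha> \<in> Idx" "\<beta> \<in> Idx" "w = nw \<alpha> \<beta>" using nf \<open>f w \<noteq> 0\<close> by blast
    then have "P (\<alpha>, \<beta>)" using \<open>f w \<noteq> 0\<close> by (simp add: P_def)
    from ex_has_least_nat[of P, OF this, of "\<lambda>p. \<Sum>i=1..n. snd p i"]
    obtain p where p: "P p" "\<And>q. P q \<Longrightarrow> (\<Sum>i=1..n. snd p i) \<le> (\<Sum>i=1..n. snd q i)" by blast
    define \<alpha>0 \<beta>0 where "\<alpha>0 = fst p" and "\<beta>0 = snd p"
    have 0: "\<alpha>0 \<in> Idx" "\<beta>0 \<in> Idx" "f (nw \<alpha>0 \<beta>0) \<noteq> 0"
      using p(1) by (auto simp: P_def \<alpha>0_def \<beta>0_def)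
    have least: "(\<Sum>i=1..n. \<beta>0 i) \<le> (\<Sum>i=1..n. \<beta> i)"
      if "\<alpha> \<in> Idx" "\<beta> \<in> Idx" "f (nw \<alpha> \<beta>) \<noteq> 0" for \<alpha> \<beta>
      using p(2)[of "(\<alpha>, \<beta>)"] that by (simp add: P_def \<beta>0_def)
    have wop_eq: "wop \<theta> v (\<delta> \<beta>0) \<alpha>0 = (if v = nw \<alpha>0 \<beta>0 then 1 else 0)" if v: "f v \<noteq> 0" for v
    proof -
      obtain \<alpha> \<beta> where ab: "\<alpha> \<in> Idx" "\<beta> \<in> Idx" "v = nw \<alpha> \<beta>" using nf v by blast
      have unique: "\<alpha> = \<alpha>0 \<and> \<beta> = \<beta>0" if "\<forall>i. \<alpha> i \<le> \<alpha>0 i" "(\<lambda>i. \<alpha>0 i - \<alpha> i + \<beta> i) = \<beta>0"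
      proof -
        have le: "\<beta> i \<le> \<beta>0 i" for i using fun_cong[OF that(2), of i] by simp
        have "\<beta> i = \<beta>0 i" if i: "i \<in> {1..n}" for i
        proof (rule ccontr)
          assume "\<beta> i \<noteq> \<beta>0 i"
          then have "\<beta> i < \<beta>0 i" using le[of i] by simp
          then have "(\<Sum>i=1..n. \<beta> i) < (\<Sum>i=1..n. \<beta>0 i)"
            by (intro sum_strict_mono_ex1 ballI bexI[of _ i]) (use le i in auto)
          then show False using least[of \<alpha> \<beta>] ab v by simp
        qed
        then have "\<beta> j = \<beta>0 j" for j
          using ab(2) 0(2) unfolding idx_def by (cases "j \<in> {1..n}") auto
        then have "\<beta> = \<beta>0" by auto
        moreover have "\<alpha> i = \<alpha>0 i" for i
          using fun_cong[OF that(2), of i] that(1) \<open>\<beta> = \<beta>0\<close> by (metis add_eq_self_zero add.commute diff_is_0_eq le_antisym)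
        ultimately show ?thesis by auto
      qed
      have v_eq: "wop \<theta> v (\<delta> \<beta>0) \<alpha>0 = (if \<forall>i. \<alpha> i \<le> \<alpha>0 i then \<delta> \<beta>0 (\<lambda>i. \<alpha>0 i - \<alpha> i + \<beta> i) else 0)"
        unfolding ab(3) by (rule wop_nw[OF \<theta> 0(1) ab(1,2)])
      show ?thesis
      proof (cases "v = nw \<alpha>0 \<beta>0")
        case True
        then show ?thesis using wop_nw[OF \<theta> 0(1) 0(1,2), of "\<delta> \<beta>0"] by (simp add: \<delta>_def)
      next
        case False
        then have "\<not> ((\<forall>i. \<alpha> i \<le> \<alpha>0 i) \<and> (\<lambda>i. \<alpha>0 i - \<alpha> i + \<beta> i) = \<beta>0)"
          unfolding ab(3) by (metis unique)
        then show ?thesis using False v_eq by (metis \<delta>_def)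
      qed
    qed
    have "A a (\<delta> \<beta>0) \<alpha>0 = (\<Sum>v | f v \<noteq> 0. if v = nw \<alpha>0 \<beta>0 then \<kappa> (f v) else 0)"
      unfolding f(2) A_cls[OF f(1)] act_def by (intro sum.cong) (auto simp: wop_eq)
    also have "\<dots> = \<kappa> (f (nw \<alpha>0 \<beta>0))"
      using f(1) 0 by (subst sum.delta) (auto simp: carrier_free_alg_iff)
    finally show False using zero[OF 0(2,1)] \<kappa>_nonzero[OF 0(3)] by simp
  qed
  then have "f = \<zero>\<^bsub>R\<^esub>" by (simp add: fun_eq_iff zero_free_alg)
  then show ?thesis by (simp add: f cls_zero)
qed

end

section \<open>Matrix units\<close>

lemma idx_induct [consumes 2, case_names zero Suc]:
  assumes "finite L" "\<alpha> \<in> idx L"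
    and zero: "P (\<lambda>_. 0)"
    and Suc: "\<And>\<alpha> i. \<alpha> \<in> idx L \<Longrightarrow> i \<in> L \<Longrightarrow> P \<alpha> \<Longrightarrow> P (\<alpha>(i := Suc (\<alpha> i)))"
  shows "P \<alpha>"
  using assms(2)
proof (induction "\<Sum>i\<in>L. \<alpha> i" arbitrary: \<alpha>)
  case 0
  then have "\<alpha> = (\<lambda>_. 0)" using \<open>finite L\<close> by (auto simp: idx_def fun_eq_iff)
  then show ?case using zero by simp
next
  case (Suc k)
  then obtain i where i: "i \<in> L" "\<alpha> i \<noteq> 0"
    by (metis Zero_not_Suc sum.neutral)
  let ?\<beta> = "\<alpha>(i := \<alpha> i - 1)"
  have "(\<Sum>j\<in>L. \<alpha> j) = \<alpha> i + (\<Sum>j\<in>L - {i}. \<alpha> j)"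
    by (rule sum.remove[OF \<open>finite L\<close> i(1)])
  moreover have "(\<Sum>j\<in>L. ?\<beta> j) = ?\<beta> i + (\<Sum>j\<in>L - {i}. ?\<beta> j)"
    by (rule sum.remove[OF \<open>finite L\<close> i(1)])
  moreover have "(\<Sum>j\<in>L - {i}. ?\<beta> j) = (\<Sum>j\<in>L - {i}. \<alpha> j)" by (intro sum.cong) auto
  moreover have "Suc (?\<beta> i) = \<alpha> i" using i by simp
  ultimately have "k = (\<Sum>j\<in>L. ?\<beta> j)" using Suc(2) by linarith
  moreover have b: "?\<beta> \<in> idx L" using Suc.prems by (auto simp: idx_def)
  ultimately have "P ?\<beta>" by (rule Suc(1))
  from assms(4)[OF b i(1) this] show ?case using i by simp
qed

lemma \<delta>_same [simp]: "\<delta> \<beta> \<beta> = 1"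
  by (simp add: \<delta>_def)

lemma zero_in_idx [simp]: "(\<lambda>_. 0) \<in> idx L"
  by (simp add: idx_def)

lemma idx_updI: "\<alpha> \<in> idx L \<Longrightarrow> i \<in> L \<Longrightarrow> \<alpha>(i := k) \<in> idx L"
  by (auto simp: idx_def)

context one_sided_inverses
begin

text \<open>Measures the failure of \<open>x j\<close> and \<open>y j\<close> to be inverse to each
  other on both sides. Where they act as shifts, it is the projection to index 0 in direction
  \<open>j\<close>.\<close>

definition e :: "nat \<Rightarrow> (letter list \<Rightarrow> 'k) set" where
  "e j = \<one>\<^bsub>S\<^esub> \<boxminus> x j \<cdot> y j"

lemma e_closed [simp]: "j \<in> {1..n} \<Longrightarrow> e j \<in> carrier S"
  by (simp add: e_def)

end

section \<open>Representations as row-finite matrices\<close>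

context sn_rep
begin

text \<open>The directions that are really shifted. No operator leads out of the multi-indices
  supported there, so \<open>Ix\<close> serves as the index set of the matrices.\<close>

definition L :: "nat set" where
  "L = {j \<in> {1..n}. \<theta> j = 0}"

abbreviation Ix where "Ix \<equiv> idx L"

lemma finite_L: "finite L"
  by (simp add: L_def)

text \<open>Finiteness of the row \<gamma> of the matrix of \<open>a\<close>. It takes the place of
  finite support of the functions, which is not imposed.\<close>

definition row_supported :: "(letter list \<Rightarrow> 'k) set \<Rightarrow> (nat \<Rightarrow> nat) \<Rightarrow> (nat \<Rightarrow> nat) set \<Rightarrow> bool" where
  "row_supported a \<gamma> D \<longleftrightarrow> finite D \<and> D \<subseteq> Ix \<and> (\<forall>g h. (\<forall>d\<in>D. g d = h d) \<longrightarrow> A a g \<gamma> = A a h \<gamma>)"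

lemma row_supportedD: "row_supported a \<gamma> D \<Longrightarrow> (\<And>d. d \<in> D \<Longrightarrow> g d = h d) \<Longrightarrow> A a g \<gamma> = A a h \<gamma>"
  unfolding row_supported_def by blast

lemma row_supported_ex:
  assumes "a \<in> carrier S" "\<gamma> \<in> Ix"
  shows "\<exists>D. row_supported a \<gamma> D"
  using assms
proof (induction arbitrary: \<gamma> rule: Sn_induct)
  case zero
  show ?case by (intro exI[of _ "{}"]) (simp add: row_supported_def)
next
  case (add a b)
  obtain D E where D: "row_supported a \<gamma> D" and E: "row_supported b \<gamma> E" using add by blast
  have "A (a \<boxplus> b) g \<gamma> = A (a \<boxplus> b) h \<gamma>" if "\<forall>d\<in>D \<union> E. g d = h d" for g h
    using add(1,2) that row_supportedD[OF D, of g h] row_supportedD[OF E, of g h] by (simp add: A_add)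
  then have "row_supported (a \<boxplus> b) \<gamma> (D \<union> E)"
    using D E by (simp add: row_supported_def)
  then show ?case ..
next
  case (scale c a)
  obtain D where D: "row_supported a \<gamma> D" using scale by blast
  have "A (sc c \<cdot> a) g \<gamma> = A (sc c \<cdot> a) h \<gamma>" if "\<forall>d\<in>D. g d = h d" for g h
    using scale(1) that row_supportedD[OF D, of g h] by (simp add: A_mult A_scal)
  then have "row_supported (sc c \<cdot> a) \<gamma> D"
    using D by (simp add: row_supported_def)
  then show ?case ..
next
  case one
  then show ?case by (intro exI[of _ "{\<gamma>}"]) (simp add: row_supported_def)
next
  case (x i a)
  let ?\<gamma> = "if \<theta> i \<noteq> 0 then \<gamma> else \<gamma>(i := \<gamma> i - 1)"
  have "?\<gamma> \<in> Ix" using x by (auto simp: idx_def L_def)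
  then obtain D where D: "row_supported a ?\<gamma> D" using x(3) by blast
  have "A (x i \<cdot> a) g \<gamma> = A (x i \<cdot> a) h \<gamma>" if "\<forall>d\<in>D. g d = h d" for g h
    using x(1,2) that row_supportedD[OF D, of g h] by (auto simp: A_mult A_xg xop_def split: if_splits)
  then have "row_supported (x i \<cdot> a) \<gamma> D"
    using D by (simp add: row_supported_def)
  then show ?case ..
next
  case (y i a)
  let ?\<gamma> = "if \<theta> i \<noteq> 0 then \<gamma> else \<gamma>(i := Suc (\<gamma> i))"
  have "?\<gamma> \<in> Ix" using y by (auto simp: idx_def L_def)
  then obtain D where D: "row_supported a ?\<gamma> D" using y(3) by blast
  have "A (y i \<cdot> a) g \<gamma> = A (y i \<cdot> a) h \<gamma>" if "\<forall>d\<in>D. g d = h d" for g h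
    using y(1,2) that row_supportedD[OF D, of g h] by (auto simp: A_mult A_yg yop_def split: if_splits)
  then have "row_supported (y i \<cdot> a) \<gamma> D"
    using D by (simp add: row_supported_def)
  then show ?case ..
qed

lemma A_cong: "a \<in> carrier S \<Longrightarrow> \<gamma> \<in> Ix \<Longrightarrow> (\<And>d. d \<in> Ix \<Longrightarrow> g d = h d) \<Longrightarrow> A a g \<gamma> = A a h \<gamma>"
  using row_supported_ex[of a \<gamma>] row_supportedD[of a \<gamma> _ g h] unfolding row_supported_def by blast

text \<open>Fixes the matrix convention used from here on: \<open>A a (\<delta> d) \<gamma>\<close>
  is the entry in row \<gamma> and column \<open>d\<close>, and finiteness of rows makes the matrix
  determine the operator on \<open>Ix\<close>.\<close>

lemma A_row:
  assumes "a \<in> carrier S" "\<gamma> \<in> Ix"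
  obtains D where "finite D" "D \<subseteq> Ix" "\<forall>g. A a g \<gamma> = (\<Sum>d\<in>D. g d * A a (\<delta> d) \<gamma>)"
proof -
  obtain D where rD: "row_supported a \<gamma> D" using row_supported_ex[OF assms] by blast
  then have D: "finite D" "D \<subseteq> Ix" by (auto simp: row_supported_def)
  have "A a g \<gamma> = (\<Sum>d\<in>D. g d * A a (\<delta> d) \<gamma>)" for g
  proof -
    have "A a g \<gamma> = A a (\<lambda>\<epsilon>. \<Sum>d\<in>D. g d * \<delta> d \<epsilon>) \<gamma>"
      using D(1) by (intro row_supportedD[OF rD]) (simp add: \<delta>_def if_distrib sum.delta cong: if_cong)
    also have "\<dots> = (\<Sum>d\<in>D. g d * A a (\<delta> d) \<gamma>)"
      by (rule A_arg_sum[OF assms(1)])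
    finally show ?thesis .
  qed
  then show ?thesis using D that by blast
qed

lemma A_nonzero_entry:
  assumes "a \<in> carrier S" "\<gamma> \<in> Ix" "A a g \<gamma> \<noteq> 0"
  obtains \<beta> where "\<beta> \<in> Ix" "A a (\<delta> \<beta>) \<gamma> \<noteq> 0"
proof -
  obtain D where D: "finite D" "D \<subseteq> Ix" "\<forall>g. A a g \<gamma> = (\<Sum>d\<in>D. g d * A a (\<delta> d) \<gamma>)"
    using assms(1,2) by (rule A_row)
  then obtain d where "d \<in> D" "g d * A a (\<delta> d) \<gamma> \<noteq> 0"
    using assms(3) unfolding D(3)[rule_format, of g] by (meson sum.not_neutral_contains_not_neutral)
  then show ?thesis using that[of d] D(2) by auto
qed

lemma A_e: 
  assumes "j \<in> {1..n}"
  shows "A (e j) g \<gamma> = (if \<theta> j = 0 \<and> \<gamma> j = 0 then g \<gamma> else 0)"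
  using assms by (auto simp: e_def A_diff A_mult A_xg A_yg xop_def yop_def)

lemma ex_projection:
  assumes "finite M" "M \<subseteq> L"
  shows "\<exists>E\<in>carrier S. \<forall>g \<gamma>. A E g \<gamma> = (if \<forall>j\<in>M. \<gamma> j = 0 then g \<gamma> else 0)"
  using assms
proof (induction M rule: finite_induct)
  case empty
  show ?case by (intro bexI[of _ "\<one>\<^bsub>S\<^esub>"]) auto
next
  case (insert j M)
  then obtain E where E: "E \<in> carrier S" "\<forall>g \<gamma>. A E g \<gamma> = (if \<forall>j\<in>M. \<gamma> j = 0 then g \<gamma> else 0)" by auto
  have j: "j \<in> {1..n}" "\<theta> j = 0" using insert.prems by (auto simp: L_def)
  show ?case using E j by (intro bexI[of _ "e j \<cdot> E"]) (auto simp: A_mult A_e)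
qed

text \<open>The unit is \<open>x\<^sup>\<alpha> E y\<^sup>\<beta>\<close>, where \<open>E\<close>,
  the product of the projections \<open>e j\<close>, is the unit at position (0, 0). Each
  \<open>y i\<close> on the right moves the column by one step, each \<open>x i\<close> on the left
  the row.\<close>

lemma ex_matrix_unit:
  assumes "\<alpha> \<in> Ix" "\<beta> \<in> Ix"
  shows "\<exists>E\<in>carrier S. \<forall>g. \<forall>\<gamma>\<in>Ix. A E g \<gamma> = (if \<gamma> = \<alpha> then g \<beta> else 0)"
  using finite_L assms(1)
proof (induction rule: idx_induct)
  case zero
  show ?case using finite_L assms(2)
  proof (induction rule: idx_induct)
    case zero
    obtain E where E: "E \<in> carrier S" "\<forall>g \<gamma>. A E g \<gamma> = (if \<forall>j\<in>L. \<gamma> j = 0 then g \<gamma> else 0)"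
      using ex_projection[OF finite_L] by blast
    moreover have "(\<forall>j\<in>L. \<gamma> j = 0) \<longleftrightarrow> \<gamma> = (\<lambda>_. 0)" if "\<gamma> \<in> Ix" for \<gamma>
      using that by (auto simp: idx_def)
    ultimately show ?case by (intro bexI[of _ E]) auto
  next
    case (Suc \<beta> i)
    then obtain E where E: "E \<in> carrier S" "\<forall>g. \<forall>\<gamma>\<in>Ix. A E g \<gamma> = (if \<gamma> = (\<lambda>_. 0) then g \<beta> else 0)" by auto
    have "i \<in> {1..n}" "\<theta> i = 0" using Suc by (auto simp: L_def)
    then show ?case using E by (intro bexI[of _ "E \<cdot> y i"]) (auto simp: A_mult A_yg yop_def fun_upd_def)
  qed
next
  case (Suc \<alpha> i)
  then obtain E where E: "E \<in> carrier S" "\<And>g \<gamma>. \<gamma> \<in> Ix \<Longrightarrow> A E g \<gamma> = (if \<gamma> = \<alpha> then g \<beta> else 0)" by auto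
  have i: "i \<in> {1..n}" "\<theta> i = 0" using Suc by (auto simp: L_def)
  have "A (x i \<cdot> E) g \<gamma> = (if \<gamma> = \<alpha>(i := Suc (\<alpha> i)) then g \<beta> else 0)" if "\<gamma> \<in> Ix" for g \<gamma>
  proof -
    have "\<gamma>(i := \<gamma> i - 1) = \<alpha> \<longleftrightarrow> \<gamma> = \<alpha>(i := Suc (\<alpha> i))" if "\<gamma> i \<noteq> 0"
      using that by (auto simp: fun_eq_iff)
    moreover have "\<gamma> \<noteq> \<alpha>(i := Suc (\<alpha> i))" if "\<gamma> i = 0" using that by auto
    ultimately show ?thesis
      using E(1) i E(2)[OF idx_updI[OF that Suc(2)], of g "\<gamma> i - 1"]
      by (cases "\<gamma> i = 0") (simp_all add: A_mult A_xg xop_def)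
  qed
  then show ?case using E(1) i by (intro bexI[of _ "x i \<cdot> E"]) auto
qed

text \<open>A nonzero entry of \<open>a\<close> in some column \<beta> and a nonzero value of
  \<open>b\<close> in row \<epsilon> are connected by the matrix unit at
  \<open>(\<beta>, \<epsilon>)\<close>; the result is the product of two nonzero elements of a
  field.\<close>

lemma A_prime:
  assumes "a \<in> carrier S" "b \<in> carrier S" "\<gamma> \<in> Ix" "\<epsilon> \<in> Ix" "A a g \<gamma> \<noteq> 0" "A b h \<epsilon> \<noteq> 0"
  shows "\<exists>c\<in>carrier S. A (a \<cdot> c \<cdot> b) h \<gamma> \<noteq> 0"
proof -
  obtain \<beta> where b: "\<beta> \<in> Ix" "A a (\<delta> \<beta>) \<gamma> \<noteq> 0" using assms A_nonzero_entry by blast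
  obtain E where E: "E \<in> carrier S" "\<And>g \<gamma>. \<gamma> \<in> Ix \<Longrightarrow> A E g \<gamma> = (if \<gamma> = \<beta> then g \<epsilon> else 0)"
    using ex_matrix_unit[OF b(1) assms(4)] by blast
  have "A (a \<cdot> E \<cdot> b) h \<gamma> = A a (A E (A b h)) \<gamma>"
    using assms E by (simp add: A_mult)
  also have "\<dots> = A a (\<lambda>\<eta>. A b h \<epsilon> * \<delta> \<beta> \<eta>) \<gamma>"
    using assms E by (intro A_cong) (auto simp: \<delta>_def)
  also have "\<dots> = A b h \<epsilon> * A a (\<delta> \<beta>) \<gamma>" using assms(1) by (rule A_arg_scale)
  finally show ?thesis using E b assms by (intro bexI[of _ E]) auto
qed

text \<open>Commuting with the matrix units whose second index is 0 forces the matrix to be a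
  multiple of the identity. Commutation is assumed for the operators and not in the algebra, so the
  lemma also describes elements that are central modulo the kernel of the representation.\<close>

lemma A_central:
  assumes a: "a \<in> carrier S"
    and comm: "\<And>c g \<gamma>. c \<in> carrier S \<Longrightarrow> \<gamma> \<in> Ix \<Longrightarrow> A (a \<cdot> c) g \<gamma> = A (c \<cdot> a) g \<gamma>"
  shows "\<forall>g. \<forall>\<gamma>\<in>Ix. A a g \<gamma> = A a (\<delta> (\<lambda>_. 0)) (\<lambda>_. 0) * g \<gamma>"
proof (intro allI ballI)
  fix g \<gamma> assume \<gamma>: "\<gamma> \<in> Ix"
  let ?k = "A a (\<delta> (\<lambda>_. 0)) (\<lambda>_. 0)"
  have entry: "A a (\<delta> \<beta>) \<gamma> = ?k * \<delta> \<beta> \<gamma>" if \<beta>: "\<beta> \<in> Ix" for \<beta>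
  proof -
    obtain E where E: "E \<in> carrier S" "\<And>g \<gamma>. \<gamma> \<in> Ix \<Longrightarrow> A E g \<gamma> = (if \<gamma> = \<beta> then g (\<lambda>_. 0) else 0)"
      using ex_matrix_unit[OF \<beta> zero_in_idx] by blast
    have "A a (\<delta> \<beta>) \<gamma> = A a (A E (\<delta> (\<lambda>_. 0))) \<gamma>"
      using a E \<gamma> by (intro A_cong) (auto simp: \<delta>_def)
    also have "\<dots> = A E (A a (\<delta> (\<lambda>_. 0))) \<gamma>"
      using comm[OF E(1) \<gamma>] a E(1) by (simp add: A_mult)
    also have "\<dots> = ?k * \<delta> \<beta> \<gamma>" using E \<gamma> by (simp add: \<delta>_def)
    finally show ?thesis .
  qed
  obtain D where D: "finite D" "D \<subseteq> Ix" "\<forall>g. A a g \<gamma> = (\<Sum>d\<in>D. g d * A a (\<delta> d) \<gamma>)"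
    using a \<gamma> by (rule A_row)
  have sum: "A a g \<gamma> = (\<Sum>d\<in>D. if d = \<gamma> then ?k * g d else 0)" for g
    unfolding D(3)[rule_format, of g] using D(2) entry by (intro sum.cong) (auto simp: \<delta>_def)
  show "A a g \<gamma> = ?k * g \<gamma>"
  proof (cases "\<gamma> \<in> D")
    case True
    then show ?thesis using sum[of g] D(1) by simp
  next
    case False
    then have "A a h \<gamma> = 0" for h using sum[of h] D(1) by simp
    then have "?k = 0" using entry[OF \<gamma>] by simp
    then show ?thesis using \<open>\<And>h. A a h \<gamma> = 0\<close> by simp
  qed
qed

end

section \<open>The height one primes\<close>

context one_sided_inverses
begin

section \<open>Elementary properties of algebra automorphisms\<close>

lemma Aut_hom:
  assumes "\<sigma> \<in> Aut K n"
  shows Aut_closed: "a \<in> carrier S \<Longrightarrow> \<sigma> a \<in> carrier S"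
    and Aut_mult: "a \<in> carrier S \<Longrightarrow> b \<in> carrier S \<Longrightarrow> \<sigma> (a \<cdot> b) = \<sigma> a \<cdot> \<sigma> b"
    and Aut_add: "a \<in> carrier S \<Longrightarrow> b \<in> carrier S \<Longrightarrow> \<sigma> (a \<boxplus> b) = \<sigma> a \<boxplus> \<sigma> b"
    and Aut_one: "\<sigma> \<one>\<^bsub>S\<^esub> = \<one>\<^bsub>S\<^esub>"
    and Aut_scal: "\<sigma> (sc c) = sc c"
    and Aut_bij: "bij_betw \<sigma> (carrier S) (carrier S)"
    and Aut_ext: "\<sigma> \<in> extensional (carrier S)"
  using assms by (auto simp: Aut_def ring_iso_def ring_hom_def)

lemma Aut_zero: "\<sigma> \<in> Aut K n \<Longrightarrow> \<sigma> \<zero>\<^bsub>S\<^esub> = \<zero>\<^bsub>S\<^esub>"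
  using ring_hom_zero[OF _ ring_Sn ring_Sn] by (auto simp: Aut_def ring_iso_def)

lemma Aut_uminus:
  assumes "\<sigma> \<in> Aut K n" "a \<in> carrier S" shows "\<sigma> (\<ominus>\<^bsub>S\<^esub> a) = \<ominus>\<^bsub>S\<^esub> \<sigma> a"
proof -
  have "\<sigma> (\<ominus>\<^bsub>S\<^esub> a) \<boxplus> \<sigma> a = \<zero>\<^bsub>S\<^esub>"
    using assms by (simp add: S.l_neg Aut_zero flip: Aut_add)
  then show ?thesis using assms by (simp add: Aut_closed S.minus_equality)
qed

lemma Aut_diff:
  "\<sigma> \<in> Aut K n \<Longrightarrow> a \<in> carrier S \<Longrightarrow> b \<in> carrier S \<Longrightarrow> \<sigma> (a \<boxminus> b) = \<sigma> a \<boxminus> \<sigma> b"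
  by (simp add: a_minus_def Aut_add Aut_uminus)

lemma AutI:
  assumes "\<And>a. a \<in> carrier S \<Longrightarrow> \<sigma> a \<in> carrier S"
    and "\<And>a b. a \<in> carrier S \<Longrightarrow> b \<in> carrier S \<Longrightarrow> \<sigma> (a \<cdot> b) = \<sigma> a \<cdot> \<sigma> b"
    and "\<And>a b. a \<in> carrier S \<Longrightarrow> b \<in> carrier S \<Longrightarrow> \<sigma> (a \<boxplus> b) = \<sigma> a \<boxplus> \<sigma> b"
    and "\<And>c. \<sigma> (sc c) = sc c"
    and "bij_betw \<sigma> (carrier S) (carrier S)" and "\<sigma> \<in> extensional (carrier S)"
  shows "\<sigma> \<in> Aut K n"
proof -
  have "sc 1 = \<one>\<^bsub>S\<^esub>"
    unfolding scal_def by (subst cls_one[symmetric]) (rule arg_cong[where f = cl], simp add: fun_eq_iff one_free_alg)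
  then show ?thesis using assms(4)[of 1] assms by (auto simp: Aut_def ring_iso_def ring_hom_def)
qed

lemma Aut_inverse:
  assumes s: "\<sigma> \<in> Aut K n"
  obtains \<rho> where "\<rho> \<in> Aut K n" "\<forall>a\<in>carrier S. \<rho> (\<sigma> a) = a" "\<forall>a\<in>carrier S. \<sigma> (\<rho> a) = a"
proof -
  define \<rho> where "\<rho> = restrict (inv_into (carrier S) \<sigma>) (carrier S)"
  note bij = Aut_bij[OF s]
  have l: "\<rho> (\<sigma> a) = a" if "a \<in> carrier S" for a
    using that bij Aut_closed[OF s] by (simp add: \<rho>_def bij_betw_def)
  have r: "\<sigma> (\<rho> a) = a" if "a \<in> carrier S" for a
    using that bij by (simp add: \<rho>_def bij_betw_def f_inv_into_f)
  have cl: "\<rho> a \<in> carrier S" if "a \<in> carrier S" for a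
    using that bij by (simp add: \<rho>_def bij_betw_def inv_into_into)
  have "\<rho> \<in> Aut K n"
  proof (rule AutI)
    show "\<rho> (a \<cdot> b) = \<rho> a \<cdot> \<rho> b" if "a \<in> carrier S" "b \<in> carrier S" for a b
      using l[of "\<rho> a \<cdot> \<rho> b"] that cl r by (simp add: Aut_mult[OF s])
    show "\<rho> (a \<boxplus> b) = \<rho> a \<boxplus> \<rho> b" if "a \<in> carrier S" "b \<in> carrier S" for a b
      using l[of "\<rho> a \<boxplus> \<rho> b"] that cl r by (simp add: Aut_add[OF s])
    show "\<rho> (sc c) = sc c" for c using l[of "sc c"] by (simp add: Aut_scal[OF s])
    show "bij_betw \<rho> (carrier S) (carrier S)"
      using bij_betw_inv_into[OF bij] by (simp add: \<rho>_def cong: bij_betw_cong)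
    show "\<rho> \<in> extensional (carrier S)" by (simp add: \<rho>_def)
  qed (rule cl)
  then show ?thesis using that l r by blast
qed

end

lemma finite_idx_box: "finite M \<Longrightarrow> finite {\<alpha> \<in> idx M. \<forall>j\<in>M. \<alpha> j < N}"
  by (rule finite_subset[OF _ finite_set_of_finite_funs[of M "{..<N}" 0]]) (auto simp: idx_def)

text \<open>A separate constant, since \<open>id\<close> would be rewritten inside the parameters of the representations.\<close>

definition ident :: "'a \<Rightarrow> 'a" where
  ident_apply: "ident c = c"

locale sn_reps = one_sided_inverses K n for K :: "'k::field itself" and n :: nat
begin

text \<open>\<open>F\<close> is the faithful representation, the kernel of \<open>T i\<close> is the \<open>i\<close>-th height one prime, and \<open>V i\<close>
  sends all other generators to 1.\<close>

sublocale F: sn_rep K n ident "\<lambda>_. 0"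
  by unfold_locales (auto simp: ident_apply)

sublocale T: sn_rep K n fls_const "\<lambda>j. if j = i then fls_X else 0" for i :: nat
  by unfold_locales (auto simp: fls_plus_const)

sublocale V: sn_rep K n ident "\<lambda>j. if j = i then 0 else 1" for i :: nat
  by unfold_locales (auto simp: ident_apply)

lemma L_simps [simp]: "F.L = {1..n}" "i \<in> {1..n} \<Longrightarrow> T.L i = {1..n} - {i}" "i \<in> {1..n} \<Longrightarrow> V.L i = {i}"
  by (auto simp: F.L_def T.L_def V.L_def)

lemma F_A_scal: "F.A (sc c) g \<alpha> = c * g \<alpha>"
  using F.A_scal[of c g \<alpha>] ident_apply[of c] by metis

lemma V_A_scal: "V.A i (sc c) g \<alpha> = c * g \<alpha>"
  using V.A_scal[of i c g \<alpha>] ident_apply[of c] by metis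

lemma F_eqI:
  assumes "a \<in> carrier S" "b \<in> carrier S"
    and "\<And>\<beta> \<gamma>. \<beta> \<in> Idx \<Longrightarrow> \<gamma> \<in> Idx \<Longrightarrow> F.A a (\<delta> \<beta>) \<gamma> = F.A b (\<delta> \<beta>) \<gamma>"
  shows "a = b"
proof -
  have "a \<boxminus> b = \<zero>\<^bsub>S\<^esub>"
    by (rule F.faithful) (use assms in \<open>auto simp: F.A_diff\<close>)
  then show ?thesis using assms by simp
qed

text \<open>The functions are tested on multi-indices whose \<open>i\<close>-th coordinate is frozen
  at 0, because \<open>x i\<close> acts as a scalar and shifts nothing.\<close>

definition p :: "nat \<Rightarrow> (letter list \<Rightarrow> 'k) set set" where
  "p i = {a \<in> carrier S. \<forall>g. \<forall>\<gamma>\<in>T.Ix i. T.A i a g \<gamma> = 0}"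

lemma p_zeroD: "a \<in> p i \<Longrightarrow> \<gamma> \<in> T.Ix i \<Longrightarrow> T.A i a g \<gamma> = 0"
  by (simp add: p_def)

lemma A_mult_zero_right:
  assumes "a \<in> carrier S" "c \<in> carrier S" "\<And>g \<gamma>. \<gamma> \<in> T.Ix i \<Longrightarrow> T.A i a g \<gamma> = 0" "\<gamma> \<in> T.Ix i"
  shows "T.A i (c \<cdot> a) g \<gamma> = 0"
proof -
  \<comment> \<open>Written as \<open>0 * 0\<close>, the zero function is a multiple of a function,
    and homogeneity in the argument shows that it is sent to 0.\<close>
  have "T.A i c (T.A i a g) \<gamma> = T.A i c (\<lambda>_. 0 * 0) \<gamma>" using assms by (intro T.A_cong) auto
  also have "\<dots> = 0" by (subst T.A_arg_scale[OF assms(2)]) simp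
  finally show ?thesis using assms by (simp add: T.A_mult)
qed

lemma ideal_p: "ideal (p i) S"
proof (rule idealI)
  show "subgroup (p i) (add_monoid S)"
  proof (rule S.add.subgroupI)
    show "p i \<noteq> {}" by (auto simp: p_def intro!: exI[of _ "\<zero>\<^bsub>S\<^esub>"])
  qed (auto simp: p_def T.A_add T.A_uminus)
next
  fix a c assume "a \<in> p i" "c \<in> carrier S"
  then show "c \<cdot> a \<in> p i" using A_mult_zero_right[of a c i] by (auto simp: p_def)
  show "a \<cdot> c \<in> p i" using \<open>a \<in> p i\<close> \<open>c \<in> carrier S\<close> by (auto simp: p_def T.A_mult)
qed (rule ring_Sn)

lemma e_in_p_iff: "i \<in> {1..n} \<Longrightarrow> j \<in> {1..n} \<Longrightarrow> e j \<in> p i \<longleftrightarrow> j = i"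
proof -
  assume ij: "i \<in> {1..n}" "j \<in> {1..n}"
  have "e j \<notin> p i" if "j \<noteq> i"
  proof
    assume "e j \<in> p i"
    then have "T.A i (e j) (\<lambda>_. 1) (\<lambda>_. 0) = 0" by (simp add: p_def)
    then show False using that ij by (simp add: T.A_e)
  qed
  then show ?thesis using ij by (auto simp: p_def T.A_e)
qed

lemma p_prime:
  assumes "a \<in> carrier S" "b \<in> carrier S" "a \<notin> p i" "b \<notin> p i"
  shows "\<exists>c\<in>carrier S. a \<cdot> c \<cdot> b \<notin> p i"
proof -
  obtain g \<gamma> h \<epsilon> where "\<gamma> \<in> T.Ix i" "T.A i a g \<gamma> \<noteq> 0" "\<epsilon> \<in> T.Ix i" "T.A i b h \<epsilon> \<noteq> 0"
    using assms by (auto simp: p_def)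
  then show ?thesis using T.A_prime[OF assms(1,2), of \<gamma> i \<epsilon> g h] by (auto simp: p_def)
qed

text \<open>Far from the boundary in direction \<open>i\<close> the matrix is constant along
  diagonals, and the constants are the Laurent coefficients of the corresponding entry under
  \<open>T i\<close>: moving down one row matches multiplication by the indeterminate. The agreement
  can fail near \<open>\<gamma> i = 0\<close>, where the shift \<open>x i\<close> inserts a
  zero.\<close>

lemma F_limit:
  assumes "a \<in> carrier S" and i: "i \<in> {1..n}"
  shows "\<exists>N. \<forall>\<beta> \<gamma>. N \<le> \<gamma> i \<longrightarrow> F.A a (\<delta> \<beta>) \<gamma> =
    fls_nth (T.A i a (\<delta> (\<beta>(i := 0))) (\<gamma>(i := 0))) (int (\<gamma> i) - int (\<beta> i))"
  using assms(1)
proof (induction rule: Sn_induct)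
  case zero
  then show ?case by simp
next
  case (add a b)
  obtain N M where N: "\<And>\<beta> \<gamma>. N \<le> \<gamma> i \<Longrightarrow> F.A a (\<delta> \<beta>) \<gamma> =
      fls_nth (T.A i a (\<delta> (\<beta>(i := 0))) (\<gamma>(i := 0))) (int (\<gamma> i) - int (\<beta> i))"
    and M: "\<And>\<beta> \<gamma>. M \<le> \<gamma> i \<Longrightarrow> F.A b (\<delta> \<beta>) \<gamma> =
      fls_nth (T.A i b (\<delta> (\<beta>(i := 0))) (\<gamma>(i := 0))) (int (\<gamma> i) - int (\<beta> i))"
    using add(3,4) by blast
  then show ?case using add(1,2)
    by (intro exI[of _ "max N M"]) (simp add: F.A_add T.A_add del: fun_upd_apply)
next
  case (scale c a)
  then obtain N where N: "\<And>\<beta> \<gamma>. N \<le> \<gamma> i \<Longrightarrow> F.A a (\<delta> \<beta>) \<gamma> =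
      fls_nth (T.A i a (\<delta> (\<beta>(i := 0))) (\<gamma>(i := 0))) (int (\<gamma> i) - int (\<beta> i))" by blast
  then show ?case using scale(1)
    by (intro exI[of _ N]) (simp add: F.A_mult T.A_mult F_A_scal T.A_scal del: fun_upd_apply)
next
  case one
  have "(\<delta> \<beta> \<gamma> :: 'k) = fls_nth (\<delta> (\<beta>(i := 0)) (\<gamma>(i := 0))) (int (\<gamma> i) - int (\<beta> i))" for \<beta> \<gamma>
  proof -
    have "\<gamma> = \<beta> \<longleftrightarrow> \<gamma>(i := 0) = \<beta>(i := 0) \<and> int (\<gamma> i) - int (\<beta> i) = 0"
      by (auto simp: fun_eq_iff)
    then show ?thesis by (auto simp: \<delta>_def)
  qed
  then show ?case by (simp del: fun_upd_apply)
next
  case (x j a)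
  then obtain N where N: "\<And>\<beta> \<gamma>. N \<le> \<gamma> i \<Longrightarrow> F.A a (\<delta> \<beta>) \<gamma> =
      fls_nth (T.A i a (\<delta> (\<beta>(i := 0))) (\<gamma>(i := 0))) (int (\<gamma> i) - int (\<beta> i))" by blast
  \<comment> \<open>For \<open>j = i\<close> the row of \<open>a\<close> that is consulted has an
    index one lower, so the bound grows by one. A factor \<open>y j\<close> looks one row further
    out and keeps the bound.\<close>
  have "F.A (x j \<cdot> a) (\<delta> \<beta>) \<gamma> =
      fls_nth (T.A i (x j \<cdot> a) (\<delta> (\<beta>(i := 0))) (\<gamma>(i := 0))) (int (\<gamma> i) - int (\<beta> i))"
    if "Suc N \<le> \<gamma> i" for \<beta> \<gamma>
  proof (cases "j = i")
    case True
    have "fls_nth (fls_X * T.A i a (\<delta> (\<beta>(i := 0))) (\<gamma>(i := 0))) (int (\<gamma> i) - int (\<beta> i))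
      = fls_nth (T.A i a (\<delta> (\<beta>(i := 0))) (\<gamma>(i := 0))) (int (\<gamma> i) - int (\<beta> i) - 1)"
      by (simp add: fls_X_times_conv_shift)
    then show ?thesis
      using True x(1,2) that N[of "\<gamma>(i := \<gamma> i - 1)" \<beta>]
      by (auto simp: F.A_mult T.A_mult F.A_xg T.A_xg xop_def of_nat_diff algebra_simps fun_upd_same fun_upd_other simp del: fun_upd_apply)
  next
    case False
    then show ?thesis
      using x(1,2) that N[of "\<gamma>(j := \<gamma> j - 1)" \<beta>]
      by (auto simp: F.A_mult T.A_mult F.A_xg T.A_xg xop_def fun_upd_twist fun_upd_same fun_upd_other simp del: fun_upd_apply)
  qed
  then show ?case by blast
next
  case (y j a)
  then obtain N where N: "\<And>\<beta> \<gamma>. N \<le> \<gamma> i \<Longrightarrow> F.A a (\<delta> \<beta>) \<gamma> =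
      fls_nth (T.A i a (\<delta> (\<beta>(i := 0))) (\<gamma>(i := 0))) (int (\<gamma> i) - int (\<beta> i))" by blast
  have "F.A (y j \<cdot> a) (\<delta> \<beta>) \<gamma> =
      fls_nth (T.A i (y j \<cdot> a) (\<delta> (\<beta>(i := 0))) (\<gamma>(i := 0))) (int (\<gamma> i) - int (\<beta> i))"
    if "N \<le> \<gamma> i" for \<beta> \<gamma>
  proof (cases "j = i")
    case True
    have "fls_nth (inverse fls_X * T.A i a (\<delta> (\<beta>(i := 0))) (\<gamma>(i := 0))) (int (\<gamma> i) - int (\<beta> i))
      = fls_nth (T.A i a (\<delta> (\<beta>(i := 0))) (\<gamma>(i := 0))) (int (\<gamma> i) - int (\<beta> i) + 1)"
      by (simp add: fls_inverse_X fls_X_inv_times_conv_shift)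
    then show ?thesis
      using True y(1,2) that N[of "\<gamma>(i := Suc (\<gamma> i))" \<beta>]
      by (auto simp: F.A_mult T.A_mult F.A_yg T.A_yg yop_def algebra_simps fun_upd_same fun_upd_other simp del: fun_upd_apply)
  next
    case False
    then show ?thesis
      using y(1,2) that N[of "\<gamma>(j := Suc (\<gamma> j))" \<beta>]
      by (auto simp: F.A_mult T.A_mult F.A_yg T.A_yg yop_def fun_upd_twist fun_upd_same fun_upd_other simp del: fun_upd_apply)
  qed
  then show ?case by blast
qed

text \<open>Among the generators only \<open>y i\<close> lets the column index exceed the row index
  in direction \<open>i\<close>, and it does so by one per factor.\<close>

lemma F_band:
  assumes "a \<in> carrier S"
  shows "\<exists>N. \<forall>\<beta> \<gamma>. F.A a (\<delta> \<beta>) \<gamma> \<noteq> 0 \<longrightarrow> \<beta> i \<le> \<gamma> i + N"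
  using assms
proof (induction rule: Sn_induct)
  case zero
  then show ?case by simp
next
  case (add a b)
  obtain N M where "\<forall>\<beta> \<gamma>. F.A a (\<delta> \<beta>) \<gamma> \<noteq> 0 \<longrightarrow> \<beta> i \<le> \<gamma> i + N" "\<forall>\<beta> \<gamma>. F.A b (\<delta> \<beta>) \<gamma> \<noteq> 0 \<longrightarrow> \<beta> i \<le> \<gamma> i + M"
    using add(3,4) by blast
  then show ?case using add(1,2)
    by (intro exI[of _ "N + M"]) (simp add: F.A_add, metis add.left_neutral add.right_neutral add_le_cancel_left le_add1 le_add2 order.trans)
next
  case (scale c a)
  then show ?case by (simp add: F.A_mult F_A_scal) blast
next
  case one
  then show ?case by (simp add: \<delta>_def)
next
  case (x j a)
  then obtain N where N: "\<forall>\<beta> \<gamma>. F.A a (\<delta> \<beta>) \<gamma> \<noteq> 0 \<longrightarrow> \<beta> i \<le> \<gamma> i + N" by blast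
  have "\<beta> i \<le> \<gamma> i + N" if "F.A (x j \<cdot> a) (\<delta> \<beta>) \<gamma> \<noteq> 0" for \<beta> \<gamma>
    using that N[rule_format, of \<beta> "\<gamma>(j := \<gamma> j - 1)"] x(1,2)
    by (auto simp: F.A_mult F.A_xg xop_def split: if_splits)
  then show ?case by blast
next
  case (y j a)
  then obtain N where N: "\<forall>\<beta> \<gamma>. F.A a (\<delta> \<beta>) \<gamma> \<noteq> 0 \<longrightarrow> \<beta> i \<le> \<gamma> i + N" by blast
  have "\<beta> i \<le> \<gamma> i + Suc N" if "F.A (y j \<cdot> a) (\<delta> \<beta>) \<gamma> \<noteq> 0" for \<beta> \<gamma>
    using that N[rule_format, of \<beta> "\<gamma>(j := Suc (\<gamma> j))"] y(1,2)
    by (auto simp: F.A_mult F.A_yg yop_def split: if_splits)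
  then show ?case by blast
qed

text \<open>In rows beyond \<open>N\<close> the entries are Laurent coefficients of zero. A far
  column in a row below \<open>N\<close> lies outside the band of width \<open>M\<close>; hence the
  bound \<open>N + M\<close>.\<close>

lemma p_box:
  assumes a: "a \<in> p i" and i: "i \<in> {1..n}"
  shows "\<exists>N. \<forall>\<beta> \<gamma>. \<gamma> \<in> Idx \<longrightarrow> N \<le> \<gamma> i \<or> N \<le> \<beta> i \<longrightarrow> F.A a (\<delta> \<beta>) \<gamma> = 0"
proof -
  have ca: "a \<in> carrier S" using a by (simp add: p_def)
  obtain N where N: "\<And>\<beta> \<gamma>. N \<le> \<gamma> i \<Longrightarrow> F.A a (\<delta> \<beta>) \<gamma> =
      fls_nth (T.A i a (\<delta> (\<beta>(i := 0))) (\<gamma>(i := 0))) (int (\<gamma> i) - int (\<beta> i))"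
    using F_limit[OF ca i] by blast
  obtain M where M: "\<And>\<beta> \<gamma>. F.A a (\<delta> \<beta>) \<gamma> \<noteq> 0 \<Longrightarrow> \<beta> i \<le> \<gamma> i + M" using F_band[OF ca] by blast
  have row: "F.A a (\<delta> \<beta>) \<gamma> = 0" if "\<gamma> \<in> Idx" "N \<le> \<gamma> i" for \<beta> \<gamma>
  proof -
    have "\<gamma>(i := 0) \<in> T.Ix i" using that i by (auto simp: idx_def)
    then have "T.A i a (\<delta> (\<beta>(i := 0))) (\<gamma>(i := 0)) = 0" using a unfolding p_def by blast
    then show ?thesis using N[of \<gamma> \<beta>] that(2) by simp
  qed
  have "F.A a (\<delta> \<beta>) \<gamma> = 0" if "\<gamma> \<in> Idx" "N + M \<le> \<gamma> i \<or> N + M \<le> \<beta> i" for \<beta> \<gamma>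
    using row[OF that(1)] M[of \<beta> \<gamma>] that(2) by fastforce
  then show ?thesis by blast
qed

lemma p_rows:
  assumes "a \<in> p i" "i \<in> {1..n}"
  shows "\<exists>N. \<forall>g. \<forall>\<gamma>\<in>Idx. N \<le> \<gamma> i \<longrightarrow> F.A a g \<gamma> = 0"
proof -
  have ca: "a \<in> carrier S" using assms by (simp add: p_def)
  obtain N where N: "\<And>\<beta> \<gamma>. \<gamma> \<in> Idx \<Longrightarrow> N \<le> \<gamma> i \<Longrightarrow> F.A a (\<delta> \<beta>) \<gamma> = 0"
    using p_box[OF assms] by blast
  have "F.A a g \<gamma> = 0" if "\<gamma> \<in> Idx" "N \<le> \<gamma> i" for g \<gamma>
    using F.A_nonzero_entry[OF ca, of \<gamma> g] N[OF that] that by auto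
  then show ?thesis by blast
qed

text \<open>The projections are the sums of \<open>x^k e y^k\<close> over \<open>k < N\<close>,
  generated by passing from \<open>P\<close> to \<open>e + x P y\<close>. Their action is recorded
  in two representations at once, because bounds found in the faithful one are later transferred to
  \<open>V j\<close>.\<close>

lemma ideal_projection:
  assumes "ideal Q S" "j \<in> {1..n}" "e j \<in> Q"
  shows "\<exists>P\<in>Q. (\<forall>g \<gamma>. F.A P g \<gamma> = (if \<gamma> j < N then g \<gamma> else 0)) \<and>
    (\<forall>g \<gamma>. V.A j P g \<gamma> = (if \<gamma> j < N then g \<gamma> else 0))"
proof (induction N)
  interpret Q: ideal Q S by fact
  case 0
  show ?case by (intro bexI[of _ "\<zero>\<^bsub>S\<^esub>"]) auto
next
  interpret Q: ideal Q S by fact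
  case (Suc N)
  then obtain P where P: "P \<in> Q" "\<forall>g \<gamma>. F.A P g \<gamma> = (if \<gamma> j < N then g \<gamma> else 0)"
    "\<forall>g \<gamma>. V.A j P g \<gamma> = (if \<gamma> j < N then g \<gamma> else 0)" by blast
  have c: "P \<in> carrier S" "e j \<in> carrier S" using P(1) assms Q.Icarr by auto
  have "e j \<boxplus> x j \<cdot> P \<cdot> y j \<in> Q"
    using assms P c by (simp add: Q.I_l_closed Q.I_r_closed)
  moreover have "F.A (e j \<boxplus> x j \<cdot> P \<cdot> y j) g \<gamma> = (if \<gamma> j < Suc N then g \<gamma> else 0)" for g \<gamma>
    using assms c P(2) by (auto simp: F.A_add F.A_mult F.A_e F.A_xg F.A_yg xop_def yop_def)
  moreover have "V.A j (e j \<boxplus> x j \<cdot> P \<cdot> y j) g \<gamma> = (if \<gamma> j < Suc N then g \<gamma> else 0)" for g \<gamma>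
    using assms c P(3) by (auto simp: V.A_add V.A_mult V.A_e V.A_xg V.A_yg xop_def yop_def)
  ultimately show ?case by blast
qed

text \<open>The nonzero rows of \<open>a\<close> have bounded index in direction \<open>j\<close>,
  so the projection onto these rows fixes \<open>a\<close> from the left; this projection lies in
  every ideal that contains \<open>e j\<close>.\<close>

lemma p_absorbs:
  assumes Q: "ideal Q S" and j: "j \<in> {1..n}" and ej: "e j \<in> Q" and a: "a \<in> p j"
  obtains P N where "P \<in> Q" "P \<cdot> a = a" "\<forall>g \<gamma>. V.A j P g \<gamma> = (if \<gamma> j < N then g \<gamma> else 0)"
proof -
  interpret Q: ideal Q S by fact
  have ca: "a \<in> carrier S" using a by (simp add: p_def)
  obtain N where N: "\<And>g \<gamma>. \<gamma> \<in> Idx \<Longrightarrow> N \<le> \<gamma> j \<Longrightarrow> F.A a g \<gamma> = 0" using p_rows[OF a j] by blast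
  obtain P where P: "P \<in> Q" "\<And>g \<gamma>. F.A P g \<gamma> = (if \<gamma> j < N then g \<gamma> else 0)"
    "\<forall>g \<gamma>. V.A j P g \<gamma> = (if \<gamma> j < N then g \<gamma> else 0)"
    using ideal_projection[OF Q j ej] by blast
  have "P \<cdot> a = a"
    using ca P(1,2) Q.Icarr N by (intro F_eqI) (auto simp: F.A_mult)
  then show ?thesis using that P(1,3) by blast
qed

lemma p_subset_ideal:
  assumes Q: "ideal Q S" and j: "j \<in> {1..n}" and ej: "e j \<in> Q"
  shows "p j \<subseteq> Q"
proof
  fix a assume a: "a \<in> p j"
  then have ca: "a \<in> carrier S" by (simp add: p_def)
  obtain P where "P \<in> Q" "P \<cdot> a = a" using p_absorbs[OF Q j ej a] by metis
  then show "a \<in> Q" using ideal.I_r_closed[OF Q _ ca] by metis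
qed

text \<open>A bound on rows does not pass from one representation to another by itself. The identity
  \<open>P \<cdot> a = a\<close> holds in the algebra and carries the bound over to
  \<open>V j\<close>, where \<open>P\<close> is again a projection.\<close>

lemma p_V_rows:
  assumes "a \<in> p j" "j \<in> {1..n}"
  shows "\<exists>N. \<forall>g \<gamma>. N \<le> \<gamma> j \<longrightarrow> V.A j a g \<gamma> = 0"
proof -
  have ca: "a \<in> carrier S" using assms by (simp add: p_def)
  obtain P N where P: "P \<in> p j" "P \<cdot> a = a" "\<forall>g \<gamma>. V.A j P g \<gamma> = (if \<gamma> j < N then g \<gamma> else 0)"
    using p_absorbs[OF ideal_p assms(2) _ assms(1)] e_in_p_iff[OF assms(2) assms(2)] by metis
  have "P \<in> carrier S" using P(1) by (simp add: p_def)
  then have "V.A j a g \<gamma> = (if \<gamma> j < N then V.A j a g \<gamma> else 0)" for g \<gamma>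
    using P(2,3) ca V.A_mult[of P a j g] by metis
  then show ?thesis by (metis not_less)
qed

section \<open>Matrix units in nonzero ideals\<close>

definition EU :: "(nat \<Rightarrow> nat) \<Rightarrow> (nat \<Rightarrow> nat) \<Rightarrow> (letter list \<Rightarrow> 'k) set" where
  "EU \<alpha> \<beta> = (SOME E. E \<in> carrier S \<and> (\<forall>g. \<forall>\<gamma>\<in>Idx. F.A E g \<gamma> = (if \<gamma> = \<alpha> then g \<beta> else 0)))"

lemma
  assumes "\<alpha> \<in> Idx" "\<beta> \<in> Idx"
  shows EU_closed [simp]: "EU \<alpha> \<beta> \<in> carrier S"
    and A_EU: "\<gamma> \<in> Idx \<Longrightarrow> F.A (EU \<alpha> \<beta>) g \<gamma> = (if \<gamma> = \<alpha> then g \<beta> else 0)"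
proof -
  have "\<exists>E. E \<in> carrier S \<and> (\<forall>g. \<forall>\<gamma>\<in>Idx. F.A E g \<gamma> = (if \<gamma> = \<alpha> then g \<beta> else 0))"
    using F.ex_matrix_unit[of \<alpha> \<beta>] assms by auto
  from someI_ex[OF this]
  show "EU \<alpha> \<beta> \<in> carrier S" "\<gamma> \<in> Idx \<Longrightarrow> F.A (EU \<alpha> \<beta>) g \<gamma> = (if \<gamma> = \<alpha> then g \<beta> else 0)"
    unfolding EU_def by auto
qed

lemma F_A_cong: "a \<in> carrier S \<Longrightarrow> \<gamma> \<in> Idx \<Longrightarrow> (\<And>d. d \<in> Idx \<Longrightarrow> g d = h d) \<Longrightarrow> F.A a g \<gamma> = F.A a h \<gamma>"
  using F.A_cong[of a \<gamma> g h] by simp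

lemma F_nonzero_entry:
  assumes "a \<in> carrier S" "a \<noteq> \<zero>\<^bsub>S\<^esub>"
  obtains \<beta> \<gamma> where "\<beta> \<in> Idx" "\<gamma> \<in> Idx" "F.A a (\<delta> \<beta>) \<gamma> \<noteq> 0"
  using F.faithful[of a] assms by auto

lemma A_mult_EU:
  assumes "a \<in> carrier S" "\<alpha> \<in> Idx" "\<beta> \<in> Idx" "\<gamma> \<in> Idx"
  shows "F.A (a \<cdot> EU \<alpha> \<beta>) g \<gamma> = g \<beta> * F.A a (\<delta> \<alpha>) \<gamma>"
proof -
  have "F.A (a \<cdot> EU \<alpha> \<beta>) g \<gamma> = F.A a (\<lambda>\<eta>. g \<beta> * \<delta> \<alpha> \<eta>) \<gamma>"
    using assms by (simp add: F.A_mult) (rule F_A_cong, auto simp: A_EU \<delta>_def)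
  then show ?thesis using F.A_arg_scale[OF assms(1)] by simp
qed

text \<open>Multiplying \<open>a\<close> by matrix units on both sides isolates one nonzero entry
  and moves it to position \<open>(\<alpha>, \<beta>)\<close>; dividing by the entry leaves the
  unit.\<close>

lemma EU_in_ideal:
  assumes Q: "ideal Q S" and a: "a \<in> Q" "a \<noteq> \<zero>\<^bsub>S\<^esub>" and ab: "\<alpha> \<in> Idx" "\<beta> \<in> Idx"
  shows "EU \<alpha> \<beta> \<in> Q"
proof -
  interpret Q: ideal Q S by fact
  have ca: "a \<in> carrier S" using a Q.Icarr by auto
  obtain \<gamma> \<epsilon> where ge: "\<gamma> \<in> Idx" "\<epsilon> \<in> Idx" "F.A a (\<delta> \<epsilon>) \<gamma> \<noteq> 0" using F_nonzero_entry[OF ca a(2)] by metis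
  let ?b = "sc (inverse (F.A a (\<delta> \<epsilon>) \<gamma>)) \<cdot> (EU \<alpha> \<gamma> \<cdot> (a \<cdot> EU \<epsilon> \<beta>))"
  have "?b \<in> Q" using a ab ge by (simp add: Q.I_l_closed Q.I_r_closed)
  moreover have "?b = EU \<alpha> \<beta>"
    using ab ge ca
    by (intro F_eqI) (auto simp: F.A_mult[of "sc _"] F.A_mult[of "EU _ _"] F_A_scal A_EU A_mult_EU)
  ultimately show ?thesis by simp
qed

text \<open>Membership in all the primes bounds every coordinate of the nonzero rows, so they lie in
  a finite box \<open>B\<close>. The sum of the diagonal matrix units over \<open>B\<close> belongs
  to \<open>Q\<close> and fixes \<open>a\<close> from the left.\<close>

lemma inter_p_subset_ideal:
  assumes Q: "ideal Q S" and EQ: "\<And>\<alpha>. \<alpha> \<in> Idx \<Longrightarrow> EU \<alpha> \<alpha> \<in> Q"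
    and a: "a \<in> carrier S" "\<And>j. j \<in> {1..n} \<Longrightarrow> a \<in> p j"
  shows "a \<in> Q"
proof -
  interpret Q: ideal Q S by fact
  have "\<forall>j\<in>{1..n}. \<exists>N. \<forall>g. \<forall>\<gamma>\<in>Idx. N \<le> \<gamma> j \<longrightarrow> F.A a g \<gamma> = 0"
    using a p_rows by blast
  then obtain N where N: "\<And>j g \<gamma>. j \<in> {1..n} \<Longrightarrow> \<gamma> \<in> Idx \<Longrightarrow> N j \<le> \<gamma> j \<Longrightarrow> F.A a g \<gamma> = 0"
    by metis
  define M where "M = (\<Sum>j\<in>{1..n}. N j)"
  have NM: "N j \<le> M" if "j \<in> {1..n}" for j unfolding M_def by (rule member_le_sum) (use that in auto)
  define B where "B = {\<alpha> \<in> Idx. \<forall>j\<in>{1..n}. \<alpha> j < M}"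
  have "finite B" unfolding B_def by (rule finite_idx_box) simp
  moreover have "finite B' \<Longrightarrow> B' \<subseteq> Idx \<Longrightarrow>
      \<exists>P\<in>Q. \<forall>g. \<forall>\<gamma>\<in>Idx. F.A P g \<gamma> = (if \<gamma> \<in> B' then g \<gamma> else 0)" for B'
  proof (induction B' rule: finite_induct)
    case empty
    show ?case by (intro bexI[of _ "\<zero>\<^bsub>S\<^esub>"]) auto
  next
    case (insert \<alpha> B')
    then obtain P where P: "P \<in> Q" "\<forall>g. \<forall>\<gamma>\<in>Idx. F.A P g \<gamma> = (if \<gamma> \<in> B' then g \<gamma> else 0)" by auto
    then show ?case using insert EQ[of \<alpha>] Q.Icarr[OF P(1)]
      by (intro bexI[of _ "P \<boxplus> EU \<alpha> \<alpha>"]) (auto simp: F.A_add A_EU)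
  qed
  ultimately obtain P where P: "P \<in> Q" "\<And>g \<gamma>. \<gamma> \<in> Idx \<Longrightarrow> F.A P g \<gamma> = (if \<gamma> \<in> B then g \<gamma> else 0)"
    unfolding B_def by (metis (no_types, lifting) mem_Collect_eq subsetI)
  have "F.A a g \<gamma> = 0" if out: "\<gamma> \<in> Idx" "\<gamma> \<notin> B" for g \<gamma>
  proof -
    obtain j where "j \<in> {1..n}" "M \<le> \<gamma> j" using out by (auto simp: B_def not_less)
    then show ?thesis using N[of j \<gamma> g] NM[of j] out by simp
  qed
  then have "P \<cdot> a = a"
    using a(1) P Q.Icarr by (intro F_eqI) (auto simp: F.A_mult)
  then show "a \<in> Q" using Q.I_r_closed[OF P(1) a(1)] by simp
qed

lemma e_nonzero: "i \<in> {1..n} \<Longrightarrow> e i \<noteq> \<zero>\<^bsub>S\<^esub>"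
proof
  assume "i \<in> {1..n}" "e i = \<zero>\<^bsub>S\<^esub>"
  then have "F.A (e i) (\<lambda>_. 1) (\<lambda>_. 0) = 0" by simp
  then show False using \<open>i \<in> {1..n}\<close> by (simp add: F.A_e)
qed

section \<open>Automorphisms permute the primes\<close>

lemma ideal_vimage_Aut:
  assumes s: "\<sigma> \<in> Aut K n" and Q: "ideal Q S"
  shows "ideal {a \<in> carrier S. \<sigma> a \<in> Q} S" (is "ideal ?J S")
proof (rule idealI)
  interpret Q: ideal Q S by fact
  show "subgroup ?J (add_monoid S)"
    by (rule S.add.subgroupI) (auto simp: Aut_add[OF s] Aut_uminus[OF s] Aut_zero[OF s] intro!: exI[of _ "\<zero>\<^bsub>S\<^esub>"])
  fix a c assume "a \<in> ?J" "c \<in> carrier S"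
  then show "c \<cdot> a \<in> ?J" "a \<cdot> c \<in> ?J"
    by (auto simp: Aut_mult[OF s] Aut_closed[OF s] Q.I_l_closed Q.I_r_closed)
qed (rule ring_Sn)

text \<open>The preimage \<open>Q\<close> of \<open>p i\<close> is a nonzero prime. If it contained
  no \<open>e j\<close>, primeness would yield an element outside \<open>Q\<close> that is a product
  of all the \<open>e j\<close> with factors in between. That element lies in every
  \<open>p j\<close>, so it is a finite matrix, and a nonzero ideal contains all of these.\<close>

lemma p_subset_vimage:
  assumes s: "\<sigma> \<in> Aut K n" and i: "i \<in> {1..n}"
  shows "\<exists>j\<in>{1..n}. \<forall>a\<in>p j. \<sigma> a \<in> p i"
proof -
  define Q where "Q = {a \<in> carrier S. \<sigma> a \<in> p i}"
  have Q: "ideal Q S" unfolding Q_def by (rule ideal_vimage_Aut[OF s ideal_p])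
  obtain \<rho> where r: "\<rho> \<in> Aut K n" "\<forall>a\<in>carrier S. \<rho> (\<sigma> a) = a" "\<forall>a\<in>carrier S. \<sigma> (\<rho> a) = a"
    using s by (rule Aut_inverse)
  have se: "\<sigma> (\<rho> (e i)) = e i" using r(3) e_closed[OF i] by blast
  have "\<rho> (e i) \<in> Q"
    unfolding Q_def using se e_in_p_iff[OF i i] Aut_closed[OF r(1) e_closed[OF i]] by simp
  moreover have "\<rho> (e i) \<noteq> \<zero>\<^bsub>S\<^esub>" using e_nonzero[OF i] se Aut_zero[OF s] by auto
  ultimately have EQ: "EU \<alpha> \<alpha> \<in> Q" if "\<alpha> \<in> Idx" for \<alpha>
    using EU_in_ideal[OF Q, of "\<rho> (e i)" \<alpha> \<alpha>] that by simp
  have prime: "\<exists>c\<in>carrier S. a \<cdot> c \<cdot> b \<notin> Q"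
    if ab: "a \<in> carrier S" "b \<in> carrier S" "a \<notin> Q" "b \<notin> Q" for a b
  proof -
    have "\<sigma> a \<notin> p i" "\<sigma> b \<notin> p i" using ab unfolding Q_def by simp_all
    then obtain c where c: "c \<in> carrier S" "\<sigma> a \<cdot> c \<cdot> \<sigma> b \<notin> p i"
      using p_prime[OF Aut_closed[OF s ab(1)] Aut_closed[OF s ab(2)]] by blast
    have rc: "\<rho> c \<in> carrier S" "\<sigma> (\<rho> c) = c" using c r(3) Aut_closed[OF r(1)] by auto
    have "\<sigma> (a \<cdot> \<rho> c \<cdot> b) = \<sigma> a \<cdot> c \<cdot> \<sigma> b"
      using ab rc by (simp add: Aut_mult[OF s])
    then have "a \<cdot> \<rho> c \<cdot> b \<notin> Q" using c(2) unfolding Q_def by simp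
    then show ?thesis using rc(1) by blast
  qed
  have "\<exists>j\<in>{1..n}. e j \<in> Q"
  proof (rule ccontr)
    assume no: "\<not> ?thesis"
    have "finite M \<Longrightarrow> M \<subseteq> {1..n} \<Longrightarrow> \<exists>b\<in>carrier S. b \<notin> Q \<and> (\<forall>j\<in>M. b \<in> p j)" for M
    proof (induction M rule: finite_induct)
      case empty
      have "\<one>\<^bsub>S\<^esub> \<notin> p i" 
        using p_zeroD[of "\<one>\<^bsub>S\<^esub>" i "\<lambda>_. 0" "\<lambda>_. 1"] by auto
      then show ?case using Aut_one[OF s] by (intro bexI[of _ "\<one>\<^bsub>S\<^esub>"]) (auto simp: Q_def)
    next
      case (insert j M)
      then obtain b where b: "b \<in> carrier S" "b \<notin> Q" "\<forall>j\<in>M. b \<in> p j" by auto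
      obtain c where c: "c \<in> carrier S" "b \<cdot> c \<cdot> e j \<notin> Q"
        using prime[OF b(1) _ b(2), of "e j"] no insert.prems by auto
      have "b \<cdot> c \<cdot> e j \<in> p k" if "k \<in> insert j M" for k
      proof (cases "k = j")
        case True
        then show ?thesis
          using ideal.I_l_closed[OF ideal_p, of "e j" j "b \<cdot> c"] e_in_p_iff[of j j] insert.prems b c by auto
      next
        case False
        then have "b \<cdot> (c \<cdot> e j) \<in> p k"
          using ideal.I_r_closed[OF ideal_p, of b k] that insert.prems b c by auto
        then show ?thesis using b c insert.prems by (simp add: S.m_assoc)
      qed
      then show ?case using b c insert.prems by (intro bexI[of _ "b \<cdot> c \<cdot> e j"]) auto
    qed
    then obtain b where "b \<in> carrier S" "b \<notin> Q" "\<forall>j\<in>{1..n}. b \<in> p j" by blast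
    then show False using inter_p_subset_ideal[OF Q EQ] by blast
  qed
  then obtain j where "j \<in> {1..n}" "e j \<in> Q" by blast
  then have "p j \<subseteq> Q" using p_subset_ideal[OF Q] by blast
  then show ?thesis using \<open>j \<in> {1..n}\<close> unfolding Q_def by blast
qed

text \<open>The inclusion is applied to \<sigma> and then to its inverse, which gives an inclusion
  of \<open>p k\<close> in \<open>p i\<close>. This forces \<open>k = i\<close>, since
  \<open>e k\<close> lies in \<open>p i\<close> for no other \<open>k\<close>, and both inclusions
  become equalities.\<close>

lemma Aut_permutes_p:
  assumes s: "\<sigma> \<in> Aut K n" and i: "i \<in> {1..n}"
  shows "\<exists>j\<in>{1..n}. \<forall>a\<in>carrier S. \<sigma> a \<in> p i \<longleftrightarrow> a \<in> p j"
proof -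
  obtain \<rho> where r: "\<rho> \<in> Aut K n" "\<forall>a\<in>carrier S. \<rho> (\<sigma> a) = a" "\<forall>a\<in>carrier S. \<sigma> (\<rho> a) = a"
    using s by (rule Aut_inverse)
  obtain j where j: "j \<in> {1..n}" "\<forall>a\<in>p j. \<sigma> a \<in> p i" using p_subset_vimage[OF s i] by blast
  obtain k where k: "k \<in> {1..n}" "\<forall>a\<in>p k. \<rho> a \<in> p j" using p_subset_vimage[OF r(1) j(1)] by blast
  have "\<sigma> (\<rho> (e k)) \<in> p i" using j(2) k e_in_p_iff[OF k(1) k(1)] by blast
  then have "e k \<in> p i" using r(3) e_closed[OF k(1)] by simp
  then have ki: "k = i" using e_in_p_iff[OF i k(1)] by simp
  have "a \<in> p j" if "a \<in> carrier S" "\<sigma> a \<in> p i" for a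
    using k(2) ki r(2) that by force
  then show ?thesis using j by blast
qed

end

section \<open>Images of the generators\<close>

text \<open>Gaussian elimination: if the last equation has a nonzero coefficient at
  \<open>s\<close>, it is used to remove the unknown \<open>s\<close> from the remaining
  equations.\<close>

lemma homogeneous_system_solution:
  fixes a :: "nat \<Rightarrow> 'b \<Rightarrow> 'k::field"
  assumes "finite T" "m < card T"
  shows "\<exists>c. (\<exists>t\<in>T. c t \<noteq> 0) \<and> (\<forall>r<m. (\<Sum>t\<in>T. c t * a r t) = 0)"
  using assms
proof (induction m arbitrary: T a)
  case 0
  then show ?case by (intro exI[of _ "\<lambda>_. 1"]) (auto simp: card_gt_0_iff)
next
  case (Suc m)
  show ?case
  proof (cases "\<forall>t\<in>T. a m t = 0")
    case True
    obtain c where "\<exists>t\<in>T. c t \<noteq> 0" "\<forall>r<m. (\<Sum>t\<in>T. c t * a r t) = 0"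
      using Suc.IH[of T a] Suc.prems by auto
    then show ?thesis using True by (intro exI[of _ c]) (auto simp: less_Suc_eq)
  next
    case False
    then obtain s where s: "s \<in> T" "a m s \<noteq> 0" by blast
    let ?T = "T - {s}"
    define b where "b r t = a r t - a m t / a m s * a r s" for r t
    have "m < card ?T" using Suc.prems s by simp
    then obtain c where c: "\<exists>t\<in>?T. c t \<noteq> 0" "\<forall>r<m. (\<Sum>t\<in>?T. c t * b r t) = 0"
      using Suc.IH[of ?T b] Suc.prems by auto
    \<comment> \<open>The value at \<open>s\<close> is the one that the last equation
      forces.\<close>
    define d where "d = c(s := - (\<Sum>t\<in>?T. c t * (a m t / a m s)))"
    have split: "(\<Sum>t\<in>T. d t * a r t) = (\<Sum>t\<in>?T. c t * b r t)" for r
    proof -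
      have "(\<Sum>t\<in>T. d t * a r t) = d s * a r s + (\<Sum>t\<in>?T. d t * a r t)"
        using Suc.prems(1) s(1) by (rule sum.remove)
      also have "(\<Sum>t\<in>?T. d t * a r t) = (\<Sum>t\<in>?T. c t * a r t)"
        by (intro sum.cong) (auto simp: d_def)
      also have "d s * a r s + (\<Sum>t\<in>?T. c t * a r t) = (\<Sum>t\<in>?T. c t * b r t)"
        by (simp add: d_def b_def right_diff_distrib sum_subtractf sum_distrib_right mult.assoc)
      finally show ?thesis .
    qed
    have "b m t = 0" for t using s(2) by (simp add: b_def)
    then have "\<forall>r<Suc m. (\<Sum>t\<in>T. d t * a r t) = 0"
      using c(2) by (auto simp: split less_Suc_eq)
    moreover have "\<exists>t\<in>T. d t \<noteq> 0" using c(1) by (auto simp: d_def)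
    ultimately show ?thesis by blast
  qed
qed

text \<open>In a product of Laurent polynomials the lowest terms and the highest terms multiply
  without cancellation. Both pairs of degrees therefore add up to 0, so the lowest and the highest
  degree of \<open>c\<close> coincide.\<close>

lemma fls_finite_support_unit:
  fixes c d :: "'k::field fls"
  assumes "c * d = 1" and fin: "finite {k. fls_nth c k \<noteq> 0}" "finite {k. fls_nth d k \<noteq> 0}"
  shows "\<exists>m. \<forall>k. fls_nth c k \<noteq> 0 \<longrightarrow> k = m"
proof -
  have nz: "c \<noteq> 0" "d \<noteq> 0" using assms(1) by auto
  let ?C = "{k. fls_nth c k \<noteq> 0}" and ?D = "{k. fls_nth d k \<noteq> 0}"
  have mem: "fls_subdegree c \<in> ?C" "fls_subdegree d \<in> ?D" using nz by auto
  define m m' where "m = Max ?C" and "m' = Max ?D"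
  have m: "fls_nth c m \<noteq> 0" "\<And>k. fls_nth c k \<noteq> 0 \<Longrightarrow> k \<le> m"
    using Max_in[OF fin(1)] Max_ge[OF fin(1)] mem by (auto simp: m_def)
  have m': "fls_nth d m' \<noteq> 0" "\<And>k. fls_nth d k \<noteq> 0 \<Longrightarrow> k \<le> m'"
    using Max_in[OF fin(2)] Max_ge[OF fin(2)] mem by (auto simp: m'_def)
  have "fls_nth (c * d) (m + m') = (\<Sum>i=fls_subdegree c..m + m' - fls_subdegree d. fls_nth c i * fls_nth d (m + m' - i))"
    by (rule fls_times_nth(2))
  also have "\<dots> = (\<Sum>i=fls_subdegree c..m + m' - fls_subdegree d. if i = m then fls_nth c m * fls_nth d m' else 0)"
  proof (intro sum.cong refl)
    fix i
    show "fls_nth c i * fls_nth d (m + m' - i) = (if i = m then fls_nth c m * fls_nth d m' else 0)"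
      using m(2)[of i] m'(2)[of "m + m' - i"] by (cases i m rule: linorder_cases) auto
  qed
  also have "\<dots> = fls_nth c m * fls_nth d m'"
    using m(2) m'(2) mem m(1) m'(1) fls_subdegree_leI[OF m(1)] fls_subdegree_leI[OF m'(1)] by simp
  finally have "fls_nth (1 :: 'k fls) (m + m') \<noteq> 0" using assms(1) m(1) m'(1) by simp
  then have "m + m' = 0" by (simp split: if_splits)
  moreover have "fls_subdegree c + fls_subdegree d = 0"
    using fls_subdegree_mult[OF nz] assms(1) by simp
  moreover have "fls_subdegree c \<le> m" "fls_subdegree d \<le> m'"
    using m(2) m'(2) mem by auto
  ultimately have "fls_subdegree c = m" by linarith
  then show ?thesis using m(2) fls_subdegree_leI by (metis order.antisym)
qed

lemma fls_single_term:
  fixes c :: "'k::field fls"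
  assumes "\<forall>k. fls_nth c k \<noteq> 0 \<longrightarrow> k = m"
  shows "c = fls_const (fls_nth c m) * fls_X_intpow m"
  using assms by (auto simp: fls_eq_iff)

context sn_reps
begin

text \<open>The field of series is only an ambient field: the entries are Laurent polynomials, and
  these have no units besides monomials.\<close>

lemma T_finite_support:
  assumes "a \<in> carrier S"
  shows "finite {k. fls_nth (T.A i a (\<delta> \<beta>) \<gamma>) k \<noteq> 0}"
  using assms
proof (induction arbitrary: \<gamma> rule: Sn_induct)
  case (add a b)
  have "{k. fls_nth (T.A i (a \<boxplus> b) (\<delta> \<beta>) \<gamma>) k \<noteq> 0} \<subseteq>
      {k. fls_nth (T.A i a (\<delta> \<beta>) \<gamma>) k \<noteq> 0} \<union> {k. fls_nth (T.A i b (\<delta> \<beta>) \<gamma>) k \<noteq> 0}"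
    using add(1,2) by (auto simp: T.A_add)
  then show ?case using add(3,4) finite_subset by blast
next
  case (scale c a)
  then show ?case by (cases "c = 0") (simp_all add: T.A_mult T.A_scal)
next
  case one
  have "{k. fls_nth (\<delta> \<beta> \<gamma> :: 'k fls) k \<noteq> 0} \<subseteq> {0}" by (auto simp: \<delta>_def split: if_splits)
  then show ?case using finite_subset by fastforce
next
  case (x j a)
  have "{k. fls_nth (fls_X * T.A i a (\<delta> \<beta>) \<gamma>) k \<noteq> 0} = (\<lambda>k. k + 1) ` {k. fls_nth (T.A i a (\<delta> \<beta>) \<gamma>) k \<noteq> 0}"
    by (force simp: fls_X_times_conv_shift image_iff intro: exI[where x = "_ - 1"])
  then have "finite {k. fls_nth (fls_X * T.A i a (\<delta> \<beta>) \<gamma>) k \<noteq> 0}" using x(3) by simp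
  then show ?case using x(1,2) x(3)[of "\<gamma>(j := \<gamma> j - 1)"] by (simp add: T.A_mult T.A_xg xop_def del: fun_upd_apply)
next
  case (y j a)
  have "{k. fls_nth (inverse fls_X * T.A i a (\<delta> \<beta>) \<gamma>) k \<noteq> 0} = (\<lambda>k. k - 1) ` {k. fls_nth (T.A i a (\<delta> \<beta>) \<gamma>) k \<noteq> 0}"
    by (force simp: fls_inverse_X fls_X_inv_times_conv_shift image_iff intro: exI[where x = "_ + 1"])
  then have "finite {k. fls_nth (inverse fls_X * T.A i a (\<delta> \<beta>) \<gamma>) k \<noteq> 0}" using y(3) by simp
  then show ?case using y(1,2) y(3)[of "\<gamma>(j := Suc (\<gamma> j))"] by (simp add: T.A_mult T.A_yg yop_def del: fun_upd_apply)
qed simp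

lemma p_diff_iff:
  assumes "a \<in> carrier S" "b \<in> carrier S"
  shows "a \<boxminus> b \<in> p i \<longleftrightarrow> (\<forall>g. \<forall>\<gamma>\<in>T.Ix i. T.A i a g \<gamma> = T.A i b g \<gamma>)"
  using assms by (simp add: p_def T.A_diff)

section \<open>Elements acting as scalars modulo a prime\<close>

definition scalar_at :: "nat \<Rightarrow> (letter list \<Rightarrow> 'k) set \<Rightarrow> 'k fls \<Rightarrow> bool" where
  "scalar_at i a c \<longleftrightarrow> (\<forall>g. \<forall>\<gamma>\<in>T.Ix i. T.A i a g \<gamma> = c * g \<gamma>)"

lemma scalar_atD: "scalar_at i a c \<Longrightarrow> \<gamma> \<in> T.Ix i \<Longrightarrow> T.A i a g \<gamma> = c * g \<gamma>"
  by (simp add: scalar_at_def)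

lemma scalar_at_unique: "scalar_at i a c \<Longrightarrow> scalar_at i a d \<Longrightarrow> c = d"
  using scalar_atD[of i a c "\<lambda>_. 0" "\<lambda>_. 1"] scalar_atD[of i a d "\<lambda>_. 0" "\<lambda>_. 1"] by simp

lemma scalar_at_mult:
  assumes "a \<in> carrier S" "b \<in> carrier S" "scalar_at i a c" "scalar_at i b d"
  shows "scalar_at i (a \<cdot> b) (c * d)"
  using assms by (simp add: scalar_at_def T.A_mult)

lemma scalar_at_pow:
  assumes "a \<in> carrier S" "scalar_at i a c"
  shows "scalar_at i (a [^]\<^bsub>S\<^esub> (m::nat)) (c ^ m)"
proof (induction m)
  case 0
  show ?case by (simp add: scalar_at_def)
next
  case (Suc m)
  then show ?case using scalar_at_mult[OF _ assms(1) Suc assms(2)] assms(1) by (simp add: mult.commute)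
qed

lemma scalar_at_scal: "scalar_at i (sc c) (fls_const c)"
  by (simp add: scalar_at_def T.A_scal)

lemma scalar_at_x: "i \<in> {1..n} \<Longrightarrow> scalar_at i (x i) fls_X"
  and scalar_at_y: "i \<in> {1..n} \<Longrightarrow> scalar_at i (y i) (inverse fls_X)"
  by (simp_all add: scalar_at_def T.A_xg T.A_yg xop_def yop_def)

lemma scalar_at_diff_in_p:
  assumes "a \<in> carrier S" "b \<in> carrier S" "scalar_at i a c"
  shows "a \<boxminus> b \<in> p i \<longleftrightarrow> scalar_at i b c"
proof -
  have "(\<forall>g. \<forall>\<gamma>\<in>T.Ix i. T.A i a g \<gamma> = T.A i b g \<gamma>) \<longleftrightarrow> scalar_at i b c"
    using assms(3) unfolding scalar_at_def by (metis (no_types, lifting))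
  then show ?thesis using p_diff_iff[OF assms(1,2)] by simp
qed

lemma scalar_commutes_mod_p:
  assumes z: "z \<in> carrier S" "scalar_at i z c" and a: "a \<in> carrier S"
  shows "z \<cdot> a \<boxminus> a \<cdot> z \<in> p i"
proof -
  have "T.A i (z \<cdot> a) g \<gamma> = T.A i (a \<cdot> z) g \<gamma>" if g: "\<gamma> \<in> T.Ix i" for g \<gamma>
  proof -
    have "T.A i a (T.A i z g) \<gamma> = T.A i a (\<lambda>\<eta>. c * g \<eta>) \<gamma>"
      using a g scalar_atD[OF z(2)] by (intro T.A_cong) auto
    then show ?thesis
      using z a g scalar_atD[OF z(2)] T.A_arg_scale[OF a, of i c g \<gamma>] by (simp add: T.A_mult)
  qed
  then show ?thesis using z a by (subst p_diff_iff) auto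
qed

text \<open>An automorphism taking \<open>p i\<close> to \<open>p j\<close> takes elements central
  modulo \<open>p i\<close> to elements central modulo \<open>p j\<close>, and centrality there
  means acting as a scalar.\<close>

lemma scalar_at_Aut:
  assumes s: "\<sigma> \<in> Aut K n" and ij: "\<forall>a\<in>carrier S. \<sigma> a \<in> p j \<longleftrightarrow> a \<in> p i"
    and z: "z \<in> carrier S" "scalar_at i z c"
  shows "\<exists>d. scalar_at j (\<sigma> z) d \<and> finite {k. fls_nth d k \<noteq> 0}"
proof -
  have sz: "\<sigma> z \<in> carrier S" using Aut_closed[OF s z(1)] .
  obtain \<rho> where r: "\<rho> \<in> Aut K n" "\<forall>a\<in>carrier S. \<rho> (\<sigma> a) = a" "\<forall>a\<in>carrier S. \<sigma> (\<rho> a) = a"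
    using s by (rule Aut_inverse)
  have "T.A j (\<sigma> z \<cdot> b) g \<gamma> = T.A j (b \<cdot> \<sigma> z) g \<gamma>" if b: "b \<in> carrier S" and g: "\<gamma> \<in> T.Ix j" for b g \<gamma>
  proof -
    have rb: "\<rho> b \<in> carrier S" "\<sigma> (\<rho> b) = b" using b r(3) Aut_closed[OF r(1)] by auto
    have "\<sigma> (z \<cdot> \<rho> b \<boxminus> \<rho> b \<cdot> z) \<in> p j"
      using ij scalar_commutes_mod_p[OF z rb(1)] z rb(1) by simp
    then have "\<sigma> z \<cdot> b \<boxminus> b \<cdot> \<sigma> z \<in> p j"
      using z rb by (simp add: Aut_diff[OF s] Aut_mult[OF s])
    then show ?thesis using p_diff_iff[of "\<sigma> z \<cdot> b" "b \<cdot> \<sigma> z" j] sz b g by simp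
  qed
  from T.A_central[OF sz this]
  have "scalar_at j (\<sigma> z) (T.A j (\<sigma> z) (\<delta> (\<lambda>_. 0)) (\<lambda>_. 0))"
    unfolding scalar_at_def by blast
  then show ?thesis using T_finite_support[OF sz] by blast
qed

lemma yx_one: "i \<in> {1..n} \<Longrightarrow> y i \<cdot> x i = \<one>\<^bsub>S\<^esub>"
  by (rule F_eqI) (auto simp: F.A_mult F.A_xg F.A_yg yop_xop_same)

text \<open>An index argument: modulo finite matrices the image of \<open>x i\<close> would be a backward shift,
  which cannot be injective for dimension reasons.\<close>
lemma no_left_inverse:
  assumes w: "w \<in> carrier S" "v \<in> carrier S" "v \<cdot> w = \<one>\<^bsub>S\<^esub>" and j: "j \<in> {1..n}" and m: "0 < m"
  shows "w \<boxminus> sc l \<cdot> y j [^]\<^bsub>S\<^esub> (m::nat) \<notin> p j"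
proof
  let ?b = "sc l \<cdot> y j [^]\<^bsub>S\<^esub> m"
  assume "w \<boxminus> ?b \<in> p j"
  then obtain N where N: "\<And>g \<gamma>. N \<le> \<gamma> j \<Longrightarrow> V.A j (w \<boxminus> ?b) g \<gamma> = 0"
    using p_V_rows[OF _ j] by blast
  have cb: "?b \<in> carrier S" using j by simp
  have pow: "V.A j (y j [^]\<^bsub>S\<^esub> k) g \<gamma> = g (\<gamma>(j := \<gamma> j + k))" for k g \<gamma>
    using j by (induction k arbitrary: g) (simp_all add: V.A_mult V.A_yg yop_def)
  have w_large: "V.A j w g \<gamma> = l * g (\<gamma>(j := \<gamma> j + m))" if "N \<le> \<gamma> j" for g \<gamma>
    using that N[of \<gamma> g] w(1) cb j by (simp add: V.A_diff V.A_mult V_A_scal pow)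
  \<comment> \<open>\<open>V j\<close> shifts the coordinate \<open>j\<close> alone, so its index
    set is a copy of the natural numbers.\<close>
  define \<iota> where "\<iota> t = (\<lambda>_::nat. 0::nat)(j := t)" for t
  have \<iota>: "\<iota> t \<in> V.Ix j" "\<iota> t j = t" for t using j by (auto simp: \<iota>_def idx_def)
  have \<iota>_eq: "\<gamma> = \<iota> (\<gamma> j)" if "\<gamma> \<in> V.Ix j" for \<gamma> using that j by (auto simp: \<iota>_def idx_def fun_eq_iff)
  have \<iota>_inj: "\<iota> s = \<iota> t \<longleftrightarrow> s = t" for s t using \<iota>(2) by metis
  \<comment> \<open>The rows below \<open>N\<close> impose \<open>N\<close> conditions on
    \<open>N + m\<close> unknowns. The rows from \<open>N\<close> on read the combination at indices
    at least \<open>N + m\<close>, where it vanishes. A nonzero function is thus annihilated by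
    \<open>w\<close>.\<close>
  obtain c :: "nat \<Rightarrow> 'k" where c: "\<exists>t\<in>{..<N + m}. c t \<noteq> 0"
    "\<forall>r<N. (\<Sum>t\<in>{..<N + m}. c t * V.A j w (\<delta> (\<iota> t)) (\<iota> r)) = 0"
    using homogeneous_system_solution[of "{..<N + m}" N "\<lambda>r t. V.A j w (\<delta> (\<iota> t)) (\<iota> r)"] m by auto
  define g where "g \<gamma> = (\<Sum>t\<in>{..<N + m}. c t * \<delta> (\<iota> t) \<gamma>)" for \<gamma>
  have g_val: "g (\<iota> t) = (if t < N + m then c t else 0)" for t
    by (simp add: g_def \<delta>_def \<iota>_inj if_distrib sum.delta cong: if_cong)
  have "V.A j w g \<gamma> = 0" if \<gamma>: "\<gamma> \<in> V.Ix j" for \<gamma>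
  proof (cases "\<gamma> j < N")
    case True
    have "V.A j w g \<gamma> = (\<Sum>t\<in>{..<N + m}. c t * V.A j w (\<delta> (\<iota> t)) \<gamma>)"
      unfolding g_def[abs_def] by (rule V.A_arg_sum[OF w(1)])
    then show ?thesis using c(2) True \<iota>_eq[OF \<gamma>] by metis
  next
    case False
    have "\<gamma>(j := \<gamma> j + m) = \<iota> (\<gamma> j + m)" using \<iota>_eq[OF \<gamma>] by (metis \<iota>_def fun_upd_upd)
    then show ?thesis using False w_large[of \<gamma> g] by (simp add: g_val)
  qed
  then have "V.A j v (V.A j w g) \<gamma> = V.A j v (\<lambda>_. 0 * 0) \<gamma>" if "\<gamma> \<in> V.Ix j" for \<gamma>
    using that w(2) by (intro V.A_cong) auto
  then have "V.A j (v \<cdot> w) g \<gamma> = 0" if "\<gamma> \<in> V.Ix j" for \<gamma>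
    using that w(1,2) V.A_arg_scale[OF w(2), of j 0 "\<lambda>_. 0" \<gamma>] by (simp add: V.A_mult)
  then have "g (\<iota> t) = 0" for t using \<iota>(1) w(3) by simp
  then show False using c(1) g_val by (metis lessThan_iff)
qed

text \<open>The images of \<open>y i\<close> and \<open>x i\<close> act as mutually inverse scalars
  with finite support, so these are single terms. A negative exponent is impossible: a left
  invertible element would agree modulo \<open>p j\<close> with a multiple of a positive power of
  \<open>y j\<close>.\<close>

lemma Aut_x_power_mod_p:
  assumes s: "\<sigma> \<in> Aut K n" and i: "i \<in> {1..n}" and j: "j \<in> {1..n}"
    and ij: "\<forall>a\<in>carrier S. \<sigma> a \<in> p j \<longleftrightarrow> a \<in> p i"
  shows "\<exists>l m. l \<noteq> 0 \<and> scalar_at j (\<sigma> (x i)) (fls_const l * fls_X ^ m) \<and>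
    scalar_at j (\<sigma> (y i)) (inverse (fls_const l * fls_X ^ m))"
proof -
  obtain c where c: "scalar_at j (\<sigma> (x i)) c" "finite {k. fls_nth c k \<noteq> 0}"
    using scalar_at_Aut[OF s ij xg_closed[OF i] scalar_at_x[OF i]] by blast
  obtain d where d: "scalar_at j (\<sigma> (y i)) d" "finite {k. fls_nth d k \<noteq> 0}"
    using scalar_at_Aut[OF s ij yg_closed[OF i] scalar_at_y[OF i]] by blast
  have cl: "\<sigma> (x i) \<in> carrier S" "\<sigma> (y i) \<in> carrier S" using Aut_closed[OF s] i by auto
  have yx: "\<sigma> (y i) \<cdot> \<sigma> (x i) = \<one>\<^bsub>S\<^esub>"
    using i yx_one[OF i] Aut_one[OF s] by (simp flip: Aut_mult[OF s])
  have "scalar_at j \<one>\<^bsub>S\<^esub> (d * c)" using scalar_at_mult[OF cl(2,1) d(1) c(1)] yx by simp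
  moreover have "scalar_at j \<one>\<^bsub>S\<^esub> 1" by (simp add: scalar_at_def)
  ultimately have dc: "d * c = 1" by (rule scalar_at_unique)
  then have cd: "c * d = 1" by (simp add: mult.commute)
  then have d_eq: "d = inverse c" by (metis inverse_unique)
  obtain m where m: "\<forall>k. fls_nth c k \<noteq> 0 \<longrightarrow> k = m"
    using fls_finite_support_unit[OF cd c(2) d(2)] by blast
  define l where "l = fls_nth c m"
  have c_eq: "c = fls_const l * fls_X_intpow m" unfolding l_def by (rule fls_single_term[OF m])
  have l: "l \<noteq> 0" using c_eq cd by auto
  have "0 \<le> m"
  proof (rule ccontr)
    assume "\<not> 0 \<le> m"
    then have m: "m = - int (nat (- m))" "0 < nat (- m)" by auto
    have "(inverse fls_X :: 'k fls) ^ nat (- m) = fls_X_intpow m"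
      using \<open>\<not> 0 \<le> m\<close> by (simp add: fls_inverse_X fls_X_inv_power_conv_shift_1)
    then have "c = fls_const l * inverse fls_X ^ nat (- m)" using c_eq by simp
    moreover have "scalar_at j (sc l \<cdot> y j [^]\<^bsub>S\<^esub> nat (- m)) (fls_const l * inverse fls_X ^ nat (- m))"
      using j by (intro scalar_at_mult scalar_at_scal scalar_at_pow scalar_at_y) auto
    ultimately have "\<sigma> (x i) \<boxminus> sc l \<cdot> y j [^]\<^bsub>S\<^esub> nat (- m) \<in> p j"
      using scalar_at_diff_in_p[OF cl(1) _ c(1)] j by simp
    then show False using no_left_inverse[OF cl yx j m(2)] by blast
  qed
  then have "(fls_X :: 'k fls) ^ nat m = fls_X_intpow m" by (simp add: fls_X_power_conv_shift_1)
  then have "c = fls_const l * fls_X ^ nat m" using c_eq by simp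
  then show ?thesis using c(1) d(1) d_eq l by blast
qed

text \<open>The inverse automorphism gives a second exponent \<open>m'\<close>. Composing the two
  expressions returns \<open>x j\<close> modulo \<open>p j\<close>, and comparing degrees gives
  \<open>m' * m = 1\<close> in natural numbers.\<close>

lemma Aut_generators_mod_p:
  assumes s: "\<sigma> \<in> Aut K n" and i: "i \<in> {1..n}" and j: "j \<in> {1..n}"
    and ij: "\<forall>a\<in>carrier S. \<sigma> a \<in> p j \<longleftrightarrow> a \<in> p i"
  shows "\<exists>l. l \<noteq> 0 \<and> \<sigma> (x i) \<boxminus> sc l \<cdot> x j \<in> p j \<and> \<sigma> (y i) \<boxminus> sc (inverse l) \<cdot> y j \<in> p j"
proof -
  obtain \<rho> where r: "\<rho> \<in> Aut K n" "\<forall>a\<in>carrier S. \<rho> (\<sigma> a) = a" "\<forall>a\<in>carrier S. \<sigma> (\<rho> a) = a"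
    using s by (rule Aut_inverse)
  have ji: "\<forall>a\<in>carrier S. \<rho> a \<in> p i \<longleftrightarrow> a \<in> p j"
  proof
    fix a assume a: "a \<in> carrier S"
    then show "\<rho> a \<in> p i \<longleftrightarrow> a \<in> p j"
      using bspec[OF ij Aut_closed[OF r(1) a]] bspec[OF r(3) a] by simp
  qed
  obtain l m where l: "l \<noteq> 0" "scalar_at j (\<sigma> (x i)) (fls_const l * fls_X ^ m)"
    "scalar_at j (\<sigma> (y i)) (inverse (fls_const l * fls_X ^ m))"
    using Aut_x_power_mod_p[OF s i j ij] by blast
  obtain l' m' where l': "l' \<noteq> 0" "scalar_at i (\<rho> (x j)) (fls_const l' * fls_X ^ m')"
    using Aut_x_power_mod_p[OF r(1) j i ji] by blast
  have cl: "\<sigma> (x i) \<in> carrier S" "\<sigma> (y i) \<in> carrier S" "\<rho> (x j) \<in> carrier S"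
    using Aut_closed[OF s] Aut_closed[OF r(1)] i j by auto
  have "scalar_at i (sc l' \<cdot> x i [^]\<^bsub>S\<^esub> m') (fls_const l' * fls_X ^ m')"
    using i by (intro scalar_at_mult scalar_at_scal scalar_at_pow scalar_at_x) auto
  then have "\<rho> (x j) \<boxminus> sc l' \<cdot> x i [^]\<^bsub>S\<^esub> m' \<in> p i"
    using scalar_at_diff_in_p[OF cl(3) _ l'(2)] i by simp
  then have in_p: "\<sigma> (\<rho> (x j) \<boxminus> sc l' \<cdot> x i [^]\<^bsub>S\<^esub> m') \<in> p j"
    using ij cl(3) i by simp
  have pow: "\<sigma> (x i [^]\<^bsub>S\<^esub> k) = \<sigma> (x i) [^]\<^bsub>S\<^esub> k" for k :: nat
    using i by (induction k) (simp_all add: Aut_one[OF s] Aut_mult[OF s])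
  have "x j \<boxminus> sc l' \<cdot> \<sigma> (x i) [^]\<^bsub>S\<^esub> m' \<in> p j"
    using in_p cl(3) i j r(3) by (simp add: Aut_diff[OF s] Aut_mult[OF s] Aut_scal[OF s] pow)
  then have "scalar_at j (sc l' \<cdot> \<sigma> (x i) [^]\<^bsub>S\<^esub> m') fls_X"
    using scalar_at_diff_in_p[OF _ _ scalar_at_x[OF j]] cl j by simp
  moreover have "scalar_at j (sc l' \<cdot> \<sigma> (x i) [^]\<^bsub>S\<^esub> m') (fls_const l' * (fls_const l * fls_X ^ m) ^ m')"
    using cl l by (intro scalar_at_mult scalar_at_scal scalar_at_pow) auto
  ultimately have "fls_X = fls_const l' * (fls_const l * fls_X ^ m) ^ m'" by (rule scalar_at_unique)
  then have "fls_subdegree (fls_X :: 'k fls) = fls_subdegree (fls_const l' * (fls_const l * fls_X ^ m) ^ m')" by simp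
  also have "\<dots> = int m' * int m"
    using l(1) l'(1) by (simp add: fls_subdegree_mult fls_subdegree_pow)
  finally have "int (m' * m) = 1" by simp
  then have "m = 1" by (metis nat_mult_eq_1_iff of_nat_eq_1_iff)
  then have m: "scalar_at j (\<sigma> (x i)) (fls_const l * fls_X)" "scalar_at j (\<sigma> (y i)) (fls_const (inverse l) * inverse fls_X)"
    using l by (simp_all add: fls_inverse_const)
  have "scalar_at j (sc l \<cdot> x j) (fls_const l * fls_X)"
    "scalar_at j (sc (inverse l) \<cdot> y j) (fls_const (inverse l) * inverse fls_X)"
    using j by (intro scalar_at_mult scalar_at_scal scalar_at_x scalar_at_y; simp)+
  then show ?thesis
    using scalar_at_diff_in_p[OF cl(1) _ m(1)] scalar_at_diff_in_p[OF cl(2) _ m(2)] j l(1) by auto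
qed

end

section \<open>Intertwining elements\<close>

type_synonym 'a imat = "(nat \<Rightarrow> nat) \<Rightarrow> (nat \<Rightarrow> nat) \<Rightarrow> 'a"

text \<open>In operator terms this is \<open>M - x_i M y_i\<close>. It vanishes exactly where an
  entry equals its predecessor on the diagonal in direction \<open>i\<close>, with entries outside
  the index range read as 0.\<close>

definition Dop :: "nat \<Rightarrow> 'a::field imat \<Rightarrow> 'a imat" where
  "Dop i M \<gamma> \<epsilon> = M \<gamma> \<epsilon> - (if \<gamma> i = 0 \<or> \<epsilon> i = 0 then 0 else M (\<gamma>(i := \<gamma> i - 1)) (\<epsilon>(i := \<epsilon> i - 1)))"

definition Ds :: "nat list \<Rightarrow> 'a::field imat \<Rightarrow> 'a imat" where
  "Ds l M = foldr Dop l M"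

lemma Ds_Nil [simp]: "Ds [] M = M"
  and Ds_Cons [simp]: "Ds (j # l) M = Dop j (Ds l M)"
  by (simp_all add: Ds_def)

lemma Dop_commute: "i \<noteq> j \<Longrightarrow> Dop i (Dop j M) = Dop j (Dop i M)"
  by (auto simp: Dop_def fun_eq_iff fun_upd_twist)

lemma Ds_Dop_commute: "j \<notin> set l \<Longrightarrow> Dop j (Ds l M) = Ds l (Dop j M)"
  by (induction l) (auto simp: Dop_commute)

lemma Ds_sum: "Ds l (\<lambda>\<gamma> \<epsilon>. \<Sum>p\<in>B. c p * M p \<gamma> \<epsilon>) = (\<lambda>\<gamma> \<epsilon>. \<Sum>p\<in>B. c p * Ds l (M p) \<gamma> \<epsilon>)"
proof (induction l)
  case (Cons j l)
  show ?case unfolding Ds_Cons Cons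
    by (auto simp: Dop_def fun_eq_iff algebra_simps sum_subtractf simp del: fun_upd_apply)
qed simp

text \<open>The matrix of \<open>x\<^sup>\<alpha> y\<^sup>\<beta>\<close>, a tensor product over the
  coordinates, in which the factors with index in \<open>l\<close> are replaced by the matrix units
  at \<open>(\<alpha> i, \<beta> i)\<close>. It interpolates between a monomial, for
  \<open>l\<close> empty, and a matrix unit, for \<open>l\<close> containing all variables.\<close>

definition shift_entry :: "nat list \<Rightarrow> (nat \<Rightarrow> nat) \<Rightarrow> (nat \<Rightarrow> nat) \<Rightarrow> 'a::field imat" where
  "shift_entry l \<alpha> \<beta> \<gamma> \<epsilon> = (if \<forall>i. if i \<in> set l then \<gamma> i = \<alpha> i \<and> \<epsilon> i = \<beta> i
      else \<alpha> i \<le> \<gamma> i \<and> \<gamma> i - \<alpha> i + \<beta> i = \<epsilon> i then 1 else 0)"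

text \<open>One coordinate of the identity
  \<open>x^a y^b - x^(a+1) y^(b+1) = x^a (1 - x y) y^b\<close>, whose right side is the matrix unit
  at \<open>(a, b)\<close>. The flag \<open>C\<close> stands for the conditions on the other
  coordinates.\<close>

lemma shift_entry_step:
  fixes a b g d :: nat
  shows "(if C \<and> a \<le> g \<and> g - a + b = d then 1 else 0) - (if g = 0 \<or> d = 0 then 0
      else if C \<and> a \<le> g - 1 \<and> g - 1 - a + b = d - 1 then 1 else 0) =
    (if C \<and> g = a \<and> d = b then 1 else (0::'a::field))"
proof -
  have "a \<le> g \<and> g - a + b = d \<longleftrightarrow> (g = a \<and> d = b) \<or> (a < g \<and> g - a + b = d)" by linarith
  moreover have "\<not> (g = 0 \<or> d = 0) \<and> a \<le> g - 1 \<and> g - 1 - a + b = d - 1 \<longleftrightarrow> a < g \<and> g - a + b = d"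
    by linarith
  ultimately show ?thesis by (smt (verit) diff_zero diff_self less_irrefl)
qed

lemma Dop_shift_entry:
  assumes j: "j \<notin> set l"
  shows "Dop j (shift_entry l \<alpha> \<beta>) = shift_entry (j # l) \<alpha> \<beta>"
proof (intro ext)
  fix \<gamma> \<epsilon> :: "nat \<Rightarrow> nat"
  let ?C = "\<forall>i. i \<noteq> j \<longrightarrow> (if i \<in> set l then \<gamma> i = \<alpha> i \<and> \<epsilon> i = \<beta> i
      else \<alpha> i \<le> \<gamma> i \<and> \<gamma> i - \<alpha> i + \<beta> i = \<epsilon> i)"
  have 1: "shift_entry l \<alpha> \<beta> \<gamma> \<epsilon> = (if ?C \<and> \<alpha> j \<le> \<gamma> j \<and> \<gamma> j - \<alpha> j + \<beta> j = \<epsilon> j then 1 else 0)"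
    unfolding shift_entry_def using j by (intro if_cong refl) metis
  have 2: "shift_entry l \<alpha> \<beta> (\<gamma>(j := \<gamma> j - 1)) (\<epsilon>(j := \<epsilon> j - 1)) =
      (if ?C \<and> \<alpha> j \<le> \<gamma> j - 1 \<and> \<gamma> j - 1 - \<alpha> j + \<beta> j = \<epsilon> j - 1 then 1 else 0)"
    unfolding shift_entry_def using j by (intro if_cong refl) (metis fun_upd_other fun_upd_same)
  have 3: "shift_entry (j # l) \<alpha> \<beta> \<gamma> \<epsilon> = (if ?C \<and> \<gamma> j = \<alpha> j \<and> \<epsilon> j = \<beta> j then 1 else 0)"
    unfolding shift_entry_def by (intro if_cong refl) auto
  show "Dop j (shift_entry l \<alpha> \<beta>) \<gamma> \<epsilon> = shift_entry (j # l) \<alpha> \<beta> \<gamma> \<epsilon>"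
    unfolding Dop_def 1 2 3 by (rule shift_entry_step)
qed

lemma Ds_shift_entry: "distinct l \<Longrightarrow> Ds l (shift_entry [] \<alpha> \<beta>) = shift_entry l \<alpha> \<beta>"
  by (induction l) (auto simp: Dop_shift_entry)

context sn_reps
begin

definition vanishes_beyond :: "nat \<Rightarrow> nat \<Rightarrow> 'k imat \<Rightarrow> bool" where
  "vanishes_beyond N i M \<longleftrightarrow> (\<forall>\<gamma>\<in>Idx. \<forall>\<epsilon>\<in>Idx. N < \<gamma> i \<or> N < \<epsilon> i \<longrightarrow> M \<gamma> \<epsilon> = 0)"

lemma vanishes_beyond_Dop:
  assumes "vanishes_beyond N i M" "i \<noteq> j" "j \<in> {1..n}"
  shows "vanishes_beyond N i (Dop j M)"
  using assms idx_upd[of _ j] by (auto simp: vanishes_beyond_def Dop_def)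

lemma vanishes_beyond_Ds:
  assumes "vanishes_beyond N i M" "i \<notin> set l" "set l \<subseteq> {1..n}"
  shows "vanishes_beyond N i (Ds l M)"
  using assms(2,3) by (induction l) (use assms(1) in \<open>auto intro!: vanishes_beyond_Dop\<close>)

text \<open>The differences commute, so \<open>Dop i\<close> may be applied before the others; these
  work in other directions and keep the bound in direction \<open>i\<close>.\<close>

lemma Ds_vanishes_beyond:
  assumes "\<And>i. i \<in> {1..n} \<Longrightarrow> vanishes_beyond N i (Dop i M)" "distinct l" "set l \<subseteq> {1..n}" "i \<in> set l"
  shows "vanishes_beyond N i (Ds l M)"
  using assms(2-4)
proof (induction l)
  case (Cons j l)
  show ?case
  proof (cases "i = j")
    case True
    then have "vanishes_beyond N i (Ds l (Dop j M))"
      using Cons.prems assms(1) by (intro vanishes_beyond_Ds) auto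
    then show ?thesis using Ds_Dop_commute[of j l M] Cons.prems by simp
  next
    case False
    then show ?thesis using Cons by (auto intro!: vanishes_beyond_Dop)
  qed
qed simp

text \<open>An entry is recovered from the differences by descending its diagonal in direction
  \<open>j\<close> until a coordinate reaches 0.\<close>

lemma Dop_inject:
  assumes j: "j \<in> {1..n}" and eq: "\<And>\<gamma> \<epsilon>. \<gamma> \<in> Idx \<Longrightarrow> \<epsilon> \<in> Idx \<Longrightarrow> Dop j M \<gamma> \<epsilon> = Dop j M' \<gamma> \<epsilon>"
    and "\<gamma> \<in> Idx" "\<epsilon> \<in> Idx"
  shows "M \<gamma> \<epsilon> = M' \<gamma> \<epsilon>"
  using assms(3,4)
proof (induction "\<gamma> j" arbitrary: \<gamma> \<epsilon>)
  case 0
  then show ?case using eq[of \<gamma> \<epsilon>] by (simp add: Dop_def)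
next
  case (Suc k)
  have "M (\<gamma>(j := \<gamma> j - 1)) (\<epsilon>(j := \<epsilon> j - 1)) = M' (\<gamma>(j := \<gamma> j - 1)) (\<epsilon>(j := \<epsilon> j - 1))"
    using Suc.hyps(2) Suc.prems idx_upd[OF _ j] by (intro Suc.hyps(1)) auto
  then show ?case using eq[OF Suc.prems] by (simp add: Dop_def del: fun_upd_apply split: if_splits)
qed

lemma Ds_inject:
  assumes "set l \<subseteq> {1..n}" "\<And>\<gamma> \<epsilon>. \<gamma> \<in> Idx \<Longrightarrow> \<epsilon> \<in> Idx \<Longrightarrow> Ds l M \<gamma> \<epsilon> = Ds l M' \<gamma> \<epsilon>"
    and "\<gamma> \<in> Idx" "\<epsilon> \<in> Idx"
  shows "M \<gamma> \<epsilon> = M' \<gamma> \<epsilon>"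
  using assms
proof (induction l arbitrary: \<gamma> \<epsilon>)
  case (Cons j l)
  have "Ds l M \<gamma> \<epsilon> = Ds l M' \<gamma> \<epsilon>" if "\<gamma> \<in> Idx" "\<epsilon> \<in> Idx" for \<gamma> \<epsilon>
    using Cons.prems(1,2) that by (intro Dop_inject[of j "Ds l M" "Ds l M'"]) auto
  then show ?case using Cons by auto
qed simp

lemma A_mo_nw:
  assumes "\<alpha> \<in> Idx" "\<beta> \<in> Idx" "\<gamma> \<in> Idx"
  shows "F.A (mo (nw \<alpha> \<beta>)) (\<delta> \<epsilon>) \<gamma> = shift_entry [] \<alpha> \<beta> \<gamma> \<epsilon>"
proof -
  have "F.A (mo (nw \<alpha> \<beta>)) (\<delta> \<epsilon>) \<gamma> = wop (\<lambda>_. 0) (nw \<alpha> \<beta>) (\<delta> \<epsilon>) \<gamma>"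
    unfolding mo_def using F.A_cls[OF monom_carrier[OF set_nw]] F.act_monom by metis
  also have "\<dots> = (if \<forall>i. \<alpha> i \<le> \<gamma> i then \<delta> \<epsilon> (\<lambda>i. \<gamma> i - \<alpha> i + \<beta> i) else 0)"
    by (rule F.wop_nw) (use assms in auto)
  also have "\<dots> = shift_entry [] \<alpha> \<beta> \<gamma> \<epsilon>"
    unfolding shift_entry_def \<delta>_def fun_eq_iff by auto
  finally show ?thesis .
qed

lemma ex_combination:
  assumes "finite B" "B \<subseteq> Idx \<times> Idx"
  shows "\<exists>s\<in>carrier S. \<forall>\<gamma>\<in>Idx. \<forall>\<epsilon>. F.A s (\<delta> \<epsilon>) \<gamma> = (\<Sum>q\<in>B. c q * shift_entry [] (fst q) (snd q) \<gamma> \<epsilon>)"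
  using assms
proof (induction B rule: finite_induct)
  case empty
  show ?case by (intro bexI[of _ "\<zero>\<^bsub>S\<^esub>"]) auto
next
  case (insert q B)
  then obtain s where s: "s \<in> carrier S"
    "\<forall>\<gamma>\<in>Idx. \<forall>\<epsilon>. F.A s (\<delta> \<epsilon>) \<gamma> = (\<Sum>q\<in>B. c q * shift_entry [] (fst q) (snd q) \<gamma> \<epsilon>)" by auto
  let ?t = "sc (c q) \<cdot> mo (nw (fst q) (snd q)) \<boxplus> s"
  have q: "fst q \<in> Idx" "snd q \<in> Idx" using insert.prems by auto
  have cl: "mo (nw (fst q) (snd q)) \<in> carrier S" by (rule mo_closed[OF set_nw])
  have "F.A ?t (\<delta> \<epsilon>) \<gamma> = (\<Sum>q\<in>insert q B. c q * shift_entry [] (fst q) (snd q) \<gamma> \<epsilon>)" if "\<gamma> \<in> Idx" for \<gamma> \<epsilon>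
    using s cl that insert.hyps A_mo_nw[OF q that] by (simp add: F.A_add F.A_mult F_A_scal)
  then show ?case using s(1) cl by (intro bexI[of _ ?t]) auto
qed

text \<open>The entries of the finite matrix \<open>Ds ix M\<close> are the coefficients of \<open>M\<close> with respect to
  the monomials \<open>x\<^sup>\<alpha> y\<^sup>\<beta>\<close>.\<close>
lemma matrix_realizable:
  assumes "\<And>i. i \<in> {1..n} \<Longrightarrow> vanishes_beyond N i (Dop i M)"
  shows "\<exists>s\<in>carrier S. \<forall>\<gamma>\<in>Idx. \<forall>\<epsilon>\<in>Idx. F.A s (\<delta> \<epsilon>) \<gamma> = M \<gamma> \<epsilon>"
proof -
  \<comment> \<open>Entries with index exactly \<open>N\<close> may be nonzero, hence the strict
    bound \<open>Suc N\<close>.\<close>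
  define Bx where "Bx = {\<alpha> \<in> Idx. \<forall>j\<in>{1..n}. \<alpha> j < Suc N}"
  have Bx: "finite (Bx \<times> Bx)" "Bx \<times> Bx \<subseteq> Idx \<times> Idx"
    unfolding Bx_def using finite_idx_box[of "{1..n}" "Suc N"] by auto
  define c where "c q = Ds ix M (fst q) (snd q)" for q
  obtain s where s: "s \<in> carrier S"
    "\<forall>\<gamma>\<in>Idx. \<forall>\<epsilon>. F.A s (\<delta> \<epsilon>) \<gamma> = (\<Sum>q\<in>Bx \<times> Bx. c q * shift_entry [] (fst q) (snd q) \<gamma> \<epsilon>)"
    using ex_combination[OF Bx] by blast
  define M' where "M' \<gamma> \<epsilon> = (\<Sum>q\<in>Bx \<times> Bx. c q * shift_entry [] (fst q) (snd q) \<gamma> \<epsilon>)" for \<gamma> \<epsilon>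
  \<comment> \<open>Comparing after all differences is enough, because \<open>Ds ix\<close> is
    injective on entries; there each monomial has become a matrix unit and the sum
    collapses.\<close>
  have "Ds ix M' \<gamma> \<epsilon> = Ds ix M \<gamma> \<epsilon>" if ge: "\<gamma> \<in> Idx" "\<epsilon> \<in> Idx" for \<gamma> \<epsilon>
  proof -
    have "Ds ix M' \<gamma> \<epsilon> = (\<Sum>q\<in>Bx \<times> Bx. c q * shift_entry ix (fst q) (snd q) \<gamma> \<epsilon>)"
      unfolding M'_def[abs_def] Ds_sum Ds_shift_entry[OF distinct_ix] ..
    also have "\<dots> = (\<Sum>q\<in>Bx \<times> Bx. if q = (\<gamma>, \<epsilon>) then c q else 0)"
    proof (intro sum.cong refl)
      fix q assume "q \<in> Bx \<times> Bx"
      then have q: "fst q \<in> Idx" "snd q \<in> Idx" using Bx by auto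
      have "(if i \<in> {1..n} then \<gamma> i = fst q i \<and> \<epsilon> i = snd q i
          else fst q i \<le> \<gamma> i \<and> \<gamma> i - fst q i + snd q i = \<epsilon> i) \<longleftrightarrow> \<gamma> i = fst q i \<and> \<epsilon> i = snd q i" for i
        using q ge by (cases "i \<in> {1..n}") (auto simp: idx_def)
      then have "shift_entry ix (fst q) (snd q) \<gamma> \<epsilon> = (if q = (\<gamma>, \<epsilon>) then 1 else (0::'k))"
        unfolding shift_entry_def set_ix by (auto simp: fun_eq_iff prod_eq_iff)
      then show "c q * shift_entry ix (fst q) (snd q) \<gamma> \<epsilon> = (if q = (\<gamma>, \<epsilon>) then c q else 0)" by simp
    qed
    also have "\<dots> = (if (\<gamma>, \<epsilon>) \<in> Bx \<times> Bx then Ds ix M \<gamma> \<epsilon> else 0)"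
      using Bx(1) by (simp add: c_def)
    also have "\<dots> = Ds ix M \<gamma> \<epsilon>"
    proof (cases "(\<gamma>, \<epsilon>) \<in> Bx \<times> Bx")
      case False
      then obtain i where i: "i \<in> {1..n}" "N < \<gamma> i \<or> N < \<epsilon> i"
        using ge by (auto simp: Bx_def not_less)
      have "vanishes_beyond N i (Ds ix M)"
        using Ds_vanishes_beyond[OF assms distinct_ix] set_ix i(1) by auto
      then show ?thesis using i(2) ge False unfolding vanishes_beyond_def by auto
    qed simp
    finally show ?thesis .
  qed
  then have "M' \<gamma> \<epsilon> = M \<gamma> \<epsilon>" if "\<gamma> \<in> Idx" "\<epsilon> \<in> Idx" for \<gamma> \<epsilon>
    using Ds_inject[of ix M' M] set_ix that by auto
  then show ?thesis using s by (intro bexI[of _ s]) (auto simp: M'_def)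
qed

text \<open>The generators move the units \<open>EU \<beta> (\<lambda>_. 0)\<close> as they move the
  basis vectors \<open>\<delta> \<beta>\<close>. This column is a copy of the module inside the
  algebra, where an automorphism can be applied to it.\<close>

lemma x_EU: "i \<in> {1..n} \<Longrightarrow> \<beta> \<in> Idx \<Longrightarrow> x i \<cdot> EU \<beta> (\<lambda>_. 0) = EU (\<beta>(i := Suc (\<beta> i))) (\<lambda>_. 0)"
  and y_EU_zero: "i \<in> {1..n} \<Longrightarrow> \<beta> \<in> Idx \<Longrightarrow> \<beta> i = 0 \<Longrightarrow> y i \<cdot> EU \<beta> (\<lambda>_. 0) = \<zero>\<^bsub>S\<^esub>"
  and y_EU: "i \<in> {1..n} \<Longrightarrow> \<beta> \<in> Idx \<Longrightarrow> \<beta> i \<noteq> 0 \<Longrightarrow> y i \<cdot> EU \<beta> (\<lambda>_. 0) = EU (\<beta>(i := \<beta> i - 1)) (\<lambda>_. 0)"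
proof -
  assume i: "i \<in> {1..n}" and b: "\<beta> \<in> Idx"
  have cl: "EU \<beta> (\<lambda>_. 0) \<in> carrier S" using b by simp
  have u: "\<gamma>(i := k) \<in> Idx" if "\<gamma> \<in> Idx" for \<gamma> k using idx_upd[OF that i] .
  show "x i \<cdot> EU \<beta> (\<lambda>_. 0) = EU (\<beta>(i := Suc (\<beta> i))) (\<lambda>_. 0)"
  proof (rule F_eqI)
    fix \<epsilon> \<gamma> assume g: "\<gamma> \<in> Idx"
    have "\<gamma>(i := \<gamma> i - 1) = \<beta> \<longleftrightarrow> \<gamma> = \<beta>(i := Suc (\<beta> i))" if "\<gamma> i \<noteq> 0"
      using that by (auto simp: fun_eq_iff)
    moreover have "\<gamma> \<noteq> \<beta>(i := Suc (\<beta> i))" if "\<gamma> i = 0" using that by auto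
    ultimately show "F.A (x i \<cdot> EU \<beta> (\<lambda>_. 0)) (\<delta> \<epsilon>) \<gamma> = F.A (EU (\<beta>(i := Suc (\<beta> i))) (\<lambda>_. 0)) (\<delta> \<epsilon>) \<gamma>"
      using i b cl g u[OF b] u[OF g]
      by (cases "\<gamma> i = 0") (simp_all add: F.A_mult F.A_xg xop_def A_EU del: fun_upd_apply)
  qed (use i b cl u in auto)
  show "y i \<cdot> EU \<beta> (\<lambda>_. 0) = \<zero>\<^bsub>S\<^esub>" if "\<beta> i = 0"
  proof (rule F_eqI)
    fix \<epsilon> \<gamma> assume g: "\<gamma> \<in> Idx"
    have "\<gamma>(i := Suc (\<gamma> i)) \<noteq> \<beta>" using that by auto
    then show "F.A (y i \<cdot> EU \<beta> (\<lambda>_. 0)) (\<delta> \<epsilon>) \<gamma> = F.A \<zero>\<^bsub>S\<^esub> (\<delta> \<epsilon>) \<gamma>"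
      using i b cl u[OF g] by (simp add: F.A_mult F.A_yg yop_def A_EU del: fun_upd_apply)
  qed (use i b cl u in auto)
  show "y i \<cdot> EU \<beta> (\<lambda>_. 0) = EU (\<beta>(i := \<beta> i - 1)) (\<lambda>_. 0)" if "\<beta> i \<noteq> 0"
  proof (rule F_eqI)
    fix \<epsilon> \<gamma> assume g: "\<gamma> \<in> Idx"
    have "\<gamma>(i := Suc (\<gamma> i)) = \<beta> \<longleftrightarrow> \<gamma> = \<beta>(i := \<beta> i - 1)" using that by (auto simp: fun_eq_iff)
    then show "F.A (y i \<cdot> EU \<beta> (\<lambda>_. 0)) (\<delta> \<epsilon>) \<gamma> = F.A (EU (\<beta>(i := \<beta> i - 1)) (\<lambda>_. 0)) (\<delta> \<epsilon>) \<gamma>"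
      using i b cl g u[OF g] u[OF b] by (simp add: F.A_mult F.A_yg yop_def A_EU del: fun_upd_apply)
  qed (use i b cl u in auto)
qed

lemma scal_commute: "a \<in> carrier S \<Longrightarrow> sc c \<cdot> a = a \<cdot> sc c"
proof (rule F_eqI)
  fix \<beta> \<gamma> assume a: "a \<in> carrier S"
  have "F.A (sc c) (\<delta> \<beta>) = (\<lambda>\<eta>. c * \<delta> \<beta> \<eta>)" by (simp add: fun_eq_iff F_A_scal)
  then show "F.A (sc c \<cdot> a) (\<delta> \<beta>) \<gamma> = F.A (a \<cdot> sc c) (\<delta> \<beta>) \<gamma>"
    using a F.A_arg_scale[OF a, of c "\<delta> \<beta>" \<gamma>] by (simp add: F.A_mult F_A_scal)
qed auto

definition near_identity :: "((letter list \<Rightarrow> 'k) set \<Rightarrow> (letter list \<Rightarrow> 'k) set) \<Rightarrow> bool" where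
  "near_identity \<sigma> \<longleftrightarrow> \<sigma> \<in> Aut K n \<and> (\<forall>i\<in>{1..n}. (\<forall>a\<in>carrier S. \<sigma> a \<in> p i \<longleftrightarrow> a \<in> p i) \<and>
     \<sigma> (x i) \<boxminus> x i \<in> p i \<and> \<sigma> (y i) \<boxminus> y i \<in> p i)"

text \<open>For large \<open>\<alpha> i\<close> the factor \<open>z\<close> has no nonzero row. For
  large \<open>\<beta> i\<close>, write \<open>z\<close> as the image of \<open>\<rho> z\<close>,
  which lies in \<open>p i\<close> too; multiplying this by the unit in row \<beta> extracts its
  column \<beta>, and that column is zero.\<close>

lemma p_times_image:
  assumes s: "\<sigma> \<in> Aut K n" and i: "i \<in> {1..n}" and pi: "\<forall>a\<in>carrier S. \<sigma> a \<in> p i \<longleftrightarrow> a \<in> p i"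
    and z: "z \<in> p i"
  shows "\<exists>N. \<forall>g. \<forall>\<alpha>\<in>Idx. \<forall>\<beta>\<in>Idx. N \<le> \<alpha> i \<or> N \<le> \<beta> i \<longrightarrow> F.A (z \<cdot> \<sigma> (EU \<beta> (\<lambda>_. 0))) g \<alpha> = 0"
proof -
  have cz: "z \<in> carrier S" using z by (simp add: p_def)
  obtain \<rho> where r: "\<rho> \<in> Aut K n" "\<forall>a\<in>carrier S. \<rho> (\<sigma> a) = a" "\<forall>a\<in>carrier S. \<sigma> (\<rho> a) = a"
    using s by (rule Aut_inverse)
  have rz: "\<rho> z \<in> carrier S" "\<sigma> (\<rho> z) = z" using cz r(3) Aut_closed[OF r(1)] by auto
  then have "\<rho> z \<in> p i" using pi z by force
  then obtain M where M: "\<And>\<beta> \<gamma>. \<gamma> \<in> Idx \<Longrightarrow> M \<le> \<beta> i \<Longrightarrow> F.A (\<rho> z) (\<delta> \<beta>) \<gamma> = 0"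
    using p_box[OF _ i] by blast
  obtain N where N: "\<And>g \<gamma>. \<gamma> \<in> Idx \<Longrightarrow> N \<le> \<gamma> i \<Longrightarrow> F.A z g \<gamma> = 0" using p_rows[OF z i] by blast
  have "F.A (z \<cdot> \<sigma> (EU \<beta> (\<lambda>_. 0))) g \<alpha> = 0"
    if ab: "\<alpha> \<in> Idx" "\<beta> \<in> Idx" and le: "N + M \<le> \<alpha> i \<or> N + M \<le> \<beta> i" for g \<alpha> \<beta>
  proof (cases "N \<le> \<alpha> i")
    case True
    then show ?thesis using N[OF ab(1)] cz ab Aut_closed[OF s] by (simp add: F.A_mult)
  next
    case False
    then have "M \<le> \<beta> i" using le by auto
    then have "\<rho> z \<cdot> EU \<beta> (\<lambda>_. 0) = \<zero>\<^bsub>S\<^esub>"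
      using rz ab M by (intro F_eqI) (auto simp: A_mult_EU)
    then have "\<sigma> (\<rho> z) \<cdot> \<sigma> (EU \<beta> (\<lambda>_. 0)) = \<zero>\<^bsub>S\<^esub>"
      using Aut_mult[OF s rz(1) EU_closed[OF ab(2) zero_in_idx]] Aut_zero[OF s] by simp
    then show ?thesis using rz by simp
  qed
  then show ?thesis by blast
qed

text \<open>Merges bounds found separately for each variable into one; the sum works because the
  property survives enlarging the bound.\<close>

lemma uniform_bound:
  assumes "\<forall>i\<in>{1..n}. \<exists>N::nat. \<forall>M\<ge>N. P i M"
  shows "\<exists>N. \<forall>i\<in>{1..n}. P i N"
proof -
  obtain N where N: "\<forall>i\<in>{1..n}. \<forall>M\<ge>N i. P i M" using assms by metis
  have "P i (\<Sum>i\<in>{1..n}. N i)" if "i \<in> {1..n}" for i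
    using N that member_le_sum[of i "{1..n}" N] by simp
  then show ?thesis by blast
qed

lemma ex_intertwiner:
  assumes "near_identity \<sigma>"
  shows "\<exists>s\<in>carrier S. s \<noteq> \<zero>\<^bsub>S\<^esub> \<and> (\<forall>a\<in>carrier S. \<sigma> a \<cdot> s = s \<cdot> a)"
proof -
  have s: "\<sigma> \<in> Aut K n" and pi: "\<And>i. i \<in> {1..n} \<Longrightarrow> \<forall>a\<in>carrier S. \<sigma> a \<in> p i \<longleftrightarrow> a \<in> p i"
    and fx: "\<And>i. i \<in> {1..n} \<Longrightarrow> \<sigma> (x i) \<boxminus> x i \<in> p i" and fy: "\<And>i. i \<in> {1..n} \<Longrightarrow> \<sigma> (y i) \<boxminus> y i \<in> p i"
    using assms by (auto simp: near_identity_def)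
  let ?v = "\<lambda>\<beta>. \<sigma> (EU \<beta> (\<lambda>_. 0))"
  have v_cl: "?v \<beta> \<in> carrier S" if "\<beta> \<in> Idx" for \<beta> using that Aut_closed[OF s] by simp
  have "?v (\<lambda>_. 0) \<noteq> \<zero>\<^bsub>S\<^esub>"
  proof
    assume "?v (\<lambda>_. 0) = \<zero>\<^bsub>S\<^esub>"
    then have "EU (\<lambda>_. 0) (\<lambda>_. 0) = \<zero>\<^bsub>S\<^esub>"
      using Aut_bij[OF s] Aut_zero[OF s] by (metis EU_closed S.zero_closed bij_betw_def inj_onD zero_in_idx)
    then show False using A_EU[of "\<lambda>_. 0" "\<lambda>_. 0" "\<lambda>_. 0" "\<lambda>_. 1"] by simp
  qed
  \<comment> \<open>The vector to which the images are applied is \<open>\<delta> \<eta>\<close>, a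
    basis vector not annihilated by the image of the unit at (0, 0). This keeps \<phi> from
    vanishing.\<close>
  then obtain \<eta> \<alpha>0 where \<eta>: "\<eta> \<in> Idx" "\<alpha>0 \<in> Idx" "F.A (?v (\<lambda>_. 0)) (\<delta> \<eta>) \<alpha>0 \<noteq> 0"
    using F_nonzero_entry[OF v_cl[OF zero_in_idx]] by metis
  define \<phi> where "\<phi> \<alpha> \<beta> = F.A (?v \<beta>) (\<delta> \<eta>) \<alpha>" for \<alpha> \<beta>
  have sx: "\<sigma> (x i) \<cdot> ?v \<beta> = ?v (\<beta>(i := Suc (\<beta> i)))" if "i \<in> {1..n}" "\<beta> \<in> Idx" for i \<beta>
    using that x_EU[OF that] by (simp flip: Aut_mult[OF s])
  have sy0: "\<sigma> (y i) \<cdot> ?v \<beta> = \<zero>\<^bsub>S\<^esub>" if "i \<in> {1..n}" "\<beta> \<in> Idx" "\<beta> i = 0" for i \<beta>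
    using that y_EU_zero[OF that] Aut_zero[OF s] by (simp flip: Aut_mult[OF s])
  have sy: "\<sigma> (y i) \<cdot> ?v \<beta> = ?v (\<beta>(i := \<beta> i - 1))" if "i \<in> {1..n}" "\<beta> \<in> Idx" "\<beta> i \<noteq> 0" for i \<beta>
    using that y_EU[OF that] by (simp flip: Aut_mult[OF s])
  have "\<exists>N. \<forall>i\<in>{1..n}. \<forall>g. \<forall>\<alpha>\<in>Idx. \<forall>\<beta>\<in>Idx. N \<le> \<alpha> i \<or> N \<le> \<beta> i \<longrightarrow>
      F.A ((\<sigma> (x i) \<boxminus> x i) \<cdot> ?v \<beta>) g \<alpha> = 0 \<and> F.A ((\<sigma> (y i) \<boxminus> y i) \<cdot> ?v \<beta>) g \<alpha> = 0"
  proof (rule uniform_bound, rule ballI)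
    fix i assume i: "i \<in> {1..n}"
    obtain N1 where N1: "\<forall>g. \<forall>\<alpha>\<in>Idx. \<forall>\<beta>\<in>Idx. N1 \<le> \<alpha> i \<or> N1 \<le> \<beta> i \<longrightarrow>
        F.A ((\<sigma> (x i) \<boxminus> x i) \<cdot> ?v \<beta>) g \<alpha> = 0"
      using p_times_image[OF s i pi[OF i] fx[OF i]] by blast
    obtain N2 where N2: "\<forall>g. \<forall>\<alpha>\<in>Idx. \<forall>\<beta>\<in>Idx. N2 \<le> \<alpha> i \<or> N2 \<le> \<beta> i \<longrightarrow>
        F.A ((\<sigma> (y i) \<boxminus> y i) \<cdot> ?v \<beta>) g \<alpha> = 0"
      using p_times_image[OF s i pi[OF i] fy[OF i]] by blast
    show "\<exists>N. \<forall>M\<ge>N. \<forall>g. \<forall>\<alpha>\<in>Idx. \<forall>\<beta>\<in>Idx. M \<le> \<alpha> i \<or> M \<le> \<beta> i \<longrightarrow>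
      F.A ((\<sigma> (x i) \<boxminus> x i) \<cdot> ?v \<beta>) g \<alpha> = 0 \<and> F.A ((\<sigma> (y i) \<boxminus> y i) \<cdot> ?v \<beta>) g \<alpha> = 0"
    proof (intro exI[of _ "N1 + N2"] allI impI ballI)
      fix M g \<alpha> \<beta> assume "N1 + N2 \<le> M" "\<alpha> \<in> Idx" "\<beta> \<in> Idx" "M \<le> \<alpha> i \<or> M \<le> \<beta> i"
      then show "F.A ((\<sigma> (x i) \<boxminus> x i) \<cdot> ?v \<beta>) g \<alpha> = 0 \<and> F.A ((\<sigma> (y i) \<boxminus> y i) \<cdot> ?v \<beta>) g \<alpha> = 0"
        using N1[rule_format, of \<alpha> \<beta> g] N2[rule_format, of \<alpha> \<beta> g] by auto
    qed
  qed
  then obtain N where N: "\<And>i g \<alpha> \<beta>. i \<in> {1..n} \<Longrightarrow> \<alpha> \<in> Idx \<Longrightarrow> \<beta> \<in> Idx \<Longrightarrow> N \<le> \<alpha> i \<or> N \<le> \<beta> i \<Longrightarrow>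
      F.A ((\<sigma> (x i) \<boxminus> x i) \<cdot> ?v \<beta>) g \<alpha> = 0 \<and> F.A ((\<sigma> (y i) \<boxminus> y i) \<cdot> ?v \<beta>) g \<alpha> = 0"
    by blast
  have \<phi>x: "\<phi> \<alpha> (\<beta>(i := Suc (\<beta> i))) = (if \<alpha> i = 0 then 0 else \<phi> (\<alpha>(i := \<alpha> i - 1)) \<beta>)"
    if i: "i \<in> {1..n}" and ab: "\<alpha> \<in> Idx" "\<beta> \<in> Idx" and le: "N \<le> \<alpha> i \<or> N \<le> \<beta> i" for i \<alpha> \<beta>
  proof -
    have "F.A (\<sigma> (x i) \<cdot> ?v \<beta>) (\<delta> \<eta>) \<alpha> = F.A (x i \<cdot> ?v \<beta>) (\<delta> \<eta>) \<alpha>"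
      using N[OF i ab le, of "\<delta> \<eta>"] i v_cl[OF ab(2)] Aut_closed[OF s] by (simp add: F.A_mult F.A_diff)
    then show ?thesis
      unfolding \<phi>_def sx[OF i ab(2)] using i v_cl[OF ab(2)] by (simp add: F.A_mult F.A_xg xop_def del: fun_upd_apply)
  qed
  have \<phi>y: "\<phi> (\<alpha>(i := Suc (\<alpha> i))) \<beta> = 0"
    if i: "i \<in> {1..n}" and ab: "\<alpha> \<in> Idx" "\<beta> \<in> Idx" and le: "N \<le> \<alpha> i" and z: "\<beta> i = 0" for i \<alpha> \<beta>
  proof -
    have "F.A (\<sigma> (y i) \<cdot> ?v \<beta>) (\<delta> \<eta>) \<alpha> = F.A (y i \<cdot> ?v \<beta>) (\<delta> \<eta>) \<alpha>"
      using N[OF i ab disjI1[OF le], of "\<delta> \<eta>"] i v_cl[OF ab(2)] Aut_closed[OF s] by (simp add: F.A_mult F.A_diff)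
    then show ?thesis
      unfolding \<phi>_def sy0[OF i ab(2) z] using i v_cl[OF ab(2)] by (simp add: F.A_mult F.A_yg yop_def del: fun_upd_apply)
  qed
  \<comment> \<open>For \<open>\<beta> i > 0\<close> the relation for \<open>x i\<close> equates the
    entry with its predecessor on the diagonal. For \<open>\<beta> i = 0\<close> the difference is
    the entry itself, and the relation for \<open>y i\<close> shows that it is zero.\<close>
  have "vanishes_beyond N i (Dop i \<phi>)" if i: "i \<in> {1..n}" for i
    unfolding vanishes_beyond_def
  proof (intro ballI impI)
    fix \<alpha> \<beta> assume ab: "\<alpha> \<in> Idx" "\<beta> \<in> Idx" and lt: "N < \<alpha> i \<or> N < \<beta> i"
    show "Dop i \<phi> \<alpha> \<beta> = 0"
    proof (cases "\<beta> i = 0")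
      case True
      then have "\<phi> \<alpha> \<beta> = 0" using \<phi>y[OF i idx_upd[OF ab(1) i] ab(2), of "\<alpha> i - 1"] lt by simp
      then show ?thesis using True by (simp add: Dop_def)
    next
      case False
      have "N \<le> \<alpha> i \<or> N \<le> (\<beta>(i := \<beta> i - 1)) i" using lt by auto
      note * = \<phi>x[OF i ab(1) idx_upd[OF ab(2) i] this]
      have "(\<beta>(i := \<beta> i - 1))(i := Suc ((\<beta>(i := \<beta> i - 1)) i)) = \<beta>" using False by auto
      from *[unfolded this] show ?thesis
        using False by (auto simp: Dop_def simp del: fun_upd_apply)
    qed
  qed
  then obtain t where t: "t \<in> carrier S" "\<And>\<gamma> \<epsilon>. \<gamma> \<in> Idx \<Longrightarrow> \<epsilon> \<in> Idx \<Longrightarrow> F.A t (\<delta> \<epsilon>) \<gamma> = \<phi> \<gamma> \<epsilon>"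
    using matrix_realizable[of N \<phi>] by blast
  have "t \<noteq> \<zero>\<^bsub>S\<^esub>" using t(2)[of \<alpha>0 "\<lambda>_. 0"] \<eta> by (auto simp: \<phi>_def)
  moreover have "\<sigma> a \<cdot> t = t \<cdot> a" if "a \<in> carrier S" for a
    using that
  proof (induction rule: Sn_induct)
    case (scale c a)
    have "\<sigma> (sc c \<cdot> a) \<cdot> t = sc c \<cdot> (t \<cdot> a)"
      using scale t(1) Aut_closed[OF s] by (simp add: Aut_mult[OF s] Aut_scal[OF s] S.m_assoc)
    then show ?case using scale(1) t(1) scal_commute[OF t(1), of c] by (simp flip: S.m_assoc)
  next
    \<comment> \<open>Column \<beta> of \<open>t\<close> is \<open>?v \<beta>\<close> applied to
      \<open>\<delta> \<eta>\<close>, so multiplying \<open>t\<close> by \<open>\<sigma> b\<close>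
      amounts to multiplying images under \<sigma> in the algebra.\<close>
    have left: "F.A (\<sigma> b \<cdot> t) (\<delta> \<beta>) \<gamma> = F.A (\<sigma> b \<cdot> ?v \<beta>) (\<delta> \<eta>) \<gamma>"
      if "b \<in> carrier S" "\<beta> \<in> Idx" "\<gamma> \<in> Idx" for b \<beta> \<gamma>
    proof -
      have "F.A (\<sigma> b) (F.A t (\<delta> \<beta>)) \<gamma> = F.A (\<sigma> b) (F.A (?v \<beta>) (\<delta> \<eta>)) \<gamma>"
        using that t(2) Aut_closed[OF s] by (intro F_A_cong) (auto simp: \<phi>_def)
      then show ?thesis using that t(1) v_cl Aut_closed[OF s] by (simp add: F.A_mult)
    qed
    {
      case (x i a)
      have "\<sigma> (x i) \<cdot> t = t \<cdot> x i"
      proof (rule F_eqI)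
        fix \<beta> \<gamma> assume bg: "\<beta> \<in> Idx" "\<gamma> \<in> Idx"
        have "xop (\<lambda>_. 0) i (\<delta> \<beta>) = (\<delta> (\<beta>(i := Suc (\<beta> i))) :: (nat \<Rightarrow> nat) \<Rightarrow> 'k)"
        proof
          fix \<gamma>
          have "\<gamma>(i := \<gamma> i - 1) = \<beta> \<longleftrightarrow> \<gamma> = \<beta>(i := Suc (\<beta> i))" if "\<gamma> i \<noteq> 0"
            using that by (auto simp: fun_eq_iff)
          moreover have "\<gamma> \<noteq> \<beta>(i := Suc (\<beta> i))" if "\<gamma> i = 0" using that by auto
          ultimately show "xop (\<lambda>_. 0) i (\<delta> \<beta>) \<gamma> = (\<delta> (\<beta>(i := Suc (\<beta> i))) \<gamma> :: 'k)"
            by (cases "\<gamma> i = 0") (simp_all add: xop_def \<delta>_def del: fun_upd_apply)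
        qed
        then have "F.A (t \<cdot> x i) (\<delta> \<beta>) \<gamma> = \<phi> \<gamma> (\<beta>(i := Suc (\<beta> i)))"
          using x(1) t bg idx_upd[OF bg(1) x(1)] by (simp add: F.A_mult F.A_xg del: fun_upd_apply)
        then show "F.A (\<sigma> (x i) \<cdot> t) (\<delta> \<beta>) \<gamma> = F.A (t \<cdot> x i) (\<delta> \<beta>) \<gamma>"
          using left[OF xg_closed[OF x(1)] bg] sx[OF x(1) bg(1)] by (simp add: \<phi>_def del: fun_upd_apply)
      qed (use x(1) t(1) Aut_closed[OF s] in auto)
      then have "\<sigma> (x i) \<cdot> (\<sigma> a \<cdot> t) = t \<cdot> (x i \<cdot> a)"
        unfolding x(3) using x(1,2) t(1) Aut_closed[OF s] by (simp flip: S.m_assoc)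
      then show ?case using x(1,2) t(1) Aut_closed[OF s] by (simp add: Aut_mult[OF s] S.m_assoc)
    next
      case (y i a)
      have "\<sigma> (y i) \<cdot> t = t \<cdot> y i"
      proof (rule F_eqI)
        fix \<beta> \<gamma> assume bg: "\<beta> \<in> Idx" "\<gamma> \<in> Idx"
        show "F.A (\<sigma> (y i) \<cdot> t) (\<delta> \<beta>) \<gamma> = F.A (t \<cdot> y i) (\<delta> \<beta>) \<gamma>"
        proof (cases "\<beta> i = 0")
          case True
          have "yop (\<lambda>_. 0) i (\<delta> \<beta>) = (\<lambda>_. 0 * (0::'k))"
            using True by (auto simp: yop_def \<delta>_def fun_eq_iff intro: exI[of _ i])
          then have "F.A (t \<cdot> y i) (\<delta> \<beta>) \<gamma> = 0"
            using y(1) t F.A_arg_scale[OF t(1), of 0 "\<lambda>_. 0" \<gamma>] by (simp add: F.A_mult F.A_yg)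
          then show ?thesis using left[OF yg_closed[OF y(1)] bg] sy0[OF y(1) bg(1) True] by simp
        next
          case False
          have "yop (\<lambda>_. 0) i (\<delta> \<beta>) = (\<delta> (\<beta>(i := \<beta> i - 1)) :: (nat \<Rightarrow> nat) \<Rightarrow> 'k)"
          proof
            fix \<gamma>
            have "\<gamma>(i := Suc (\<gamma> i)) = \<beta> \<longleftrightarrow> \<gamma> = \<beta>(i := \<beta> i - 1)" using False by (auto simp: fun_eq_iff)
            then show "yop (\<lambda>_. 0) i (\<delta> \<beta>) \<gamma> = (\<delta> (\<beta>(i := \<beta> i - 1)) \<gamma> :: 'k)"
              by (simp add: yop_def \<delta>_def del: fun_upd_apply)
          qed
          then have "F.A (t \<cdot> y i) (\<delta> \<beta>) \<gamma> = \<phi> \<gamma> (\<beta>(i := \<beta> i - 1))"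
            using y(1) t bg idx_upd[OF bg(1) y(1)] by (simp add: F.A_mult F.A_yg del: fun_upd_apply)
          then show ?thesis
            using left[OF yg_closed[OF y(1)] bg] sy[OF y(1) bg(1) False] by (simp add: \<phi>_def del: fun_upd_apply)
        qed
      qed (use y(1) t(1) Aut_closed[OF s] in auto)
      then have "\<sigma> (y i) \<cdot> (\<sigma> a \<cdot> t) = t \<cdot> (y i \<cdot> a)"
        unfolding y(3) using y(1,2) t(1) Aut_closed[OF s] by (simp flip: S.m_assoc)
      then show ?case using y(1,2) t(1) Aut_closed[OF s] by (simp add: Aut_mult[OF s] S.m_assoc)
    }
  qed (use t(1) Aut_closed[OF s] in \<open>auto simp: Aut_zero[OF s] Aut_one[OF s] Aut_add[OF s] S.l_distr S.r_distr\<close>)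
  ultimately show ?thesis using t(1) by blast
qed

text \<open>Moving \<open>a\<close> to the left past \<open>u\<close> and then past \<open>t\<close>
  applies \<rho> and then \<sigma>, which cancel; so the product is central and hence a scalar. It
  is nonzero because \<open>t \<cdot> c \<cdot> u = \<sigma> c \<cdot> (t \<cdot> u)\<close> for
  every \<open>c\<close>, and the algebra is prime.\<close>

lemma intertwiners_product:
  assumes s: "\<sigma> \<in> Aut K n" and r: "\<rho> \<in> Aut K n" "\<forall>a\<in>carrier S. \<sigma> (\<rho> a) = a"
    and t: "t \<in> carrier S" "t \<noteq> \<zero>\<^bsub>S\<^esub>" "\<forall>a\<in>carrier S. \<sigma> a \<cdot> t = t \<cdot> a"
    and u: "u \<in> carrier S" "u \<noteq> \<zero>\<^bsub>S\<^esub>" "\<forall>a\<in>carrier S. \<rho> a \<cdot> u = u \<cdot> a"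
  shows "\<exists>k. k \<noteq> 0 \<and> t \<cdot> u = sc k"
proof -
  let ?z = "t \<cdot> u"
  have z: "?z \<in> carrier S" using t u by simp
  have comm: "?z \<cdot> a = a \<cdot> ?z" if a: "a \<in> carrier S" for a
  proof -
    have ra: "\<rho> a \<in> carrier S" "\<sigma> (\<rho> a) = a" using a r Aut_closed by auto
    have "?z \<cdot> a = t \<cdot> (u \<cdot> a)" using t(1) u(1) a by (simp add: S.m_assoc)
    also have "\<dots> = t \<cdot> (\<rho> a \<cdot> u)" using u(3) a by simp
    also have "\<dots> = (t \<cdot> \<rho> a) \<cdot> u" using t(1) u(1) ra by (simp add: S.m_assoc)
    also have "\<dots> = (\<sigma> (\<rho> a) \<cdot> t) \<cdot> u" using bspec[OF t(3) ra(1)] by simp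
    also have "\<dots> = a \<cdot> ?z" using t(1) u(1) a ra by (simp add: S.m_assoc)
    finally show ?thesis .
  qed
  define k where "k = F.A ?z (\<delta> (\<lambda>_. 0)) (\<lambda>_. 0)"
  have "F.A ?z g \<gamma> = k * g \<gamma>" if "\<gamma> \<in> Idx" for g \<gamma>
  proof -
    have "F.A (?z \<cdot> c) g \<gamma> = F.A (c \<cdot> ?z) g \<gamma>" if "c \<in> carrier S" for c g \<gamma>
      by (simp only: comm[OF that])
    from F.A_central[OF z this] show ?thesis unfolding k_def L_simps(1) using that by blast
  qed
  then have zk: "?z = sc k" by (intro F_eqI z) (auto simp: F_A_scal)
  moreover have "k \<noteq> 0"
  proof
    assume "k = 0"
    have "?z = \<zero>\<^bsub>S\<^esub>" by (rule F_eqI[OF z]) (auto simp: zk \<open>k = 0\<close> F_A_scal)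
    obtain \<beta> \<gamma> where 1: "\<gamma> \<in> Idx" "F.A t (\<delta> \<beta>) \<gamma> \<noteq> 0" using F_nonzero_entry[OF t(1,2)] by metis
    obtain \<beta>' \<gamma>' where 2: "\<gamma>' \<in> Idx" "F.A u (\<delta> \<beta>') \<gamma>' \<noteq> 0" using F_nonzero_entry[OF u(1,2)] by metis
    obtain c where c: "c \<in> carrier S" "F.A (t \<cdot> c \<cdot> u) (\<delta> \<beta>') \<gamma> \<noteq> 0"
      using F.A_prime[OF t(1) u(1), of \<gamma> \<gamma>' "\<delta> \<beta>" "\<delta> \<beta>'"] 1 2 by auto
    have "t \<cdot> c \<cdot> u = (\<sigma> c \<cdot> t) \<cdot> u" using bspec[OF t(3) c(1)] by simp
    also have "\<dots> = \<sigma> c \<cdot> ?z" using t(1) u(1) c(1) Aut_closed[OF s] by (simp add: S.m_assoc)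
    also have "\<dots> = \<zero>\<^bsub>S\<^esub>" using \<open>?z = \<zero>\<^bsub>S\<^esub>\<close> Aut_closed[OF s c(1)] by simp
    finally show False using c by simp
  qed
  ultimately show ?thesis by blast
qed

section \<open>Inner automorphisms from intertwiners\<close>

lemma scal_mult: "sc a \<cdot> sc b = sc (a * b)"
  by (rule F_eqI) (auto simp: F.A_mult F_A_scal)

lemma scal_one: "sc 1 = \<one>\<^bsub>S\<^esub>"
  by (rule F_eqI) (auto simp: F_A_scal)

lemma near_identity_Inn:
  assumes n: "near_identity \<sigma>"
  shows "\<sigma> \<in> Inn K n"
proof -
  have s: "\<sigma> \<in> Aut K n" using n by (simp add: near_identity_def)
  obtain \<rho> where r: "\<rho> \<in> Aut K n" "\<forall>a\<in>carrier S. \<rho> (\<sigma> a) = a" "\<forall>a\<in>carrier S. \<sigma> (\<rho> a) = a"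
    using s by (rule Aut_inverse)
  have "near_identity \<rho>"
    unfolding near_identity_def
  proof (intro conjI ballI r(1))
    fix i assume i: "i \<in> {1..n}"
    have pi: "\<sigma> a \<in> p i \<longleftrightarrow> a \<in> p i" if "a \<in> carrier S" for a using n i that by (simp add: near_identity_def)
    show pi': "\<rho> a \<in> p i \<longleftrightarrow> a \<in> p i" if a: "a \<in> carrier S" for a
      using pi[OF Aut_closed[OF r(1) a]] bspec[OF r(3) a] by simp
    have neg: "b \<boxminus> a \<in> p i" if "a \<boxminus> b \<in> p i" "a \<in> carrier S" "b \<in> carrier S" for a b
      using that by (auto simp: p_diff_iff)
    show "\<rho> (x i) \<boxminus> x i \<in> p i" "\<rho> (y i) \<boxminus> y i \<in> p i"
    proof -
      have "\<rho> (\<sigma> a) \<boxminus> \<rho> a \<in> p i" if "\<sigma> a \<boxminus> a \<in> p i" "a \<in> carrier S" for a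
        using pi'[of "\<sigma> a \<boxminus> a"] that Aut_closed[OF s] by (simp add: Aut_diff[OF r(1)])
      then have "\<rho> a \<boxminus> a \<in> p i" if "\<sigma> a \<boxminus> a \<in> p i" "a \<in> carrier S" for a
        using that r(2) neg Aut_closed[OF r(1)] by simp
      then show "\<rho> (x i) \<boxminus> x i \<in> p i" "\<rho> (y i) \<boxminus> y i \<in> p i"
        using n i by (auto simp: near_identity_def)
    qed
  qed
  then obtain u where u: "u \<in> carrier S" "u \<noteq> \<zero>\<^bsub>S\<^esub>" "\<forall>a\<in>carrier S. \<rho> a \<cdot> u = u \<cdot> a"
    using ex_intertwiner by blast
  obtain t where t: "t \<in> carrier S" "t \<noteq> \<zero>\<^bsub>S\<^esub>" "\<forall>a\<in>carrier S. \<sigma> a \<cdot> t = t \<cdot> a"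
    using ex_intertwiner[OF n] by blast
  obtain k where k: "k \<noteq> 0" "t \<cdot> u = sc k" using intertwiners_product[OF s r(1,3) t u] by blast
  obtain k' where k': "k' \<noteq> 0" "u \<cdot> t = sc k'" using intertwiners_product[OF r(1) s r(2) u t] by blast
  \<comment> \<open>The two products give \<open>t\<close> a right and a left inverse with scalars
    that might differ a priori; uniqueness of inverses identifies them.\<close>
  have right: "t \<cdot> (u \<cdot> sc (inverse k)) = \<one>\<^bsub>S\<^esub>"
    using k t(1) u(1) by (simp add: scal_mult scal_one flip: S.m_assoc)
  have left: "(sc (inverse k') \<cdot> u) \<cdot> t = \<one>\<^bsub>S\<^esub>"
    using k' t(1) u(1) by (simp add: scal_mult scal_one S.m_assoc)
  have "sc (inverse k') \<cdot> u = u \<cdot> sc (inverse k)"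
    using S.inv_unique[OF left right] t(1) u(1) by simp
  then have tU: "t \<in> Units S"
    using left right t(1) u(1) unfolding Units_def by auto
  have "\<sigma> a = t \<cdot> a \<cdot> inv\<^bsub>S\<^esub> t" if a: "a \<in> carrier S" for a
  proof -
    have "\<sigma> a = \<sigma> a \<cdot> (t \<cdot> inv\<^bsub>S\<^esub> t)" using tU a Aut_closed[OF s] by simp
    also have "\<dots> = \<sigma> a \<cdot> t \<cdot> inv\<^bsub>S\<^esub> t" using tU a t(1) Aut_closed[OF s] by (simp add: S.m_assoc)
    also have "\<dots> = t \<cdot> a \<cdot> inv\<^bsub>S\<^esub> t" using bspec[OF t(3) a] by simp
    finally show ?thesis .
  qed
  then show ?thesis using s tU unfolding Inn_def by blast
qed

end

section \<open>The automorphism group\<close>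

text \<open>Conjugation by \<open>s \<otimes> t \<otimes> w\<close> is conjugation by
  \<open>t \<otimes> w\<close>, an element of the subgroup, followed by conjugation by
  \<open>s\<close>, which preserves \<open>T\<close> by assumption and \<open>N\<close> by
  normality.\<close>

lemma (in group) normal_set_mult:
  assumes T: "subgroup T G" and N: "N \<lhd> G" and A: "A \<subseteq> carrier G"
    and norm: "\<And>s t. s \<in> A \<Longrightarrow> t \<in> T \<Longrightarrow> s \<otimes> t \<otimes> inv s \<in> T"
    and dec: "\<And>g. g \<in> carrier G \<Longrightarrow> \<exists>s\<in>A. \<exists>t\<in>T. \<exists>w\<in>N. g = s \<otimes> t \<otimes> w"
  shows "(T <#> N) \<lhd> G"
proof -
  interpret T: subgroup T G by fact
  interpret N: normal N G by fact
  have mem: "t \<otimes> w \<in> T <#> N" if "t \<in> T" "w \<in> N" for t w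
    using that by (auto simp: set_mult_def)
  have sub: "subgroup (T <#> N) G"
  proof (rule subgroupI)
    show "T <#> N \<subseteq> carrier G" by (auto simp: set_mult_def)
    show "T <#> N \<noteq> {}" using mem[OF T.one_closed N.one_closed] by blast
  next
    fix a assume "a \<in> T <#> N"
    then obtain t w where a: "a = t \<otimes> w" "t \<in> T" "w \<in> N" by (auto simp: set_mult_def)
    have "inv a = inv t \<otimes> (t \<otimes> inv w \<otimes> inv t)"
      using a by (simp add: inv_mult_group m_assoc[symmetric])
    then show "inv a \<in> T <#> N" using a mem N.inv_op_closed2 by simp
  next
    fix a b assume "a \<in> T <#> N" "b \<in> T <#> N"
    then obtain t w t' w' where a: "a = t \<otimes> w" "t \<in> T" "w \<in> N" and b: "b = t' \<otimes> w'" "t' \<in> T" "w' \<in> N"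
      by (auto simp: set_mult_def)
    have "inv t' \<otimes> w \<otimes> t' \<in> N" using a b N.inv_op_closed1 by simp
    moreover have "a \<otimes> b = (t \<otimes> t') \<otimes> ((inv t' \<otimes> w \<otimes> t') \<otimes> w')"
    proof -
      have "(t \<otimes> t') \<otimes> ((inv t' \<otimes> w \<otimes> t') \<otimes> w') = t \<otimes> ((t' \<otimes> inv t') \<otimes> w) \<otimes> t' \<otimes> w'"
        using a(2,3) b(2,3) by (simp add: m_assoc del: r_inv Units_r_inv)
      then show ?thesis using a b by (simp add: m_assoc)
    qed
    ultimately show "a \<otimes> b \<in> T <#> N" using a b mem[of "t \<otimes> t'"] by simp
  qed
  interpret TN: subgroup "T <#> N" G by (rule sub)
  show ?thesis unfolding normal_inv_iff
  proof (intro conjI sub ballI)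
    fix g h assume g: "g \<in> carrier G" and h: "h \<in> T <#> N"
    obtain s t w where s: "s \<in> A" "t \<in> T" "w \<in> N" "g = s \<otimes> t \<otimes> w" using dec[OF g] by blast
    have sc: "s \<in> carrier G" using s A by auto
    define u where "u = t \<otimes> w"
    have u: "u \<in> T <#> N" unfolding u_def using s mem by blast
    then have "u \<otimes> h \<otimes> inv u \<in> T <#> N" using h by simp
    then obtain t' w' where k: "u \<otimes> h \<otimes> inv u = t' \<otimes> w'" "t' \<in> T" "w' \<in> N" by (auto simp: set_mult_def)
    have uc: "u \<in> carrier G" "h \<in> carrier G" using u h by auto
    have "g \<otimes> h \<otimes> inv g = s \<otimes> (u \<otimes> h \<otimes> inv u) \<otimes> inv s"
      using s(2-4) sc uc unfolding u_def by (simp add: inv_mult_group m_assoc)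
    also have "\<dots> = (s \<otimes> t' \<otimes> inv s) \<otimes> (s \<otimes> w' \<otimes> inv s)"
    proof -
      have "(s \<otimes> t' \<otimes> inv s) \<otimes> (s \<otimes> w' \<otimes> inv s) = s \<otimes> t' \<otimes> (inv s \<otimes> s) \<otimes> w' \<otimes> inv s"
        using sc k(2,3) by (simp add: m_assoc del: l_inv Units_l_inv)
      then show ?thesis using sc k by (simp add: m_assoc)
    qed
    finally show "g \<otimes> h \<otimes> inv g \<in> T <#> N"
      using norm[OF s(1) k(2)] N.inv_op_closed2[OF sc k(3)] mem by simp
  qed
qed

context sn_reps
begin

lemma Aut_eqI:
  assumes "\<sigma> \<in> Aut K n" "\<tau> \<in> Aut K n"
    and "\<And>i. i \<in> {1..n} \<Longrightarrow> \<sigma> (x i) = \<tau> (x i)" "\<And>i. i \<in> {1..n} \<Longrightarrow> \<sigma> (y i) = \<tau> (y i)"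
  shows "\<sigma> = \<tau>"
proof (rule extensionalityI[OF Aut_ext Aut_ext])
  fix a assume "a \<in> carrier S"
  then show "\<sigma> a = \<tau> a"
    by (induction rule: Sn_induct)
      (simp_all add: assms Aut_zero Aut_one Aut_add Aut_mult Aut_scal)
qed (use assms in auto)

section \<open>Monomial automorphisms\<close>

definition monomial_endo ::
  "(nat \<Rightarrow> nat) \<Rightarrow> (nat \<Rightarrow> 'k) \<Rightarrow> ((letter list \<Rightarrow> 'k) set \<Rightarrow> (letter list \<Rightarrow> 'k) set) \<Rightarrow> bool" where
  "monomial_endo \<tau> l h \<longleftrightarrow> (\<forall>a\<in>carrier S. h a \<in> carrier S) \<and>
    (\<forall>a\<in>carrier S. \<forall>b\<in>carrier S. h (a \<cdot> b) = h a \<cdot> h b \<and> h (a \<boxplus> b) = h a \<boxplus> h b) \<and>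
    (\<forall>c. h (sc c) = sc c) \<and> (\<forall>i\<in>{1..n}. h (x i) = sc (l i) \<cdot> x (\<tau> i) \<and>
       h (y i) = sc (inverse (l i)) \<cdot> y (\<tau> i))"

lemma monomial_endoD:
  assumes "monomial_endo \<tau> l h"
  shows "a \<in> carrier S \<Longrightarrow> h a \<in> carrier S"
    and "a \<in> carrier S \<Longrightarrow> b \<in> carrier S \<Longrightarrow> h (a \<cdot> b) = h a \<cdot> h b"
    and "a \<in> carrier S \<Longrightarrow> b \<in> carrier S \<Longrightarrow> h (a \<boxplus> b) = h a \<boxplus> h b"
    and "h (sc c) = sc c"
    and "i \<in> {1..n} \<Longrightarrow> h (x i) = sc (l i) \<cdot> x (\<tau> i)"
    and "i \<in> {1..n} \<Longrightarrow> h (y i) = sc (inverse (l i)) \<cdot> y (\<tau> i)"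
  using assms by (simp_all add: monomial_endo_def)

text \<open>The endomorphism is conjugation by the operator \<open>g \<mapsto> (\<lambda>\<gamma>. W \<gamma> * g (\<gamma> \<circ> \<tau>))\<close>,
  which intertwines the faithful representation with its twist.\<close>
lemma ex_monomial_endo:
  assumes perm: "\<tau> permutes {1..n}" and l: "\<And>i. i \<in> {1..n} \<Longrightarrow> l i \<noteq> 0"
  shows "\<exists>h. monomial_endo \<tau> l h"
proof -
  \<comment> \<open>The weights are chosen so that raising the exponent at \<open>\<tau> i\<close>
    multiplies by \<open>l i\<close>; they produce the scalar factors, while the composition with
    \<tau> in \<open>Q\<close> produces the permutation.\<close>
  define W :: "(nat \<Rightarrow> nat) \<Rightarrow> 'k" where "W \<gamma> = (\<Prod>i\<in>{1..n}. l i ^ \<gamma> (\<tau> i))" for \<gamma>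
  define Q :: "((nat \<Rightarrow> nat) \<Rightarrow> 'k) \<Rightarrow> (nat \<Rightarrow> nat) \<Rightarrow> 'k" where "Q g \<gamma> = W \<gamma> * g (\<gamma> \<circ> \<tau>)" for g \<gamma>
  \<comment> \<open>\<open>rel a b\<close> expresses that \<open>b\<close> is the conjugate of
    \<open>a\<close> by \<open>Q\<close> without inverting \<open>Q\<close>. It is a relation
    compatible with the ring operations, and turns into a function through \<open>ex\<close> and
    \<open>uniq\<close>.\<close>
  define rel where "rel a b \<longleftrightarrow> (\<forall>g. \<forall>\<gamma>\<in>Idx. F.A b (Q g) \<gamma> = Q (F.A a g) \<gamma>)" for a b
  have inj: "\<tau> i = \<tau> j \<longleftrightarrow> i = j" for i j using permutes_inj[OF perm] by (auto dest: injD)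
  have \<tau>_mem: "\<tau> i \<in> {1..n}" if "i \<in> {1..n}" for i using permutes_in_image[OF perm] that by blast
  have W: "W \<gamma> \<noteq> 0" for \<gamma> using l by (simp add: W_def)
  have comp_Idx: "\<gamma> \<circ> \<tau> \<in> Idx" if "\<gamma> \<in> Idx" for \<gamma>
    using that permutes_not_in[OF perm] unfolding idx_def by auto
  have comp_upd: "(\<gamma>(\<tau> i := k)) \<circ> \<tau> = (\<gamma> \<circ> \<tau>)(i := k)" for \<gamma> i k by (auto simp: fun_eq_iff inj)
  have W_Suc: "W (\<gamma>(\<tau> i := Suc (\<gamma> (\<tau> i)))) = l i * W \<gamma>" if i: "i \<in> {1..n}" for \<gamma> i
  proof -
    have "(\<Prod>j\<in>{1..n} - {i}. l j ^ (\<gamma>(\<tau> i := Suc (\<gamma> (\<tau> i)))) (\<tau> j)) = (\<Prod>j\<in>{1..n} - {i}. l j ^ \<gamma> (\<tau> j))"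
      by (intro prod.cong) (auto simp: inj)
    moreover have "W \<epsilon> = l i ^ \<epsilon> (\<tau> i) * (\<Prod>j\<in>{1..n} - {i}. l j ^ \<epsilon> (\<tau> j))" for \<epsilon>
      unfolding W_def by (rule prod.remove) (use i in auto)
    ultimately show ?thesis by (simp add: mult.assoc del: fun_upd_apply add: fun_upd_same)
  qed
  have W_pred: "W \<gamma> = l i * W (\<gamma>(\<tau> i := \<gamma> (\<tau> i) - 1))" if "i \<in> {1..n}" "\<gamma> (\<tau> i) \<noteq> 0" for \<gamma> i
    using W_Suc[OF that(1), of "\<gamma>(\<tau> i := \<gamma> (\<tau> i) - 1)"] that(2) by simp
  have rel_x: "rel (x i) (sc (l i) \<cdot> x (\<tau> i))" if i: "i \<in> {1..n}" for i
    unfolding rel_def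
  proof (intro allI ballI)
    fix g \<gamma>
    show "F.A (sc (l i) \<cdot> x (\<tau> i)) (Q g) \<gamma> = Q (F.A (x i) g) \<gamma>"
    proof (cases "\<gamma> (\<tau> i) = 0")
      case False
      then have "Q (xop (\<lambda>_. 0) i g) \<gamma> = l i * W (\<gamma>(\<tau> i := \<gamma> (\<tau> i) - 1)) * g ((\<gamma> \<circ> \<tau>)(i := \<gamma> (\<tau> i) - 1))"
        using W_pred[of i \<gamma>, OF i False] by (simp add: Q_def xop_def del: fun_upd_apply)
      moreover have "xop (\<lambda>_. 0) (\<tau> i) (Q g) \<gamma> = W (\<gamma>(\<tau> i := \<gamma> (\<tau> i) - 1)) * g ((\<gamma> \<circ> \<tau>)(i := \<gamma> (\<tau> i) - 1))"
        using False by (simp add: Q_def xop_def comp_upd del: fun_upd_apply)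
      ultimately show ?thesis using i \<tau>_mem[OF i] by (simp add: F.A_mult F.A_xg F_A_scal mult.assoc del: fun_upd_apply)
    qed (use i \<tau>_mem[OF i] in \<open>simp add: F.A_mult F.A_xg F_A_scal Q_def xop_def\<close>)
  qed
  have rel_y: "rel (y i) (sc (inverse (l i)) \<cdot> y (\<tau> i))" if i: "i \<in> {1..n}" for i
    unfolding rel_def
  proof (intro allI ballI)
    fix g \<gamma>
    have "yop (\<lambda>_. 0) (\<tau> i) (Q g) \<gamma> = l i * W \<gamma> * g ((\<gamma> \<circ> \<tau>)(i := Suc (\<gamma> (\<tau> i))))"
      using W_Suc[OF i] by (simp add: Q_def yop_def comp_upd del: fun_upd_apply)
    moreover have "Q (yop (\<lambda>_. 0) i g) \<gamma> = W \<gamma> * g ((\<gamma> \<circ> \<tau>)(i := Suc (\<gamma> (\<tau> i))))"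
      by (simp add: Q_def yop_def del: fun_upd_apply)
    ultimately show "F.A (sc (inverse (l i)) \<cdot> y (\<tau> i)) (Q g) \<gamma> = Q (F.A (y i) g) \<gamma>"
      using i \<tau>_mem[OF i] l[OF i] by (simp add: F.A_mult F.A_yg F_A_scal mult.assoc del: fun_upd_apply)
  qed
  have rel_sc: "rel (sc c) (sc c)" for c by (simp add: rel_def F_A_scal Q_def)
  have rel_add: "rel (a \<boxplus> b) (a' \<boxplus> b')"
    if "rel a a'" "rel b b'" "a \<in> carrier S" "b \<in> carrier S" "a' \<in> carrier S" "b' \<in> carrier S" for a b a' b'
    using that comp_Idx by (simp add: rel_def F.A_add Q_def distrib_left)
  have rel_mult: "rel (a \<cdot> b) (a' \<cdot> b')"
    if r: "rel a a'" "rel b b'" and cl: "a \<in> carrier S" "b \<in> carrier S" "a' \<in> carrier S" "b' \<in> carrier S" for a b a' b'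
    unfolding rel_def
  proof (intro allI ballI)
    fix g \<gamma> assume g: "\<gamma> \<in> Idx"
    have "F.A a' (F.A b' (Q g)) \<gamma> = F.A a' (Q (F.A b g)) \<gamma>"
      using r(2) cl g by (intro F_A_cong) (auto simp: rel_def)
    also have "\<dots> = Q (F.A a (F.A b g)) \<gamma>" using r(1) g by (simp add: rel_def)
    finally show "F.A (a' \<cdot> b') (Q g) \<gamma> = Q (F.A (a \<cdot> b) g) \<gamma>" using cl by (simp add: F.A_mult)
  qed
  have uniq: "b = b'" if r: "rel a b" "rel a b'" and cl: "b \<in> carrier S" "b' \<in> carrier S" for a b b'
  proof (rule F_eqI[OF cl])
    fix \<beta> \<gamma> assume bg: "\<beta> \<in> Idx" "\<gamma> \<in> Idx"
    \<comment> \<open>A preimage of the basis vector under \<open>Q\<close>; hence \<open>b\<close>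
      and \<open>b'\<close> agree on every basis vector.\<close>
    define g where "g \<epsilon> = \<delta> \<beta> (\<epsilon> \<circ> inv_into UNIV \<tau>) / W (\<epsilon> \<circ> inv_into UNIV \<tau>)" for \<epsilon>
    have "Q g \<epsilon> = \<delta> \<beta> \<epsilon>" for \<epsilon>
      using W permutes_inv_o(1)[OF perm] by (simp add: Q_def g_def o_assoc[symmetric])
    then have "Q g = \<delta> \<beta>" by auto
    then show "F.A b (\<delta> \<beta>) \<gamma> = F.A b' (\<delta> \<beta>) \<gamma>" using r bg by (metis rel_def)
  qed
  have zero: "sc 0 = \<zero>\<^bsub>S\<^esub>" by (rule F_eqI) (auto simp: F_A_scal)
  have ex: "\<exists>b\<in>carrier S. rel a b" if "a \<in> carrier S" for a
    using that
  proof (induction rule: Sn_induct)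
    case zero
    then show ?case using rel_sc[of 0] \<open>sc 0 = \<zero>\<^bsub>S\<^esub>\<close> by (metis S.zero_closed)
  next
    case one
    then show ?case using rel_sc[of 1] scal_one by (metis S.one_closed)
  next
    case (add a b)
    then obtain a' b' where "a' \<in> carrier S" "b' \<in> carrier S" "rel a a'" "rel b b'" by blast
    then show ?case using add(1,2) rel_add by (intro bexI[of _ "a' \<boxplus> b'"]) auto
  next
    case (scale c a)
    then obtain a' where "a' \<in> carrier S" "rel a a'" by blast
    then show ?case using scale(1) rel_mult rel_sc by (intro bexI[of _ "sc c \<cdot> a'"]) auto
  next
    case (x i a)
    then obtain a' where "a' \<in> carrier S" "rel a a'" by blast
    then show ?case using x(1,2) rel_mult rel_x \<tau>_mem[OF x(1)]
      by (intro bexI[of _ "sc (l i) \<cdot> x (\<tau> i) \<cdot> a'"]) auto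
  next
    case (y i a)
    then obtain a' where "a' \<in> carrier S" "rel a a'" by blast
    then show ?case using y(1,2) rel_mult rel_y \<tau>_mem[OF y(1)]
      by (intro bexI[of _ "sc (inverse (l i)) \<cdot> y (\<tau> i) \<cdot> a'"]) auto
  qed
  define h where "h a = (SOME b. b \<in> carrier S \<and> rel a b)" for a
  have h: "h a \<in> carrier S" "rel a (h a)" if "a \<in> carrier S" for a
    using someI_ex[of "\<lambda>b. b \<in> carrier S \<and> rel a b"] ex[OF that] unfolding h_def by blast+
  have hI: "h a = b" if "a \<in> carrier S" "b \<in> carrier S" "rel a b" for a b
    using uniq[OF h(2)[OF that(1)] that(3) h(1)[OF that(1)] that(2)] .
  show ?thesis
    unfolding monomial_endo_def
  proof (intro exI[of _ h] conjI ballI allI)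
    fix a b assume ab: "a \<in> carrier S" "b \<in> carrier S"
    show "h (a \<cdot> b) = h a \<cdot> h b"
      by (rule hI) (use ab h[OF ab(1)] h[OF ab(2)] rel_mult in auto)
    show "h (a \<boxplus> b) = h a \<boxplus> h b"
      by (rule hI) (use ab h[OF ab(1)] h[OF ab(2)] rel_add in auto)
  next
    fix i assume i: "i \<in> {1..n}"
    show "h (x i) = sc (l i) \<cdot> x (\<tau> i)"
      by (rule hI) (use i \<tau>_mem[OF i] rel_x[OF i] in auto)
    show "h (y i) = sc (inverse (l i)) \<cdot> y (\<tau> i)"
      by (rule hI) (use i \<tau>_mem[OF i] rel_y[OF i] in auto)
  next
    show "h (sc c) = sc c" for c by (rule hI) (auto intro: rel_sc)
  qed (rule h(1))
qed

text \<open>The inverse is again monomial, with the inverse permutation and the scalars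
  \<open>inverse (l (?\<rho> i))\<close>. Both composites fix the generators and therefore every
  element.\<close>

lemma ex_monomial_Aut:
  assumes perm: "\<tau> permutes {1..n}" and l: "\<And>i. i \<in> {1..n} \<Longrightarrow> l i \<noteq> 0"
  obtains \<sigma> where "\<sigma> \<in> Aut K n" "\<forall>i\<in>{1..n}. \<sigma> (x i) = sc (l i) \<cdot> x (\<tau> i) \<and>
     \<sigma> (y i) = sc (inverse (l i)) \<cdot> y (\<tau> i)"
proof -
  obtain h where "monomial_endo \<tau> l h" using ex_monomial_endo[of \<tau> l, OF perm] l by blast
  note h = monomial_endoD[OF this]
  let ?\<rho> = "inv_into UNIV \<tau>"
  let ?l = "\<lambda>i. inverse (l (?\<rho> i))"
  note perm' = permutes_inv[OF perm]
  have mem: "\<tau> i \<in> {1..n}" "?\<rho> i \<in> {1..n}" if "i \<in> {1..n}" for i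
    using permutes_in_image[OF perm] permutes_in_image[OF perm'] that by blast+
  have "?l i \<noteq> 0" if "i \<in> {1..n}" for i using l[OF mem(2)[OF that]] by simp
  then obtain k where "monomial_endo ?\<rho> ?l k" using ex_monomial_endo[of ?\<rho> ?l, OF perm'] by blast
  note k = monomial_endoD[OF this]
  have inv: "?\<rho> (\<tau> i) = i" "\<tau> (?\<rho> i) = i" for i
    using permutes_inverses[OF perm] by auto
  have id: "f a = a" if a: "a \<in> carrier S"
    and f: "\<And>a b. a \<in> carrier S \<Longrightarrow> b \<in> carrier S \<Longrightarrow> f (a \<cdot> b) = f a \<cdot> f b"
    "\<And>a b. a \<in> carrier S \<Longrightarrow> b \<in> carrier S \<Longrightarrow> f (a \<boxplus> b) = f a \<boxplus> f b"
    "\<And>c. f (sc c) = sc c" "\<And>i. i \<in> {1..n} \<Longrightarrow> f (x i) = x i" "\<And>i. i \<in> {1..n} \<Longrightarrow> f (y i) = y i"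
    for f a
  proof -
    have "sc 0 = \<zero>\<^bsub>S\<^esub>" by (rule F_eqI) (auto simp: F_A_scal)
    then have z: "f \<zero>\<^bsub>S\<^esub> = \<zero>\<^bsub>S\<^esub>" using f(3)[of 0] by simp
    show ?thesis using a by (induction rule: Sn_induct) (use f(3)[of 1] scal_one in \<open>simp_all add: z f\<close>)
  qed
  have assoc: "sc c \<cdot> (sc d \<cdot> a) = sc (c * d) \<cdot> a" if "a \<in> carrier S" for c d a
    using that by (simp add: scal_mult flip: S.m_assoc)
  have kh: "k (h a) = a" if "a \<in> carrier S" for a
    by (rule id[OF that, of "\<lambda>a. k (h a)"]) (use mem l in \<open>simp_all add: h k inv assoc scal_one\<close>)
  have hk: "h (k a) = a" if "a \<in> carrier S" for a
    by (rule id[OF that, of "\<lambda>a. h (k a)"]) (use mem l in \<open>simp_all add: h k inv assoc scal_one\<close>)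
  have bij: "bij_betw h (carrier S) (carrier S)"
    by (rule bij_betw_byWitness[of _ k]) (use h(1) k(1) kh hk in auto)
  have "restrict h (carrier S) \<in> Aut K n"
    by (rule AutI) (use h bij in \<open>auto cong: bij_betw_cong\<close>)
  then show ?thesis using that[of "restrict h (carrier S)"] h(5,6) by simp
qed

section \<open>The automorphism group and its subgroups\<close>

lemma Gn_simps [simp]: "carrier (Gn K n) = Aut K n"
  "\<one>\<^bsub>Gn K n\<^esub> = restrict id (carrier S)"
  "\<sigma> \<otimes>\<^bsub>Gn K n\<^esub> \<tau> = compose (carrier S) \<sigma> \<tau>"
  by (simp_all add: Gn_def)

lemma id_Aut: "restrict id (carrier S) \<in> Aut K n"
  by (rule AutI) (auto simp: bij_betw_def inj_on_def)

lemma compose_Aut: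
  assumes "\<sigma> \<in> Aut K n" "\<tau> \<in> Aut K n"
  shows "compose (carrier S) \<sigma> \<tau> \<in> Aut K n"
  using assms bij_betw_compose[OF Aut_bij[OF assms(2)] Aut_bij[OF assms(1)]]
  by (intro AutI) (auto simp: compose_eq Aut_closed Aut_mult Aut_add Aut_scal)

lemma group_Gn: "group (Gn K n)"
proof (rule groupI)
  fix \<sigma> \<tau> \<rho> assume "\<sigma> \<in> carrier (Gn K n)" "\<tau> \<in> carrier (Gn K n)" "\<rho> \<in> carrier (Gn K n)"
  then show "\<sigma> \<otimes>\<^bsub>Gn K n\<^esub> \<tau> \<otimes>\<^bsub>Gn K n\<^esub> \<rho> = \<sigma> \<otimes>\<^bsub>Gn K n\<^esub> (\<tau> \<otimes>\<^bsub>Gn K n\<^esub> \<rho>)"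
    using compose_assoc[of \<rho> "carrier S" "carrier S" \<sigma> \<tau>] Aut_closed[of \<rho>] by simp
next
  fix \<sigma> assume s: "\<sigma> \<in> carrier (Gn K n)"
  then show "\<one>\<^bsub>Gn K n\<^esub> \<otimes>\<^bsub>Gn K n\<^esub> \<sigma> = \<sigma>"
    by (intro extensionalityI[where A = "carrier S"]) (auto simp: compose_eq Aut_closed Aut_ext)
  have s': "\<sigma> \<in> Aut K n" using s by simp
  obtain \<rho> where r: "\<rho> \<in> Aut K n" "\<forall>a\<in>carrier S. \<rho> (\<sigma> a) = a" using Aut_inverse[OF s'] by metis
  then have "\<rho> \<otimes>\<^bsub>Gn K n\<^esub> \<sigma> = \<one>\<^bsub>Gn K n\<^esub>"
    by (intro extensionalityI[where A = "carrier S"]) (auto simp: compose_eq)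
  then show "\<exists>\<rho>\<in>carrier (Gn K n). \<rho> \<otimes>\<^bsub>Gn K n\<^esub> \<sigma> = \<one>\<^bsub>Gn K n\<^esub>" using r(1) by auto
qed (auto simp: compose_Aut id_Aut)

sublocale G: group "Gn K n" by (rule group_Gn)

lemma inv_Aut:
  assumes "\<sigma> \<in> Aut K n"
  shows "inv\<^bsub>Gn K n\<^esub> \<sigma> \<in> Aut K n" "a \<in> carrier S \<Longrightarrow> (inv\<^bsub>Gn K n\<^esub> \<sigma>) (\<sigma> a) = a"
    "a \<in> carrier S \<Longrightarrow> \<sigma> ((inv\<^bsub>Gn K n\<^esub> \<sigma>) a) = a"
proof -
  show "inv\<^bsub>Gn K n\<^esub> \<sigma> \<in> Aut K n" using G.inv_closed[of \<sigma>] assms by simp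
  show "a \<in> carrier S \<Longrightarrow> (inv\<^bsub>Gn K n\<^esub> \<sigma>) (\<sigma> a) = a"
    using fun_cong[OF G.l_inv[of \<sigma>], of a] assms by (simp add: compose_eq)
  show "a \<in> carrier S \<Longrightarrow> \<sigma> ((inv\<^bsub>Gn K n\<^esub> \<sigma>) a) = a"
    using fun_cong[OF G.r_inv[of \<sigma>], of a] assms by (simp add: compose_eq)
qed

lemma inv_Aut_eqI: "\<sigma> \<in> Aut K n \<Longrightarrow> a \<in> carrier S \<Longrightarrow> \<sigma> a = b \<Longrightarrow> (inv\<^bsub>Gn K n\<^esub> \<sigma>) b = a"
  using inv_Aut(2) by auto

lemma subgroup_SymG: "subgroup (SymG K n) (Gn K n)"
proof (rule G.subgroupI)
  show "SymG K n \<subseteq> carrier (Gn K n)" by (auto simp: SymG_def)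
  have "restrict id (carrier S) \<in> SymG K n"
    unfolding SymG_def using id_Aut by (auto intro!: exI[of _ id])
  then show "SymG K n \<noteq> {}" by blast
next
  fix \<sigma> assume "\<sigma> \<in> SymG K n"
  then obtain \<tau> where s: "\<sigma> \<in> Aut K n" and t: "bij_betw \<tau> {1..n} {1..n}"
    "\<forall>i\<in>{1..n}. \<sigma> (x i) = x (\<tau> i) \<and> \<sigma> (y i) = y (\<tau> i)" by (auto simp: SymG_def)
  have mem: "inv_into {1..n} \<tau> j \<in> {1..n}" "\<tau> (inv_into {1..n} \<tau> j) = j" if "j \<in> {1..n}" for j
    using that t(1) bij_betw_inv_into_right[OF t(1)] bij_betwE[OF bij_betw_inv_into[OF t(1)]] by auto
  have "(inv\<^bsub>Gn K n\<^esub> \<sigma>) (x j) = x (inv_into {1..n} \<tau> j)" "(inv\<^bsub>Gn K n\<^esub> \<sigma>) (y j) = y (inv_into {1..n} \<tau> j)"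
    if j: "j \<in> {1..n}" for j
    using inv_Aut_eqI[OF s xg_closed[OF mem(1)[OF j]]] inv_Aut_eqI[OF s yg_closed[OF mem(1)[OF j]]]
      bspec[OF t(2) mem(1)[OF j]] mem(2)[OF j] by simp_all
  then show "inv\<^bsub>Gn K n\<^esub> \<sigma> \<in> SymG K n"
    unfolding SymG_def using inv_Aut(1)[OF s] bij_betw_inv_into[OF t(1)] by blast
next
  fix \<sigma> \<rho> assume "\<sigma> \<in> SymG K n" "\<rho> \<in> SymG K n"
  then obtain \<tau> \<tau>' where s: "\<sigma> \<in> Aut K n" "bij_betw \<tau> {1..n} {1..n}"
    "\<forall>i\<in>{1..n}. \<sigma> (x i) = x (\<tau> i) \<and> \<sigma> (y i) = y (\<tau> i)"
    and r: "\<rho> \<in> Aut K n" "bij_betw \<tau>' {1..n} {1..n}"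
    "\<forall>i\<in>{1..n}. \<rho> (x i) = x (\<tau>' i) \<and> \<rho> (y i) = y (\<tau>' i)" by (auto simp: SymG_def)
  have "\<sigma> (\<rho> (x i)) = x ((\<tau> \<circ> \<tau>') i)" "\<sigma> (\<rho> (y i)) = y ((\<tau> \<circ> \<tau>') i)" if "i \<in> {1..n}" for i
    using that s(3) r(3) bij_betwE[OF r(2)] by auto
  then have "compose (carrier S) \<sigma> \<rho> \<in> SymG K n"
    unfolding SymG_def using compose_Aut[OF s(1) r(1)] bij_betw_trans[OF r(2) s(2)]
    by (auto simp: compose_eq intro!: exI[of _ "\<tau> \<circ> \<tau>'"])
  then show "\<sigma> \<otimes>\<^bsub>Gn K n\<^esub> \<rho> \<in> SymG K n" by simp
qed

lemma subgroup_Torus: "subgroup (Torus K n) (Gn K n)"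
proof (rule G.subgroupI)
  show "Torus K n \<subseteq> carrier (Gn K n)" by (auto simp: Torus_def)
  have "restrict id (carrier S) \<in> Torus K n"
    unfolding Torus_def using id_Aut by (auto simp: scal_one intro!: exI[of _ "\<lambda>_. 1"])
  then show "Torus K n \<noteq> {}" by blast
next
  fix \<sigma> assume "\<sigma> \<in> Torus K n"
  then obtain l where s: "\<sigma> \<in> Aut K n" and l: "\<forall>i\<in>{1..n}. l i \<noteq> 0"
    "\<forall>i\<in>{1..n}. \<sigma> (x i) = sc (l i) \<cdot> x i \<and> \<sigma> (y i) = sc (inverse (l i)) \<cdot> y i" by (auto simp: Torus_def)
  have "(inv\<^bsub>Gn K n\<^esub> \<sigma>) (x i) = sc (inverse (l i)) \<cdot> x i" "(inv\<^bsub>Gn K n\<^esub> \<sigma>) (y i) = sc (inverse (inverse (l i))) \<cdot> y i"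
    if i: "i \<in> {1..n}" for i
    by (rule inv_Aut_eqI[OF s]; use i l in
        \<open>simp add: Aut_mult[OF s] Aut_scal[OF s] scal_mult scal_one flip: S.m_assoc\<close>)+
  then show "inv\<^bsub>Gn K n\<^esub> \<sigma> \<in> Torus K n"
    unfolding Torus_def using inv_Aut(1)[OF s] l(1) by (auto intro!: exI[of _ "\<lambda>i. inverse (l i)"])
next
  fix \<sigma> \<rho> assume "\<sigma> \<in> Torus K n" "\<rho> \<in> Torus K n"
  then obtain l m where s: "\<sigma> \<in> Aut K n" and l: "\<forall>i\<in>{1..n}. l i \<noteq> 0"
    "\<forall>i\<in>{1..n}. \<sigma> (x i) = sc (l i) \<cdot> x i \<and> \<sigma> (y i) = sc (inverse (l i)) \<cdot> y i"
    and r: "\<rho> \<in> Aut K n" and m: "\<forall>i\<in>{1..n}. m i \<noteq> 0"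
    "\<forall>i\<in>{1..n}. \<rho> (x i) = sc (m i) \<cdot> x i \<and> \<rho> (y i) = sc (inverse (m i)) \<cdot> y i" by (auto simp: Torus_def)
  have "\<sigma> (\<rho> (x i)) = sc (m i * l i) \<cdot> x i" "\<sigma> (\<rho> (y i)) = sc (inverse (m i * l i)) \<cdot> y i"
    if i: "i \<in> {1..n}" for i
    using i l m by (simp_all add: Aut_mult[OF s] Aut_scal[OF s] scal_mult mult.commute flip: S.m_assoc)
  then have "compose (carrier S) \<sigma> \<rho> \<in> Torus K n"
    unfolding Torus_def using compose_Aut[OF s r] l(1) m(1)
    by (auto simp: compose_eq intro!: exI[of _ "\<lambda>i. m i * l i"])
  then show "\<sigma> \<otimes>\<^bsub>Gn K n\<^esub> \<rho> \<in> Torus K n" by simp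
qed

lemma normal_Inn: "Inn K n \<lhd> Gn K n"
  unfolding G.normal_inv_iff
proof (intro conjI ballI)
  show "subgroup (Inn K n) (Gn K n)"
  proof (rule G.subgroupI)
    show "Inn K n \<subseteq> carrier (Gn K n)" by (auto simp: Inn_def)
    have "restrict id (carrier S) \<in> Inn K n"
      unfolding Inn_def using id_Aut by (auto intro!: bexI[of _ "\<one>\<^bsub>S\<^esub>"])
    then show "Inn K n \<noteq> {}" by blast
  next
    fix \<sigma> assume "\<sigma> \<in> Inn K n"
    then obtain u where s: "\<sigma> \<in> Aut K n" and u: "u \<in> Units S" "\<forall>a\<in>carrier S. \<sigma> a = u \<cdot> a \<cdot> inv\<^bsub>S\<^esub> u"
      by (auto simp: Inn_def)
    have uc: "u \<in> carrier S" "inv\<^bsub>S\<^esub> u \<in> carrier S" using u(1) by auto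
    have "(inv\<^bsub>Gn K n\<^esub> \<sigma>) a = inv\<^bsub>S\<^esub> u \<cdot> a \<cdot> inv\<^bsub>S\<^esub> (inv\<^bsub>S\<^esub> u)" if a: "a \<in> carrier S" for a
    proof (rule inv_Aut_eqI[OF s])
      have "u \<cdot> (inv\<^bsub>S\<^esub> u \<cdot> a \<cdot> u) \<cdot> inv\<^bsub>S\<^esub> u = (u \<cdot> inv\<^bsub>S\<^esub> u) \<cdot> a \<cdot> (u \<cdot> inv\<^bsub>S\<^esub> u)"
        using a uc by (simp add: S.m_assoc del: S.Units_r_inv)
      then show "\<sigma> (inv\<^bsub>S\<^esub> u \<cdot> a \<cdot> inv\<^bsub>S\<^esub> (inv\<^bsub>S\<^esub> u)) = a" using u a uc by simp
    qed (use a uc u in auto)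
    then show "inv\<^bsub>Gn K n\<^esub> \<sigma> \<in> Inn K n"
      unfolding Inn_def using inv_Aut(1)[OF s] u(1) by blast
  next
    fix \<sigma> \<rho> assume "\<sigma> \<in> Inn K n" "\<rho> \<in> Inn K n"
    then obtain u v where s: "\<sigma> \<in> Aut K n" and u: "u \<in> Units S" "\<forall>a\<in>carrier S. \<sigma> a = u \<cdot> a \<cdot> inv\<^bsub>S\<^esub> u"
      and r: "\<rho> \<in> Aut K n" and v: "v \<in> Units S" "\<forall>a\<in>carrier S. \<rho> a = v \<cdot> a \<cdot> inv\<^bsub>S\<^esub> v"
      by (auto simp: Inn_def)
    have c: "u \<in> carrier S" "inv\<^bsub>S\<^esub> u \<in> carrier S" "v \<in> carrier S" "inv\<^bsub>S\<^esub> v \<in> carrier S" using u(1) v(1) by auto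
    have inv_uv: "inv\<^bsub>S\<^esub> (u \<cdot> v) = inv\<^bsub>S\<^esub> v \<cdot> inv\<^bsub>S\<^esub> u"
    proof (rule S.inv_char[symmetric, symmetric])
      have "u \<cdot> v \<cdot> (inv\<^bsub>S\<^esub> v \<cdot> inv\<^bsub>S\<^esub> u) = u \<cdot> (v \<cdot> inv\<^bsub>S\<^esub> v) \<cdot> inv\<^bsub>S\<^esub> u"
        using c by (simp add: S.m_assoc del: S.Units_r_inv)
      then show "u \<cdot> v \<cdot> (inv\<^bsub>S\<^esub> v \<cdot> inv\<^bsub>S\<^esub> u) = \<one>\<^bsub>S\<^esub>" using c u(1) v(1) by simp
      have "inv\<^bsub>S\<^esub> v \<cdot> inv\<^bsub>S\<^esub> u \<cdot> (u \<cdot> v) = inv\<^bsub>S\<^esub> v \<cdot> (inv\<^bsub>S\<^esub> u \<cdot> u) \<cdot> v"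
        using c by (simp add: S.m_assoc del: S.Units_l_inv)
      then show "inv\<^bsub>S\<^esub> v \<cdot> inv\<^bsub>S\<^esub> u \<cdot> (u \<cdot> v) = \<one>\<^bsub>S\<^esub>" using c u(1) v(1) by simp
    qed (use c in auto)
    have "\<sigma> (\<rho> a) = u \<cdot> v \<cdot> a \<cdot> inv\<^bsub>S\<^esub> (u \<cdot> v)" if a: "a \<in> carrier S" for a
      using a c u(2) v(2) unfolding inv_uv by (simp add: S.m_assoc)
    then have "compose (carrier S) \<sigma> \<rho> \<in> Inn K n"
      unfolding Inn_def using compose_Aut[OF s r] S.Units_m_closed[OF u(1) v(1)]
      by (auto simp: compose_eq)
    then show "\<sigma> \<otimes>\<^bsub>Gn K n\<^esub> \<rho> \<in> Inn K n" by simp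
  qed
next
  fix \<sigma> \<rho> assume s: "\<sigma> \<in> carrier (Gn K n)" and "\<rho> \<in> Inn K n"
  then obtain u where r: "\<rho> \<in> Aut K n" and u: "u \<in> Units S" "\<forall>a\<in>carrier S. \<rho> a = u \<cdot> a \<cdot> inv\<^bsub>S\<^esub> u"
    by (auto simp: Inn_def)
  have s': "\<sigma> \<in> Aut K n" using s by simp
  have uc: "u \<in> carrier S" "inv\<^bsub>S\<^esub> u \<in> carrier S" using u(1) by auto
  have inverses: "\<sigma> u \<cdot> \<sigma> (inv\<^bsub>S\<^esub> u) = \<one>\<^bsub>S\<^esub>" "\<sigma> (inv\<^bsub>S\<^esub> u) \<cdot> \<sigma> u = \<one>\<^bsub>S\<^esub>"
    using u(1) uc by (simp_all add: Aut_one[OF s'] flip: Aut_mult[OF s'])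
  have su: "\<sigma> u \<in> Units S" using inverses uc Aut_closed[OF s'] unfolding Units_def by blast
  have inv_su: "inv\<^bsub>S\<^esub> (\<sigma> u) = \<sigma> (inv\<^bsub>S\<^esub> u)"
    using inverses uc Aut_closed[OF s'] by (intro S.inv_char) auto
  have "\<sigma> (\<rho> ((inv\<^bsub>Gn K n\<^esub> \<sigma>) a)) = \<sigma> u \<cdot> a \<cdot> inv\<^bsub>S\<^esub> (\<sigma> u)" if a: "a \<in> carrier S" for a
  proof -
    have "(inv\<^bsub>Gn K n\<^esub> \<sigma>) a \<in> carrier S" using Aut_closed[OF inv_Aut(1)[OF s'] a] .
    then show ?thesis using u(2) uc inv_Aut(3)[OF s' a] by (simp add: Aut_mult[OF s'] inv_su)
  qed
  moreover have "compose (carrier S) (compose (carrier S) \<sigma> \<rho>) (inv\<^bsub>Gn K n\<^esub> \<sigma>) \<in> Aut K n"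
    using compose_Aut s' r inv_Aut(1) by blast
  ultimately have "compose (carrier S) (compose (carrier S) \<sigma> \<rho>) (inv\<^bsub>Gn K n\<^esub> \<sigma>) \<in> Inn K n"
    unfolding Inn_def using su Aut_closed[OF inv_Aut(1)[OF s']] by (auto simp: compose_eq)
  then show "\<sigma> \<otimes>\<^bsub>Gn K n\<^esub> \<rho> \<otimes>\<^bsub>Gn K n\<^esub> inv\<^bsub>Gn K n\<^esub> \<sigma> \<in> Inn K n" by simp
qed

text \<open>Conjugation only relabels the parameters: \<open>l\<close> becomes \<open>l\<close>
  composed with the inverse permutation.\<close>

lemma SymG_normalizes_Torus:
  assumes "\<sigma> \<in> SymG K n" "\<rho> \<in> Torus K n"
  shows "\<sigma> \<otimes>\<^bsub>Gn K n\<^esub> \<rho> \<otimes>\<^bsub>Gn K n\<^esub> inv\<^bsub>Gn K n\<^esub> \<sigma> \<in> Torus K n"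
proof -
  obtain \<tau> where s: "\<sigma> \<in> Aut K n" and t: "bij_betw \<tau> {1..n} {1..n}"
    "\<forall>i\<in>{1..n}. \<sigma> (x i) = x (\<tau> i) \<and> \<sigma> (y i) = y (\<tau> i)" using assms(1) by (auto simp: SymG_def)
  obtain l where r: "\<rho> \<in> Aut K n" and l: "\<forall>i\<in>{1..n}. l i \<noteq> 0"
    "\<forall>i\<in>{1..n}. \<rho> (x i) = sc (l i) \<cdot> x i \<and> \<rho> (y i) = sc (inverse (l i)) \<cdot> y i"
    using assms(2) by (auto simp: Torus_def)
  let ?\<tau> = "inv_into {1..n} \<tau>"
  have mem: "?\<tau> j \<in> {1..n}" "\<tau> (?\<tau> j) = j" if "j \<in> {1..n}" for j
    using that t(1) bij_betw_inv_into_right[OF t(1)] bij_betwE[OF bij_betw_inv_into[OF t(1)]] by auto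
  have "\<sigma> (\<rho> ((inv\<^bsub>Gn K n\<^esub> \<sigma>) (x j))) = sc (l (?\<tau> j)) \<cdot> x j"
    "\<sigma> (\<rho> ((inv\<^bsub>Gn K n\<^esub> \<sigma>) (y j))) = sc (inverse (l (?\<tau> j))) \<cdot> y j" if j: "j \<in> {1..n}" for j
  proof -
    have "(inv\<^bsub>Gn K n\<^esub> \<sigma>) (x j) = x (?\<tau> j)" "(inv\<^bsub>Gn K n\<^esub> \<sigma>) (y j) = y (?\<tau> j)"
      using inv_Aut_eqI[OF s xg_closed[OF mem(1)[OF j]]] inv_Aut_eqI[OF s yg_closed[OF mem(1)[OF j]]]
        bspec[OF t(2) mem(1)[OF j]] mem(2)[OF j] by simp_all
    then show "\<sigma> (\<rho> ((inv\<^bsub>Gn K n\<^esub> \<sigma>) (x j))) = sc (l (?\<tau> j)) \<cdot> x j"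
      "\<sigma> (\<rho> ((inv\<^bsub>Gn K n\<^esub> \<sigma>) (y j))) = sc (inverse (l (?\<tau> j))) \<cdot> y j"
      using mem[OF j] t(2) l(2) by (simp_all add: Aut_mult[OF s] Aut_scal[OF s])
  qed
  moreover have "compose (carrier S) (compose (carrier S) \<sigma> \<rho>) (inv\<^bsub>Gn K n\<^esub> \<sigma>) \<in> Aut K n"
    using compose_Aut s r inv_Aut(1) by blast
  ultimately have "compose (carrier S) (compose (carrier S) \<sigma> \<rho>) (inv\<^bsub>Gn K n\<^esub> \<sigma>) \<in> Torus K n"
    unfolding Torus_def using l(1) mem(1) Aut_closed[OF inv_Aut(1)[OF s]]
    by (auto simp: compose_eq intro!: exI[of _ "\<lambda>j. l (?\<tau> j)"])
  then show ?thesis by simp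
qed

lemma Aut_decomposition:
  assumes s: "\<sigma> \<in> Aut K n"
  shows "\<exists>\<tau>\<in>SymG K n. \<exists>t\<in>Torus K n. \<exists>\<omega>\<in>Inn K n. \<sigma> = \<tau> \<otimes>\<^bsub>Gn K n\<^esub> t \<otimes>\<^bsub>Gn K n\<^esub> \<omega>"
proof -
  obtain \<rho> where r: "\<rho> \<in> Aut K n" "\<forall>a\<in>carrier S. \<rho> (\<sigma> a) = a" "\<forall>a\<in>carrier S. \<sigma> (\<rho> a) = a"
    using s by (rule Aut_inverse)
  obtain \<iota> where \<iota>: "\<And>j. j \<in> {1..n} \<Longrightarrow> \<iota> j \<in> {1..n}"
    "\<And>j a. j \<in> {1..n} \<Longrightarrow> a \<in> carrier S \<Longrightarrow> \<sigma> a \<in> p j \<longleftrightarrow> a \<in> p (\<iota> j)"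
    using Aut_permutes_p[OF s] by metis
  have "inj_on \<iota> {1..n}"
  proof (rule inj_onI)
    fix j k assume jk: "j \<in> {1..n}" "k \<in> {1..n}" "\<iota> j = \<iota> k"
    have re: "\<rho> (e j) \<in> carrier S" "\<sigma> (\<rho> (e j)) = e j" using r(3) e_closed[OF jk(1)] Aut_closed[OF r(1)] by auto
    then have "e j \<in> p k" using \<iota>(2)[OF jk(1) re(1)] \<iota>(2)[OF jk(2) re(1)] jk e_in_p_iff[OF jk(1) jk(1)] by simp
    then show "j = k" using e_in_p_iff[OF jk(2,1)] by simp
  qed
  moreover have "\<iota> ` {1..n} \<subseteq> {1..n}" using \<iota>(1) by blast
  ultimately have bij: "bij_betw \<iota> {1..n} {1..n}"
    using endo_inj_surj[OF finite_atLeastAtMost] by (simp add: bij_betw_def)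
  \<comment> \<open>The image of \<open>p (\<iota> j)\<close> is \<open>p j\<close>, so the
    permutation that is wanted is the inverse of \<open>\<iota>\<close>. It is extended by the
    identity, as \<open>permutes\<close> demands.\<close>
  define \<tau> where "\<tau> i = (if i \<in> {1..n} then inv_into {1..n} \<iota> i else i)" for i
  have "bij_betw \<tau> {1..n} {1..n}"
    using bij_betw_inv_into[OF bij] by (rule bij_betw_cong[THEN iffD1, rotated]) (simp add: \<tau>_def)
  then have perm: "\<tau> permutes {1..n}" by (rule bij_imp_permutes) (auto simp: \<tau>_def)
  have mem: "\<tau> i \<in> {1..n}" if "i \<in> {1..n}" for i using permutes_in_image[OF perm] that by blast
  have \<iota>\<tau>: "\<iota> (\<tau> i) = i" if "i \<in> {1..n}" for i
    using that bij_betw_inv_into_right[OF bij] by (simp add: \<tau>_def)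
  have pp: "\<forall>a\<in>carrier S. \<sigma> a \<in> p (\<tau> i) \<longleftrightarrow> a \<in> p i" if i: "i \<in> {1..n}" for i
    using \<iota>(2)[OF mem[OF i]] \<iota>\<tau>[OF i] by simp
  have "\<forall>i\<in>{1..n}. \<exists>l. l \<noteq> 0 \<and> \<sigma> (x i) \<boxminus> sc l \<cdot> x (\<tau> i) \<in> p (\<tau> i) \<and>
      \<sigma> (y i) \<boxminus> sc (inverse l) \<cdot> y (\<tau> i) \<in> p (\<tau> i)"
    using Aut_generators_mod_p[OF s _ mem pp] by blast
  then obtain l where l: "\<And>i. i \<in> {1..n} \<Longrightarrow> l i \<noteq> 0"
    "\<And>i. i \<in> {1..n} \<Longrightarrow> \<sigma> (x i) \<boxminus> sc (l i) \<cdot> x (\<tau> i) \<in> p (\<tau> i)"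
    "\<And>i. i \<in> {1..n} \<Longrightarrow> \<sigma> (y i) \<boxminus> sc (inverse (l i)) \<cdot> y (\<tau> i) \<in> p (\<tau> i)"
    by metis
  obtain w where w: "w \<in> Aut K n" "\<forall>i\<in>{1..n}. w (x i) = sc 1 \<cdot> x (\<tau> i) \<and> w (y i) = sc (inverse 1) \<cdot> y (\<tau> i)"
    using ex_monomial_Aut[OF perm, of "\<lambda>_. 1"] by auto
  have wS: "w \<in> SymG K n" unfolding SymG_def
    using w mem \<open>bij_betw \<tau> {1..n} {1..n}\<close> by (auto simp: scal_one intro!: exI[of _ \<tau>])
  have w': "\<And>i. i \<in> {1..n} \<Longrightarrow> w (x i) = x (\<tau> i) \<and> w (y i) = y (\<tau> i)" using w(2) mem by (simp add: scal_one)
  obtain t where t: "t \<in> Aut K n" "\<forall>i\<in>{1..n}. t (x i) = sc (l i) \<cdot> x (id i) \<and> t (y i) = sc (inverse (l i)) \<cdot> y (id i)"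
    using ex_monomial_Aut[OF permutes_id, of l] l(1) by blast
  have tT: "t \<in> Torus K n" unfolding Torus_def using t l(1) by (auto intro!: exI[of _ l])
  define h where "h = compose (carrier S) w t"
  have h: "h \<in> Aut K n" unfolding h_def by (rule compose_Aut[OF w(1) t(1)])
  have hx: "h (x i) = sc (l i) \<cdot> x (\<tau> i)" "h (y i) = sc (inverse (l i)) \<cdot> y (\<tau> i)" if i: "i \<in> {1..n}" for i
    using i t(2) w'[OF i] by (simp_all add: h_def compose_eq Aut_mult[OF w(1)] Aut_scal[OF w(1)])
  \<comment> \<open>Serves to identify the image of \<open>p i\<close> under \<open>h\<close>: each
    of the primes is recognised by the single \<open>e j\<close> that it contains.\<close>
  have he: "h (e i) = e (\<tau> i)" if i: "i \<in> {1..n}" for i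
  proof -
    have "sc (l i) \<cdot> x (\<tau> i) \<cdot> (sc (inverse (l i)) \<cdot> y (\<tau> i)) = x (\<tau> i) \<cdot> y (\<tau> i)"
    proof -
      have "sc (l i) \<cdot> x (\<tau> i) \<cdot> (sc (inverse (l i)) \<cdot> y (\<tau> i)) =
          x (\<tau> i) \<cdot> (sc (l i) \<cdot> sc (inverse (l i))) \<cdot> y (\<tau> i)"
        using mem[OF i] by (simp add: scal_commute[of "x (\<tau> i)"] S.m_assoc)
      then show ?thesis using mem[OF i] l(1)[OF i] by (simp add: scal_mult scal_one)
    qed
    then show ?thesis using i mem[OF i] hx[OF i]
      by (simp add: e_def Aut_diff[OF h] Aut_mult[OF h] Aut_one[OF h])
  qed
  have hp: "h a \<in> p (\<tau> i) \<longleftrightarrow> a \<in> p i" if i: "i \<in> {1..n}" and a: "a \<in> carrier S" for i a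
  proof -
    obtain k where k: "k \<in> {1..n}" "\<forall>a\<in>carrier S. h a \<in> p (\<tau> i) \<longleftrightarrow> a \<in> p k"
      using Aut_permutes_p[OF h mem[OF i]] by blast
    have "e i \<in> p k" using k(2) he[OF i] e_in_p_iff[OF mem[OF i] mem[OF i]] e_closed[OF i] by auto
    then have "k = i" using e_in_p_iff[OF k(1) i] by simp
    then show ?thesis using k(2) a by blast
  qed
  define \<omega> where "\<omega> = compose (carrier S) (inv\<^bsub>Gn K n\<^esub> h) \<sigma>"
  have \<omega>: "\<omega> \<in> Aut K n" unfolding \<omega>_def by (rule compose_Aut[OF inv_Aut(1)[OF h] s])
  have h\<omega>: "h (\<omega> a) = \<sigma> a" if a: "a \<in> carrier S" for a
    using inv_Aut(3)[OF h Aut_closed[OF s a]] a by (simp add: \<omega>_def compose_eq)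
  have "near_identity \<omega>"
    unfolding near_identity_def
  proof (intro conjI ballI \<omega>)
    fix i assume i: "i \<in> {1..n}"
    show "\<omega> a \<in> p i \<longleftrightarrow> a \<in> p i" if a: "a \<in> carrier S" for a
      using hp[OF i Aut_closed[OF \<omega> a]] h\<omega>[OF a] bspec[OF pp[OF i] a] by simp
    have "h (\<omega> (x i) \<boxminus> x i) \<in> p (\<tau> i)" "h (\<omega> (y i) \<boxminus> y i) \<in> p (\<tau> i)"
      using i l(2,3)[OF i] hx[OF i] h\<omega> Aut_closed[OF \<omega>] by (simp_all add: Aut_diff[OF h])
    then show "\<omega> (x i) \<boxminus> x i \<in> p i" "\<omega> (y i) \<boxminus> y i \<in> p i"
      using hp[OF i] i Aut_closed[OF \<omega>] by auto
  qed
  then have \<omega>I: "\<omega> \<in> Inn K n" by (rule near_identity_Inn)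
  have "\<sigma> = compose (carrier S) h \<omega>"
    by (rule extensionalityI[OF Aut_ext[OF s], of "compose (carrier S) h \<omega>"]) (auto simp: compose_eq h\<omega>)
  then have "\<sigma> = w \<otimes>\<^bsub>Gn K n\<^esub> t \<otimes>\<^bsub>Gn K n\<^esub> \<omega>" by (simp add: h_def)
  then show ?thesis using wS tT \<omega>I by blast
qed

section \<open>Characters and uniqueness of the decomposition\<close>

sublocale C: sn_rep K n ident \<mu> for \<mu>
  by unfold_locales (auto simp: ident_apply)

text \<open>If no \<open>\<mu> i\<close> is zero, all generators act as scalars and the
  representation reduces to the single index 0; this value is then the character with
  \<open>x i\<close> sent to \<open>\<mu> i\<close>.\<close>

definition chi :: "(nat \<Rightarrow> 'k) \<Rightarrow> (letter list \<Rightarrow> 'k) set \<Rightarrow> 'k" where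
  "chi \<mu> a = C.A \<mu> a (\<lambda>_. 1) (\<lambda>_. 0)"

context
  fixes \<mu> :: "nat \<Rightarrow> 'k"
  assumes \<mu>: "\<And>i. \<mu> i \<noteq> 0"
begin

lemma chi_mult:
  assumes "a \<in> carrier S" "b \<in> carrier S"
  shows "chi \<mu> (a \<cdot> b) = chi \<mu> a * chi \<mu> b"
proof -
  have "C.L \<mu> = {}" using \<mu> by (simp add: C.L_def)
  then have "C.Ix \<mu> = {\<lambda>_. 0}" by (auto simp: idx_def)
  then have "C.A \<mu> a (C.A \<mu> b (\<lambda>_. 1)) (\<lambda>_. 0) = C.A \<mu> a (\<lambda>_. chi \<mu> b * 1) (\<lambda>_. 0)"
    using assms by (intro C.A_cong) (auto simp: chi_def)
  also have "\<dots> = chi \<mu> b * chi \<mu> a" unfolding chi_def by (rule C.A_arg_scale[OF assms(1)])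
  finally show ?thesis using C.A_mult[OF assms, of \<mu> "\<lambda>_. 1"] by (simp add: chi_def mult.commute)
qed

lemma chi_scal: "chi \<mu> (sc c) = c"
  using C.A_scal[of \<mu> c "\<lambda>_. 1" "\<lambda>_. 0"] ident_apply[of c] by (metis chi_def mult.right_neutral)

lemma chi_x: "i \<in> {1..n} \<Longrightarrow> chi \<mu> (x i) = \<mu> i"
  using \<mu> by (simp add: chi_def C.A_xg xop_def)

text \<open>Under \<open>h\<close>, the product of the two outer factors, the inner factor turns
  into conjugation by \<open>h u\<close>, and the values of \<open>h u\<close> and its inverse
  cancel in the commutative field.\<close>

lemma chi_decomposition:
  assumes w: "w \<in> Aut K n" "\<forall>i\<in>{1..n}. w (x i) = x (\<tau> i)" "i \<in> {1..n}" "\<tau> i \<in> {1..n}"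
    and t: "t \<in> Aut K n" "\<forall>i\<in>{1..n}. t (x i) = sc (l i) \<cdot> x i"
    and \<omega>: "\<omega> \<in> Inn K n"
  shows "chi \<mu> ((w \<otimes>\<^bsub>Gn K n\<^esub> t \<otimes>\<^bsub>Gn K n\<^esub> \<omega>) (x i)) = l i * \<mu> (\<tau> i)"
proof -
  obtain u where \<omega>A: "\<omega> \<in> Aut K n" and u: "u \<in> Units S" "\<forall>a\<in>carrier S. \<omega> a = u \<cdot> a \<cdot> inv\<^bsub>S\<^esub> u"
    using \<omega> by (auto simp: Inn_def)
  have uc: "u \<in> carrier S" "inv\<^bsub>S\<^esub> u \<in> carrier S" using u(1) by auto
  define h where "h = compose (carrier S) w t"
  have h: "h \<in> Aut K n" unfolding h_def by (rule compose_Aut[OF w(1) t(1)])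
  have hx: "h (x i) = sc (l i) \<cdot> x (\<tau> i)"
    using w(2,3) t(2) by (simp add: h_def compose_eq Aut_mult[OF w(1)] Aut_scal[OF w(1)])
  have cl: "h u \<in> carrier S" "h (inv\<^bsub>S\<^esub> u) \<in> carrier S" "h (x i) \<in> carrier S"
    using Aut_closed[OF h] uc w(3) by auto
  have "h u \<cdot> h (inv\<^bsub>S\<^esub> u) = \<one>\<^bsub>S\<^esub>" using u(1) uc by (simp add: Aut_one[OF h] flip: Aut_mult[OF h])
  then have one: "chi \<mu> (h u) * chi \<mu> (h (inv\<^bsub>S\<^esub> u)) = 1"
    using chi_mult[OF cl(1,2)] chi_scal[of 1] scal_one by simp
  have "(w \<otimes>\<^bsub>Gn K n\<^esub> t \<otimes>\<^bsub>Gn K n\<^esub> \<omega>) (x i) = h u \<cdot> h (x i) \<cdot> h (inv\<^bsub>S\<^esub> u)"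
    using u(2) uc w(3) by (simp add: compose_eq Aut_mult[OF h] flip: h_def)
  then have "chi \<mu> ((w \<otimes>\<^bsub>Gn K n\<^esub> t \<otimes>\<^bsub>Gn K n\<^esub> \<omega>) (x i)) = chi \<mu> (h u) * chi \<mu> (h (x i)) * chi \<mu> (h (inv\<^bsub>S\<^esub> u))"
    using cl by (simp add: chi_mult)
  also have "\<dots> = chi \<mu> (h (x i))" using one by (simp add: mult.commute mult.left_commute)
  also have "\<dots> = l i * \<mu> (\<tau> i)" using w(4) by (simp add: hx chi_mult chi_scal chi_x)
  finally show ?thesis .
qed

end

text \<open>The character with all \<open>\<mu> i = 1\<close> reads off the torus parameters. Once
  these agree, the character with value \<open>c\<close> at \<open>\<tau> i\<close> and 1 elsewhere
  distinguishes \<open>\<tau> i\<close> from any other index: \<open>c \<noteq> 1\<close> makes it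
  separate, \<open>c \<noteq> 0\<close> makes it a character. The inner factors then agree by
  cancellation.\<close>

lemma decomposition_unique:
  fixes c :: 'k
  assumes c: "c \<noteq> 0" "c \<noteq> 1"
    and w: "w \<in> SymG K n" "w' \<in> SymG K n" and t: "t \<in> Torus K n" "t' \<in> Torus K n"
    and \<omega>: "\<omega> \<in> Inn K n" "\<omega>' \<in> Inn K n"
    and eq: "w \<otimes>\<^bsub>Gn K n\<^esub> t \<otimes>\<^bsub>Gn K n\<^esub> \<omega> = w' \<otimes>\<^bsub>Gn K n\<^esub> t' \<otimes>\<^bsub>Gn K n\<^esub> \<omega>'"
  shows "w = w' \<and> t = t' \<and> \<omega> = \<omega>'"
proof -
  obtain \<tau> where wA: "w \<in> Aut K n" and \<tau>: "bij_betw \<tau> {1..n} {1..n}"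
    "\<forall>i\<in>{1..n}. w (x i) = x (\<tau> i) \<and> w (y i) = y (\<tau> i)" using w(1) by (auto simp: SymG_def)
  obtain \<tau>' where wA': "w' \<in> Aut K n" and \<tau>': "bij_betw \<tau>' {1..n} {1..n}"
    "\<forall>i\<in>{1..n}. w' (x i) = x (\<tau>' i) \<and> w' (y i) = y (\<tau>' i)" using w(2) by (auto simp: SymG_def)
  obtain l where tA: "t \<in> Aut K n" and l: "\<forall>i\<in>{1..n}. l i \<noteq> 0"
    "\<forall>i\<in>{1..n}. t (x i) = sc (l i) \<cdot> x i \<and> t (y i) = sc (inverse (l i)) \<cdot> y i"
    using t(1) by (auto simp: Torus_def)
  obtain l' where tA': "t' \<in> Aut K n" and l': "\<forall>i\<in>{1..n}. l' i \<noteq> 0"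
    "\<forall>i\<in>{1..n}. t' (x i) = sc (l' i) \<cdot> x i \<and> t' (y i) = sc (inverse (l' i)) \<cdot> y i"
    using t(2) by (auto simp: Torus_def)
  have key: "l i * \<mu> (\<tau> i) = l' i * \<mu> (\<tau>' i)" if i: "i \<in> {1..n}" and \<mu>: "\<And>i. \<mu> i \<noteq> 0" for i \<mu>
  proof -
    have "l i * \<mu> (\<tau> i) = chi \<mu> ((w \<otimes>\<^bsub>Gn K n\<^esub> t \<otimes>\<^bsub>Gn K n\<^esub> \<omega>) (x i))"
      by (rule chi_decomposition[OF \<mu> wA _ i _ tA _ \<omega>(1), symmetric]) (use \<tau> l i bij_betwE[OF \<tau>(1)] in auto)
    also have "\<dots> = l' i * \<mu> (\<tau>' i)"
      unfolding eq by (rule chi_decomposition[OF \<mu> wA' _ i _ tA' _ \<omega>(2)]) (use \<tau>' l' i bij_betwE[OF \<tau>'(1)] in auto)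
    finally show ?thesis .
  qed
  have ll: "l i = l' i" if "i \<in> {1..n}" for i using key[OF that, of "\<lambda>_. 1"] by simp
  have \<tau>\<tau>: "\<tau> i = \<tau>' i" if i: "i \<in> {1..n}" for i
  proof -
    let ?\<mu> = "\<lambda>j. if j = \<tau> i then c else 1"
    have "?\<mu> j \<noteq> 0" for j using c by simp
    from key[of i ?\<mu>, OF i this] show ?thesis
      using c ll[OF i] l(1) i by (auto split: if_splits)
  qed
  have ww: "w = w'" by (rule Aut_eqI[OF wA wA']) (use \<tau>(2) \<tau>'(2) \<tau>\<tau> in auto)
  have tt: "t = t'" by (rule Aut_eqI[OF tA tA']) (use l(2) l'(2) ll in auto)
  have "\<omega> \<in> carrier (Gn K n)" "\<omega>' \<in> carrier (Gn K n)" "w \<otimes>\<^bsub>Gn K n\<^esub> t \<in> carrier (Gn K n)"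
    using \<omega> compose_Aut[OF wA tA] by (auto simp: Inn_def)
  then have "\<omega> = \<omega>'" using eq G.l_cancel unfolding ww tt by blast
  then show ?thesis using ww tt by blast
qed

end

theorem theorem5p1:
  fixes K :: "'k::field_char_0 itself" and n :: nat
  assumes "n \<ge> 1"
  shows "group (Gn K n)
    \<and> subgroup (SymG K n) (Gn K n)
    \<and> subgroup (Torus K n) (Gn K n)
    \<and> Inn K n \<lhd> Gn K n
    \<and> (Torus K n <#>\<^bsub>Gn K n\<^esub> Inn K n) \<lhd> Gn K n
    \<and> (\<forall>\<sigma> \<in> carrier (Gn K n). \<exists>!p. case p of (\<tau>, t, \<omega>) \<Rightarrow>
          \<tau> \<in> SymG K n \<and> t \<in> Torus K n \<and> \<omega> \<in> Inn K n
          \<and> \<sigma> = \<tau> \<otimes>\<^bsub>Gn K n\<^esub> t \<otimes>\<^bsub>Gn K n\<^esub> \<omega>)"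
proof -
  interpret sn_reps K n .
  have dec: "\<exists>\<tau>\<in>SymG K n. \<exists>t\<in>Torus K n. \<exists>\<omega>\<in>Inn K n. \<sigma> = \<tau> \<otimes>\<^bsub>Gn K n\<^esub> t \<otimes>\<^bsub>Gn K n\<^esub> \<omega>"
    if "\<sigma> \<in> carrier (Gn K n)" for \<sigma>
    using Aut_decomposition[of \<sigma>] that unfolding Gn_simps(1) by blast
  have "(Torus K n <#>\<^bsub>Gn K n\<^esub> Inn K n) \<lhd> Gn K n"
    by (rule G.normal_set_mult[OF subgroup_Torus normal_Inn subgroup.subset[OF subgroup_SymG]
          SymG_normalizes_Torus dec])
  moreover have "\<exists>!p. case p of (\<tau>, t, \<omega>) \<Rightarrow> \<tau> \<in> SymG K n \<and> t \<in> Torus K n \<and> \<omega> \<in> Inn K n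
          \<and> \<sigma> = \<tau> \<otimes>\<^bsub>Gn K n\<^esub> t \<otimes>\<^bsub>Gn K n\<^esub> \<omega>" if s: "\<sigma> \<in> carrier (Gn K n)" for \<sigma>
  proof -
    obtain w t \<omega> where d: "w \<in> SymG K n" "t \<in> Torus K n" "\<omega> \<in> Inn K n" "\<sigma> = w \<otimes>\<^bsub>Gn K n\<^esub> t \<otimes>\<^bsub>Gn K n\<^esub> \<omega>"
      using dec[OF s] by blast
    \<comment> \<open>Characteristic zero enters here: 2 is an element of the field different from 0
      and 1.\<close>
    have two: "(2::'k) \<noteq> 0" "(2::'k) \<noteq> 1" by simp_all
    show ?thesis
    proof (rule ex1I[of _ "(w, t, \<omega>)"])
      fix q assume q: "case q of (\<tau>, t, \<omega>) \<Rightarrow> \<tau> \<in> SymG K n \<and> t \<in> Torus K n \<and> \<omega> \<in> Inn K n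
          \<and> \<sigma> = \<tau> \<otimes>\<^bsub>Gn K n\<^esub> t \<otimes>\<^bsub>Gn K n\<^esub> \<omega>"
      obtain w' t' \<omega>' where q_eq: "q = (w', t', \<omega>')" by (cases q)
      have "w' = w \<and> t' = t \<and> \<omega>' = \<omega>"
        by (rule decomposition_unique[OF two]) (use q d in \<open>auto simp: q_eq\<close>)
      then show "q = (w, t, \<omega>)" by (simp add: q_eq)
    qed (use d in simp)
  qed
  ultimately show ?thesis
    using group_Gn subgroup_SymG subgroup_Torus normal_Inn by blast
qed

end
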